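(* Let $\mathcal{F}$ be a family of pairs $(f,g)$ of non-negative measurable functions on $\mathbb{R}^n$. Let $0<\delta<1$ and $1<p_0<\infty$, and suppose that for all $w\in A_{p_0}$, $$\int_{\mathbb{R}^n}f(x)^{p_0}w(x)^{\delta}dx\le C_0\int_{\mathbb{R}^n}g(x)^{p_0}w(x)^{\delta}dx,\qquad (f,g)\in\mathcal{F}$$ (understood in the sense explained in the context). Let $p:\mathbb{R}^n\to(0,\infty)$ be measurable and let $p_*$ be a real number such that $$\frac{p_0}{1+\delta(p_0-1)}<p_*<p^-\le p^+<\frac{p_0}{1-\delta},$$ and suppose that $\delta_*\,(p(\cdot)/p_* )'\in\mathcal{B}(\mathbb{R}^n)$, where $\delta_*=\frac{p_0-p_*(1-\delta)}{p_0}$. Then there is a constant $C$ such that for all $(f,g)\in\mathcal{F}$ with $f\in L^{p(\cdot)}(\mathbb{R}^n)$, $$\|f\|_{p(\cdot)}\le C\|g\|_{p(\cdot)}.$$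
   Context: For a measurable $p:\mathbb{R}^n\to(0,\infty)$ put $p^-=\operatorname{ess\,inf}_{x}p(x)$, $p^+=\operatorname{ess\,sup}_{x}p(x)$. Variable Lebesgue space: for measurable $p$ with values in $[1,\infty)$ (a.e.), $L^{p(\cdot)}(\mathbb{R}^n)$ is the set of measurable $f$ such that $\int_{\mathbb{R}^n}(|f(x)|/\lambda)^{p(x)}dx<\infty$ for some $\lambda>0$, with norm $\|f\|_{p(\cdot)}=\inf\{\lambda>0:\int_{\mathbb{R}^n}(|f(x)|/\lambda)^{p(x)}dx\le1\}$. A norm is taken to be $+\infty$ if the function is not in the space. Conjugate exponent: $r'(\cdot)$ is defined pointwise by $1/r(x)+1/r'(x)=1$. $\mathcal{B}(\mathbb{R}^n)$ is the set of exponents $r:\mathbb{R}^n\to[1,\infty)$ (measurable) such that the Hardy–Littlewood maximal operator $Mf(x)=\sup_{\rho>0}\frac1{|B(x,\rho)|}\int_{B(x,\rho)}|f(y)|dy$ is bounded on $L^{r(\cdot)}(\mathbb{R}^n)$. A weight is a non-negative locally integrable function $w$ on $\mathbb{R}^n$. For $1<q<\infty$, $w\in A_q$ means there is a constant $C$ such that for every cube $Q\subset\mathbb{R}^n$, $\frac1{|Q|}\int_Q w\,dx\left(\frac1{|Q|}\int_Q w^{1-q'}dx\right)^{q-1}\le C$, where $1/q+1/q'=1$; the smallest such $C$ is the $A_q$ constant of $w$. Convention: saying that the weighted inequality holds for $(f,g)\in\mathcal{F}$ and $w\in A_{p_0}$ means that it holds for any pair in $\mathcal{F}$ for which its left-hand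 side is finite, with a constant $C_0$ depending only on $p_0$ and the $A_{p_0}$ constant of $w$ (here $\delta$ and $\mathcal{F}$ are fixed). *)

theory Defs
  imports "HOL-Analysis.Analysis" "HOL-Probability.Essential_Supremum"
begin

text \<open>
  Measurability and integration on \<open>real ^ 'n\<close> are with respect to Lebesgue measure.
  Functions are extended-real-valued so that the maximal function, which may be infinite,
  belongs to the same type; real-valued functions embed via \<open>ereal\<close>.
\<close>

text \<open>
  Real powers on \<open>[0,\<infinity>]\<close>. Negative powers of \<open>0\<close> are infinite, unlike \<open>0 powr a = 0\<close> on the
  reals; with the latter a weight vanishing on a set of positive measure could satisfy the
  \<open>A\<^sub>q\<close> condition.
\<close>

definition enn_powr :: "ennreal \<Rightarrow> real \<Rightarrow> ennreal" where
  "enn_powr x a =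
    (if a = 0 then 1
     else if x = 0 then (if a < 0 then \<infinity> else 0)
     else if x = \<infinity> then (if a < 0 then 0 else \<infinity>)
     else ennreal (enn2real x powr a))"

definition essinf :: "'a measure \<Rightarrow> ('a \<Rightarrow> ereal) \<Rightarrow> ereal" where
  "essinf M f = Sup {z. AE x in M. z \<le> f x}"

text \<open>
  The solution \<open>r'\<close> of \<open>1/r + 1/r' = 1\<close>; only meaningful for \<open>r > 1\<close> (in particular the value at
  \<open>r = 1\<close> is not infinity).
\<close>

definition conj_exponent :: "real \<Rightarrow> real" where
  "conj_exponent r = r / (r - 1)"

lemma conj_exponent_iff:
  assumes "1 < r"
  shows "s = conj_exponent r \<longleftrightarrow> s \<noteq> 0 \<and> 1 / r + 1 / s = 1"
proof
  assume "s = conj_exponent r"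
  then show "s \<noteq> 0 \<and> 1 / r + 1 / s = 1"
    using assms by (auto simp: conj_exponent_def divide_simps) (auto simp: algebra_simps)
next
  assume s: "s \<noteq> 0 \<and> 1 / r + 1 / s = 1"
  have "r \<noteq> 0"
    using assms by simp
  then have "s + r = r * s * (1 / r + 1 / s)"
    using conjunct1[OF s] by (simp add: distrib_left)
  also have "\<dots> = r * s"
    using s by simp
  finally have "s + r = r * s" .
  then have "s * (r - 1) = r"
    by (simp add: algebra_simps)
  then show "s = conj_exponent r"
    using assms by (simp add: conj_exponent_def eq_divide_eq)
qed


subsection \<open>Variable Lebesgue spaces\<close>

definition modular :: "(real ^ 'n \<Rightarrow> real) \<Rightarrow> (real ^ 'n \<Rightarrow> ereal) \<Rightarrow> real \<Rightarrow> ennreal" where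
  "modular p f t = (\<integral>\<^sup>+ x. enn_powr (e2ennreal \<bar>f x\<bar> / ennreal t) (p x) \<partial>lebesgue)"

definition var_Lebesgue :: "(real ^ 'n \<Rightarrow> real) \<Rightarrow> (real ^ 'n \<Rightarrow> ereal) set" where
  "var_Lebesgue p = {f \<in> borel_measurable lebesgue. \<exists>t>0. modular p f t < \<infinity>}"

definition var_norm :: "(real ^ 'n \<Rightarrow> real) \<Rightarrow> (real ^ 'n \<Rightarrow> ereal) \<Rightarrow> ennreal" where
  "var_norm p f =
    (if f \<in> var_Lebesgue p then (INF t\<in>{t. 0 < t \<and> modular p f t \<le> 1}. ennreal t) else \<infinity>)"


subsection \<open>The maximal operator\<close>

definition maximal :: "(real ^ 'n \<Rightarrow> ereal) \<Rightarrow> real ^ 'n \<Rightarrow> ereal" where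
  "maximal f x =
    enn2ereal (SUP \<rho>\<in>{0<..}.
      (\<integral>\<^sup>+ y\<in>ball x \<rho>. e2ennreal \<bar>f y\<bar> \<partial>lebesgue) / emeasure lebesgue (ball x \<rho>))"

text \<open>
  Exponents are identified up to null sets, so the bound \<open>1 \<le> r\<close> is required almost everywhere.
\<close>

definition maximal_exponents :: "(real ^ 'n \<Rightarrow> real) set" where
  "maximal_exponents =
    {r \<in> borel_measurable lebesgue.
      (AE x in lebesgue. 1 \<le> r x) \<and>
      (\<exists>C::real. \<forall>f\<in>var_Lebesgue r.
         maximal f \<in> var_Lebesgue r \<and> var_norm r (maximal f) \<le> ennreal C * var_norm r f)}"


subsection \<open>Muckenhoupt weights\<close>

definition weight :: "(real ^ 'n \<Rightarrow> real) \<Rightarrow> bool" where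
  "weight w \<longleftrightarrow> (\<forall>x. 0 \<le> w x) \<and> (\<forall>K. compact K \<longrightarrow> set_integrable lebesgue K w)"

definition cubes :: "(real ^ 'n) set set" where
  "cubes = {cbox a (a + (\<chi> i. l)) | a l. 0 < l}"

definition average :: "(real ^ 'n) set \<Rightarrow> (real ^ 'n \<Rightarrow> ennreal) \<Rightarrow> ennreal" where
  "average Q h = (\<integral>\<^sup>+ x\<in>Q. h x \<partial>lebesgue) / emeasure lebesgue Q"

definition Aq_bound :: "real \<Rightarrow> (real ^ 'n \<Rightarrow> real) \<Rightarrow> real \<Rightarrow> bool" where
  "Aq_bound q w C \<longleftrightarrow> 0 \<le> C \<and>
    (\<forall>Q\<in>cubes.
       average Q (\<lambda>x. ennreal (w x)) *
       enn_powr (average Q (\<lambda>x. enn_powr (ennreal (w x)) (1 - conj_exponent q))) (q - 1)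
       \<le> ennreal C)"

definition Aq :: "real \<Rightarrow> (real ^ 'n \<Rightarrow> real) set" where
  "Aq q = {w. weight w \<and> (\<exists>C. Aq_bound q w C)}"

definition Aq_const :: "real \<Rightarrow> (real ^ 'n \<Rightarrow> real) \<Rightarrow> real" where
  "Aq_const q w = Inf {C. Aq_bound q w C}"

lemma Aq_const_least:
  assumes "w \<in> Aq q"
  shows "Aq_bound q w (Aq_const q w)"
    and "Aq_bound q w C \<Longrightarrow> Aq_const q w \<le> C"
proof -
  have bdd: "bdd_below {C. Aq_bound q w C}"
    by (rule bdd_belowI[of _ 0]) (simp add: Aq_bound_def)
  obtain C0 where C0: "Aq_bound q w C0"
    using assms by (auto simp: Aq_def)
  show "Aq_bound q w C \<Longrightarrow> Aq_const q w \<le> C"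
    unfolding Aq_const_def using bdd by (simp add: cInf_lower)
  have le: "X \<le> ennreal (Aq_const q w)"
    if X: "\<And>C. Aq_bound q w C \<Longrightarrow> X \<le> ennreal C" for X
  proof -
    obtain r where r: "0 \<le> r" "X = ennreal r"
      using X[OF C0] by (cases X) (auto simp: top_unique)
    have "r \<le> C" if "Aq_bound q w C" for C
      using X[OF that] r that by (simp add: Aq_bound_def)
    then have "r \<le> Aq_const q w"
      unfolding Aq_const_def using C0 by (intro cInf_greatest) auto
    then show ?thesis
      using r by (simp add: ennreal_leI)
  qed
  have "0 \<le> Aq_const q w"
    unfolding Aq_const_def using C0 by (intro cInf_greatest) (auto simp: Aq_bound_def)
  then show "Aq_bound q w (Aq_const q w)"
    unfolding Aq_bound_def by (auto intro!: le simp: Aq_bound_def)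
qed

definition weighted_integral ::
    "real \<Rightarrow> real \<Rightarrow> (real ^ 'n \<Rightarrow> real) \<Rightarrow> (real ^ 'n \<Rightarrow> ereal) \<Rightarrow> ennreal" where
  "weighted_integral p0 \<delta> w f =
    (\<integral>\<^sup>+ x. enn_powr (e2ennreal (f x)) p0 * ennreal (w x powr \<delta>) \<partial>lebesgue)"

end

theory Submission
  imports Defs
begin

text \<open>
  Assume that no constant \<open>C\<close> exists. Then there are pairs \<open>(f\<^sub>j, g\<^sub>j)\<close> for which the ratio of the norms
  grows like \<open>16\<^sup>j\<close>; normalise \<open>f\<^sub>j\<close>. The functions dual to all the \<open>f\<^sub>j\<close>, weighted by powers of
  \<open>1/4\<close>, can be summed and the sum majorised by one \<open>A\<^sub>1\<close> weight \<open>W\<close> with the Rubio de Francia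
  algorithm, because the maximal operator is bounded on the space with exponent
  \<open>\<delta>\<^sub>*(p/p\<^sub>*)'\<close>. Young's inequality against \<open>W\<close> then contradicts the \<open>p\<^sub>*\<close>-inequality with
  weight \<open>W\<close> raised to \<open>\<delta>\<^sub>*\<close>. Using a single weight for the whole sequence means that no dependence
  on the weight constants has to be tracked; in particular \<open>C\<^sub>0\<close> need not be locally bounded.

  The \<open>p\<^sub>*\<close>-inequality for \<open>w\<close> in \<open>A\<^sub>1\<close> follows from the \<open>p\<^sub>0\<close>-inequality by the same argument, with
  the maximal operator acting on \<open>L\<^sup>m(w)\<close> if \<open>p\<^sub>* < p\<^sub>0\<close> and on \<open>L\<^sup>q(w\<^sup>1\<^sup>-\<^sup>q)\<close> if \<open>p\<^sub>* > p\<^sub>0\<close>. Both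
  bounds reduce, since \<open>w\<close> is in \<open>A\<^sub>1\<close>, to the maximal operator of the doubling measure \<open>w dx\<close>.
\<close>

subsection \<open>Powers of extended nonnegative reals\<close>

text \<open>The pairing with a dual function is explicit: suitable powers of the normalised
  functions (\<open>k\<close>, \<open>u0\<close>, \<open>v0\<close> below) are the functions to be
  majorised. Replacing the j-th one by its majorant costs a geometric factor in \<open>j\<close>,
  and \<open>16 ^ j\<close> is large enough to outgrow it in each case. All estimates are made on
  modulars, that is on integrals of powers, because pointwise inequalities pass to them even when
  the exponent varies with the point.

  Lowering the exponent is the delicate direction: an integral with the larger exponent
  \<open>p_0\<close> is comparable to one with exponent \<open>p_*\<close> only after division by a
  power of a majorant of the functions themselves. That negative power is the second factor of a
  product \<open>u * v powr (1 - p)\<close> of A_1 weights. It also forces the functions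
  \<open>g_j\<close> to be majorised together with the \<open>f_j\<close>.

  The bounds on \<open>p_*\<close> enter through the maximal theorem, which needs an exponent above
  1: the lower bound gives \<open>1 < m\<close>, the upper bound gives \<open>1 < q\<close>.\<close>

lemma enn_powr_ennreal:
  assumes "0 \<le> x" "0 < a \<or> 0 < x"
  shows "enn_powr (ennreal x) a = ennreal (x powr a)"
  using assms by (cases "x = 0") (auto simp: enn_powr_def)

lemma enn_powr_zero [simp]: "0 < a \<Longrightarrow> enn_powr 0 a = 0"
  and enn_powr_top [simp]: "0 < a \<Longrightarrow> enn_powr \<infinity> a = \<infinity>"
  and enn_powr_top' [simp]: "0 < a \<Longrightarrow> enn_powr top a = top"
  and enn_powr_one [simp]: "enn_powr 1 a = 1"
  by (auto simp: enn_powr_def)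

lemma enn_powr_exponent_one [simp]: "enn_powr x 1 = x"
  by (cases x) (auto simp: enn_powr_ennreal)

lemma enn_powr_eq_0_iff: "0 < a \<Longrightarrow> enn_powr x a = 0 \<longleftrightarrow> x = 0"
  by (cases x) (auto simp: enn_powr_ennreal)

lemma enn_powr_mono:
  assumes "x \<le> y" "0 < a"
  shows "enn_powr x a \<le> enn_powr y a"
proof (cases y)
  case (real s)
  then obtain r where "x = ennreal r" "0 \<le> r" "r \<le> s"
    using assms by (cases x) (auto simp: top_unique)
  then show ?thesis
    using real assms by (auto simp: enn_powr_ennreal intro!: ennreal_leI powr_mono2)
qed (use assms in auto)

lemma enn_powr_mult:
  assumes "0 < a"
  shows "enn_powr (x * y) a = enn_powr x a * enn_powr y a"
proof -
  consider r s where "x = ennreal r" "0 \<le> r" "y = ennreal s" "0 \<le> s" | "x = top" | "y = top"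
    by (cases x; cases y) auto
  then show ?thesis
  proof cases
    case 1
    then show ?thesis
      using assms by (simp add: enn_powr_ennreal powr_mult flip: ennreal_mult)
  next
    case 2
    then show ?thesis
      using assms by (cases "y = 0") (auto simp: ennreal_top_mult enn_powr_eq_0_iff)
  next
    case 3
    then show ?thesis
      using assms by (cases "x = 0") (auto simp: ennreal_mult_top enn_powr_eq_0_iff)
  qed
qed

lemma enn_powr_powr:
  assumes "0 < a" "0 < b"
  shows "enn_powr (enn_powr x a) b = enn_powr x (a * b)"
  using assms by (cases x) (auto simp: enn_powr_ennreal powr_powr)

lemma enn_powr_le_self:
  assumes "x \<le> 1" "1 \<le> a"
  shows "enn_powr x a \<le> x"
proof -
  obtain r where "x = ennreal r" "0 \<le> r" "r \<le> 1"
    using assms by (cases x) (auto simp: top_unique)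
  then show ?thesis
    using assms powr_mono'[of 1 a r] by (simp add: enn_powr_ennreal ennreal_leI)
qed

lemma enn_powr_measurable [measurable]:
  fixes r :: "'a \<Rightarrow> real"
  assumes [measurable]: "u \<in> borel_measurable M" "r \<in> borel_measurable M"
  shows "(\<lambda>x. enn_powr (u x) (r x)) \<in> borel_measurable M"
  unfolding enn_powr_def by measurable

lemma enn_powr_finite: "x < \<infinity> \<Longrightarrow> 0 < a \<Longrightarrow> enn_powr x a < \<infinity>"
  by (cases x) (auto simp: enn_powr_ennreal)

lemma enn_powr_add:
  assumes "0 < a" "0 < b"
  shows "enn_powr x (a + b) = enn_powr x a * enn_powr x b"
proof (cases x)
  case (real r)
  then show ?thesis
    using assms by (simp add: enn_powr_ennreal powr_add ennreal_mult)
next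
  case top
  then show ?thesis
    using assms by simp
qed

lemma enn_powr_add_pos:
  assumes "0 < x" "x < \<infinity>"
  shows "enn_powr x (a + b) = enn_powr x a * enn_powr x b"
proof -
  obtain r where "x = ennreal r" "0 < r"
    using assms by (cases x) auto
  then show ?thesis
    by (simp add: enn_powr_ennreal powr_add ennreal_mult)
qed

lemma enn_powr_powr_pos:
  assumes "0 < x" "x < \<infinity>"
  shows "enn_powr (enn_powr x a) b = enn_powr x (a * b)"
proof -
  obtain r where "x = ennreal r" "0 < r"
    using assms by (cases x) auto
  then show ?thesis
    by (simp add: enn_powr_ennreal powr_powr)
qed

lemma enn_powr_pos_nonzero:
  assumes "0 < x" "x < \<infinity>"
  shows "enn_powr x a \<noteq> 0"
proof -
  obtain r where "x = ennreal r" "0 < r"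
    using assms by (cases x) auto
  then show ?thesis
    by (simp add: enn_powr_ennreal)
qed

text \<open>Compare \<open>Y\<close> with \<open>h\<close> to the power \<open>p - s\<close>. If
  \<open>Y\<close> is smaller, the first summand suffices; otherwise \<open>h\<close> to the power
  \<open>s\<close> is at most \<open>Y\<close> to the power \<open>s / (p - s)\<close>, and the
  exponents of \<open>Y\<close> add up to \<open>p / (p - s)\<close>, the conjugate of
  \<open>p / s\<close>.\<close>

lemma enn_powr_Young:
  assumes "0 < s" "s < p"
  shows "enn_powr h s * Y \<le> enn_powr h p + enn_powr Y (p / (p - s))"
proof (cases "Y \<le> enn_powr h (p - s)")
  case True
  have "enn_powr h s * Y \<le> enn_powr h s * enn_powr h (p - s)"
    by (intro mult_left_mono True) simp
  also have "\<dots> = enn_powr h p"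
    using assms enn_powr_add[of s "p - s" h] by simp
  finally show ?thesis
    by (rule add_increasing2[rotated]) simp
next
  case False
  then have "enn_powr (enn_powr h (p - s)) (s / (p - s)) \<le> enn_powr Y (s / (p - s))"
    using assms by (intro enn_powr_mono) auto
  then have "enn_powr h s \<le> enn_powr Y (s / (p - s))"
    using assms by (simp add: enn_powr_powr)
  then have "enn_powr h s * Y \<le> enn_powr Y (s / (p - s)) * enn_powr Y 1"
    by (simp add: mult_right_mono)
  also have "\<dots> = enn_powr Y (s / (p - s) + 1)"
    using assms by (intro enn_powr_add[symmetric]) auto
  also have "s / (p - s) + 1 = p / (p - s)"
    using assms by (simp add: field_simps)
  finally show ?thesis
    by (rule add_increasing[rotated]) simp
qed

subsection \<open>The Rubio de Francia algorithm\<close>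

lemma suminf_half_ennreal: "(\<Sum>j. (1/2::ennreal) ^ Suc j) = 1"
proof -
  have "(\<Sum>j. ennreal ((1/2) ^ Suc j)) = ennreal 1"
    by (rule suminf_ennreal_eq) (use power_half_series in auto)
  moreover have "ennreal ((1/2) ^ k) = (1/2) ^ k" for k
    by (simp add: divide_ennreal_def flip: ennreal_power)
  ultimately show ?thesis
    by (simp only: ennreal_1)
qed

lemma suminf_Suc_le_ennreal: "(\<Sum>j. f (Suc j)) \<le> (\<Sum>j. f j :: ennreal)"
proof (rule suminf_le_const[OF summableI])
  fix n
  have "(\<Sum>j<n. f (Suc j)) \<le> (\<Sum>j<Suc n. f j)"
    by (subst sum.lessThan_Suc_shift) simp
  also have "\<dots> \<le> (\<Sum>j. f j)"
    by (rule sum_le_suminf) auto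
  finally show "(\<Sum>j<n. f (Suc j)) \<le> (\<Sum>j. f j)" .
qed

text \<open>For \<open>v = 1\<close> this is the modular of the variable space, for constant
  \<open>r\<close> the r-th power of a weighted Lebesgue norm; the common form lets one algorithm
  serve both.\<close>

definition wmod :: "'a measure \<Rightarrow> ('a \<Rightarrow> real) \<Rightarrow> ('a \<Rightarrow> ennreal) \<Rightarrow> ('a \<Rightarrow> ennreal) \<Rightarrow> ennreal" where
  "wmod M r v u = (\<integral>\<^sup>+ x. enn_powr (u x) (r x) * v x \<partial>M)"

lemma wmod_mono:
  assumes "AE x in M. u x \<le> u' x" "AE x in M. 0 < r x"
  shows "wmod M r v u \<le> wmod M r v u'"
  unfolding wmod_def using assms
  by (intro nn_integral_mono_AE, eventually_elim) (intro mult_right_mono enn_powr_mono, auto)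

lemma wmod_cmult:
  assumes [measurable]: "u \<in> borel_measurable M" "v \<in> borel_measurable M" and "0 < m"
  shows "wmod M (\<lambda>_. m) v (\<lambda>x. c * u x) = enn_powr c m * wmod M (\<lambda>_. m) v u"
  unfolding wmod_def using assms(3)
  by (subst nn_integral_cmult[symmetric]) (auto simp: enn_powr_mult mult.assoc)

lemma wmod_finite_AE:
  assumes [measurable]: "r \<in> borel_measurable M" "v \<in> borel_measurable M" "u \<in> borel_measurable M"
    and "wmod M r v u < \<infinity>" "AE x in M. v x \<noteq> 0" "AE x in M. 0 < r x"
  shows "AE x in M. u x < \<infinity>"
proof -
  have "AE x in M. enn_powr (u x) (r x) * v x \<noteq> \<infinity>"
    using assms(4) by (intro nn_integral_PInf_AE) (auto simp: wmod_def)
  then show ?thesis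
    using assms(5,6)
  proof eventually_elim
    case (elim x)
    then show ?case
      by (cases "u x = top") (auto simp: ennreal_top_mult less_top)
  qed
qed

lemma wmod_scale:
  assumes "u \<in> borel_measurable M" "v \<in> borel_measurable M" "0 < m" "0 < c"
  shows "wmod M (\<lambda>_. m) v (\<lambda>x. ennreal c * u x) = ennreal (c powr m) * wmod M (\<lambda>_. m) v u"
  using assms by (simp add: wmod_cmult enn_powr_ennreal)

lemma wmod_cong_AE:
  assumes "AE x in M. v x = v' x"
  shows "wmod M r v f = wmod M r v' f"
  unfolding wmod_def using assms by (intro nn_integral_cong_AE, eventually_elim) simp

text \<open>Takes the place of the triangle inequality: the modular unit ball is stable under this
  geometric combination although the exponent varies.\<close>

lemma wmod_geometric_sum:
  fixes u :: "nat \<Rightarrow> 'a \<Rightarrow> ennreal"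
  assumes [measurable]: "r \<in> borel_measurable M" "v \<in> borel_measurable M"
      "\<And>j. u j \<in> borel_measurable M"
    and r: "AE x in M. 1 \<le> r x"
    and u: "\<And>j. wmod M r v (u j) \<le> 1"
  shows "wmod M r v (\<lambda>x. \<Sum>j. (1/4) ^ Suc j * u j x) \<le> 1"
proof -
  have quarter: "(1/4::ennreal) ^ Suc j = (1/2) ^ Suc j * (1/2) ^ Suc j" for j
  proof -
    have "(1/4::ennreal) = 1/2 * (1/2)"
      by (simp add: divide_ennreal_def ennreal_inverse_mult[symmetric])
    then show ?thesis
      by (simp only: power_mult_distrib)
  qed
  have le1: "(1/2::ennreal) ^ Suc j \<le> 1" for j
    by (rule power_le_one) (auto intro: divide_le_posI_ennreal)
  have pt: "enn_powr (\<Sum>j. (1/4) ^ Suc j * u j x) (r x)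
      \<le> (\<Sum>j. (1/2) ^ Suc j * enn_powr (u j x) (r x))" if "1 \<le> r x" for x
  proof -
    \<comment> \<open>Writing \<open>1/4\<close> as a square bounds the sum by a supremum, so no convexity is needed.\<close>
    let ?Z = "\<Sum>j. (1/2) ^ Suc j * enn_powr (u j x) (r x)"
    let ?S = "enn_powr ?Z (1 / r x)"
    have "(1/2) ^ Suc j * u j x \<le> ?S" for j
    proof -
      have "enn_powr ((1/2) ^ Suc j * u j x) (r x) = enn_powr ((1/2) ^ Suc j) (r x) * enn_powr (u j x) (r x)"
        using that by (simp add: enn_powr_mult del: power_Suc)
      also have "\<dots> \<le> (1/2) ^ Suc j * enn_powr (u j x) (r x)"
        using that by (intro mult_right_mono enn_powr_le_self le1) auto
      also have "\<dots> \<le> ?Z"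
        using sum_le_suminf[of "\<lambda>j. (1/2) ^ Suc j * enn_powr (u j x) (r x)" "{j}"]
        by (simp del: power_Suc)
      finally have "enn_powr (enn_powr ((1/2) ^ Suc j * u j x) (r x)) (1 / r x) \<le> ?S"
        using that by (intro enn_powr_mono) auto
      then show ?thesis
        using that by (simp add: enn_powr_powr del: power_Suc)
    qed
    then have "(\<Sum>j. (1/4) ^ Suc j * u j x) \<le> (\<Sum>j. (1/2) ^ Suc j * ?S)"
      unfolding quarter mult.assoc by (intro suminf_le mult_left_mono) auto
    also have "\<dots> = ?S"
      by (simp add: suminf_half_ennreal del: power_Suc)
    finally have "enn_powr (\<Sum>j. (1/4) ^ Suc j * u j x) (r x) \<le> enn_powr ?S (r x)"
      using that by (intro enn_powr_mono) auto
    also have "\<dots> = ?Z"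
      using that by (simp add: enn_powr_powr del: power_Suc)
    finally show ?thesis .
  qed
  have "wmod M r v (\<lambda>x. \<Sum>j. (1/4) ^ Suc j * u j x)
      \<le> (\<integral>\<^sup>+ x. (\<Sum>j. (1/2) ^ Suc j * (enn_powr (u j x) (r x) * v x)) \<partial>M)"
    unfolding wmod_def mult.assoc[symmetric] ennreal_suminf_multc
    by (intro nn_integral_mono_AE, use r in eventually_elim) (intro mult_right_mono pt, auto)
  also have "\<dots> = (\<Sum>j. (1/2) ^ Suc j * wmod M r v (u j))"
    unfolding wmod_def by (simp add: nn_integral_suminf nn_integral_cmult del: power_Suc)
  also have "\<dots> \<le> (\<Sum>j. (1/2) ^ Suc j * 1)"
    using u by (intro suminf_le mult_left_mono) auto
  finally show ?thesis
    by (simp add: suminf_half_ennreal del: power_Suc)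
qed

text \<open>The iteration \<open>u \<mapsto> N u / B\<close> preserves the modular unit ball, and so
  does summing the iterates with weights \<open>(1/4) ^ Suc j\<close>. The zeroth term gives
  \<open>k \<le> 4 W\<close>; applying \<open>N\<close> shifts the series by one index at the cost
  \<open>4 * B\<close>.\<close>

lemma rubio_de_francia:
  fixes N :: "('a \<Rightarrow> ennreal) \<Rightarrow> 'a \<Rightarrow> ennreal" and B :: ennreal
  assumes [measurable]: "r \<in> borel_measurable M" "v \<in> borel_measurable M" "k \<in> borel_measurable M"
    and r: "AE x in M. 1 \<le> r x"
    and sublinear: "\<And>u x. (\<And>j. u j \<in> borel_measurable M) \<Longrightarrow>
        N (\<lambda>x. \<Sum>j. (1/4) ^ Suc j * u j x) x \<le> (\<Sum>j. (1/4) ^ Suc j * N (u j) x)"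
    and B: "B \<noteq> 0" "B \<noteq> \<infinity>"
    and N_meas: "\<And>u. u \<in> borel_measurable M \<Longrightarrow> wmod M r v u \<le> 1 \<Longrightarrow> N u \<in> borel_measurable M"
    and N_mod: "\<And>u. u \<in> borel_measurable M \<Longrightarrow> wmod M r v u \<le> 1 \<Longrightarrow> wmod M r v (\<lambda>x. N u x / B) \<le> 1"
    and k: "wmod M r v k \<le> 1"
  obtains W where "W \<in> borel_measurable M" "wmod M r v W \<le> 1" "\<And>x. k x \<le> 4 * W x"
    "\<And>x. N W x \<le> 4 * B * W x"
proof -
  define T where "T j = ((\<lambda>u x. N u x / B) ^^ j) k" for j
  have T_Suc: "T (Suc j) = (\<lambda>x. N (T j) x / B)" for j
    by (simp add: T_def)
  have T: "T j \<in> borel_measurable M \<and> wmod M r v (T j) \<le> 1" for j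
  proof (induction j)
    case (Suc j)
    then have [measurable]: "N (T j) \<in> borel_measurable M"
      by (auto intro: N_meas)
    show ?case
      unfolding T_Suc using Suc by (auto intro!: N_mod)
  qed (simp_all add: T_def k)
  then have [measurable]: "\<And>j. T j \<in> borel_measurable M"
    by auto
  define W where "W x = (\<Sum>j. (1/4) ^ Suc j * T j x)" for x
  have four: "4 * ((1/4) ^ Suc j * y) = (1/4) ^ j * y" for j and y :: ennreal
  proof -
    have "4 * (1/4) = (1::ennreal)"
      by (simp add: ennreal_times_divide)
    then show ?thesis
      by (simp add: mult.assoc[symmetric])
  qed
  show thesis
  proof
    show "W \<in> borel_measurable M"
      unfolding W_def by measurable
    show "wmod M r v W \<le> 1"
      unfolding W_def using T by (intro wmod_geometric_sum r) auto
    show "k x \<le> 4 * W x" for x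
    proof -
      have "4 * W x = (\<Sum>j. (1/4) ^ j * T j x)"
        unfolding W_def ennreal_suminf_cmult[symmetric] four ..
      also have "\<dots> \<ge> k x"
        using sum_le_suminf[of "\<lambda>j. (1/4) ^ j * T j x" "{0}"] by (simp add: T_def)
      finally show ?thesis .
    qed
    show "N W x \<le> 4 * B * W x" for x
    proof -
      have "N W x \<le> (\<Sum>j. (1/4) ^ Suc j * N (T j) x)"
        unfolding W_def by (intro sublinear) auto
      \<comment> \<open>\<open>N\<close> of an iterate is \<open>B\<close> times the next iterate,
        whose weight is smaller by the factor \<open>1/4\<close>.\<close>
      also have "\<dots> = (\<Sum>j. 4 * B * ((1/4) ^ Suc (Suc j) * T (Suc j) x))"
      proof (intro arg_cong[where f = suminf] ext)
        fix j
        have "B * (N (T j) x / B) = N (T j) x"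
          using B by (simp add: ennreal_times_divide ennreal_mult_divide_eq mult.commute[of B])
        then have "(1/4) ^ Suc j * N (T j) x = B * ((1/4) ^ Suc j * T (Suc j) x)"
          unfolding T_Suc by (metis mult.left_commute)
        then show "(1/4) ^ Suc j * N (T j) x = 4 * B * ((1/4) ^ Suc (Suc j) * T (Suc j) x)"
          by (metis four mult.assoc mult.left_commute)
      qed
      also have "\<dots> = 4 * B * (\<Sum>j. (1/4) ^ Suc (Suc j) * T (Suc j) x)"
        by (rule ennreal_suminf_cmult)
      also have "\<dots> \<le> 4 * B * W x"
        unfolding W_def by (intro mult_left_mono suminf_Suc_le_ennreal) auto
      finally show ?thesis .
    qed
  qed
qed

lemma geometric_sum_majorizes:
  fixes u :: "nat \<Rightarrow> 'a \<Rightarrow> ennreal"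
  shows "u j x \<le> ennreal (4 ^ Suc j) * (\<Sum>i. (1/4) ^ Suc i * u i x)"
proof -
  have "ennreal (4 ^ Suc j) * (1/4) ^ Suc j = 1"
  proof -
    have "(4::ennreal) * (1/4) = 1"
      by (simp add: ennreal_times_divide)
    then show ?thesis
      by (simp only: ennreal_power[symmetric] power_mult_distrib[symmetric] zero_le_numeral
          ennreal_numeral power_one)
  qed
  then have "u j x = ennreal (4 ^ Suc j) * ((1/4) ^ Suc j * u j x)"
    by (simp only: mult.assoc[symmetric] mult_1)
  also have "\<dots> \<le> ennreal (4 ^ Suc j) * (\<Sum>i. (1/4) ^ Suc i * u i x)"
    using sum_le_suminf[of "\<lambda>i. (1/4) ^ Suc i * u i x" "{j}"]
    by (intro mult_left_mono) (auto simp del: power_Suc)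
  finally show ?thesis .
qed

text \<open>In \<open>j + 2\<close>, the part \<open>j + 1\<close> undoes the weight of
  \<open>u j\<close> in the sum \<open>k\<close> and the last factor 4 comes from
  \<open>k \<le> 4 W\<close>. The nonzero modular of \<open>u 0\<close> keeps \<open>W\<close> from
  vanishing almost everywhere, on which the positivity of A_1 weights rests.\<close>

lemma rubio_de_francia_sequence:
  fixes N :: "('a \<Rightarrow> ennreal) \<Rightarrow> 'a \<Rightarrow> ennreal" and B :: ennreal and u :: "nat \<Rightarrow> 'a \<Rightarrow> ennreal"
  assumes [measurable]: "r \<in> borel_measurable M" "v \<in> borel_measurable M" "\<And>j. u j \<in> borel_measurable M"
    and r: "AE x in M. 1 \<le> r x"
    and sublinear: "\<And>u x. (\<And>j. u j \<in> borel_measurable M) \<Longrightarrow>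
        N (\<lambda>x. \<Sum>j. (1/4) ^ Suc j * u j x) x \<le> (\<Sum>j. (1/4) ^ Suc j * N (u j) x)"
    and B: "B \<noteq> 0" "B \<noteq> \<infinity>"
    and N_meas: "\<And>u. u \<in> borel_measurable M \<Longrightarrow> wmod M r v u \<le> 1 \<Longrightarrow> N u \<in> borel_measurable M"
    and N_mod: "\<And>u. u \<in> borel_measurable M \<Longrightarrow> wmod M r v u \<le> 1 \<Longrightarrow> wmod M r v (\<lambda>x. N u x / B) \<le> 1"
    and u: "\<And>j. wmod M r v (u j) \<le> 1" "wmod M r v (u 0) \<noteq> 0"
  obtains W where "W \<in> borel_measurable M" "wmod M r v W \<le> 1" "\<And>j x. u j x \<le> ennreal (4 ^ (j + 2)) * W x"
    "\<And>x. N W x \<le> 4 * B * W x" "\<not> (AE x in M. W x = 0)"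
proof -
  define k where "k x = (\<Sum>i. (1/4) ^ Suc i * u i x)" for x
  have k: "k \<in> borel_measurable M" "wmod M r v k \<le> 1"
    unfolding k_def using r u(1) by (auto intro!: wmod_geometric_sum simp del: power_Suc)
  obtain W where W: "W \<in> borel_measurable M" "wmod M r v W \<le> 1" "\<And>x. k x \<le> 4 * W x"
    "\<And>x. N W x \<le> 4 * B * W x"
    by (rule rubio_de_francia[OF assms(1,2) k(1) r sublinear B N_meas N_mod k(2)]) auto
  have u_le: "u j x \<le> ennreal (4 ^ (j + 2)) * W x" for j x
  proof -
    have "u j x \<le> ennreal (4 ^ Suc j) * k x"
      unfolding k_def by (rule geometric_sum_majorizes)
    also have "\<dots> \<le> ennreal (4 ^ Suc j) * (ennreal 4 * W x)"
      using W(3)[of x] by (intro mult_left_mono) auto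
    also have "\<dots> = ennreal (4 ^ Suc j * 4) * W x"
      by (subst ennreal_mult) (simp_all only: mult.assoc, auto)
    also have "4 ^ Suc j * 4 = (4::real) ^ (j + 2)"
      by simp
    finally show ?thesis .
  qed
  have "\<not> (AE x in M. W x = 0)"
  proof
    assume "AE x in M. W x = 0"
    then have "AE x in M. enn_powr (u 0 x) (r x) * v x = 0"
      using r
    proof eventually_elim
      fix x assume "W x = 0" "1 \<le> r x"
      then show "enn_powr (u 0 x) (r x) * v x = 0"
        using u_le[of 0 x] by simp
    qed
    then have "wmod M r v (u 0) = 0"
      unfolding wmod_def by (subst nn_integral_cong_AE[where v = "\<lambda>_. 0"]) auto
    then show False
      using u(2) by contradiction
  qed
  then show thesis
    using that W(1,2,4) u_le by blast
qed

subsection \<open>Weighted maximal functions\<close>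

text \<open>The uncentred maximal operator of the measure \<open>w dx\<close>, unweighted for
  \<open>w = 1\<close>. Being uncentred makes its superlevel sets open, hence measurable.\<close>

definition wmax :: "('a::euclidean_space \<Rightarrow> ennreal) \<Rightarrow> ('a \<Rightarrow> ennreal) \<Rightarrow> 'a \<Rightarrow> ennreal" where
  "wmax w g x = (SUP (c, \<rho>)\<in>{(c, \<rho>). x \<in> ball c \<rho>}.
     (\<integral>\<^sup>+ y\<in>ball c \<rho>. g y * w y \<partial>lebesgue) / (\<integral>\<^sup>+ y\<in>ball c \<rho>. w y \<partial>lebesgue))"

text \<open>The inequality is required at every point, as the algorithm delivers it, so it can be
  integrated or evaluated anywhere in the ball; infinite values of \<open>w\<close> are allowed on a
  null set.\<close>

definition A1 :: "('a::euclidean_space \<Rightarrow> ennreal) \<Rightarrow> bool" where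
  "A1 w \<longleftrightarrow> w \<in> borel_measurable lebesgue \<and> (\<forall>x. 0 < w x) \<and> (AE x in lebesgue. w x < \<infinity>) \<and>
    (\<exists>C<\<infinity>. \<forall>c \<rho>. \<forall>x\<in>ball c \<rho>.
      (\<integral>\<^sup>+ y\<in>ball c \<rho>. w y \<partial>lebesgue) \<le> C * emeasure lebesgue (ball c \<rho>) * w x)"

section \<open>Lebesgue measure of balls\<close>

lemma ball_lebesgue_sets [measurable, simp]: "ball c \<rho> \<in> sets (lebesgue :: 'a::euclidean_space measure)"
  by auto

lemma emeasure_lebesgue_ball_pos:
  "0 < \<rho> \<Longrightarrow> 0 < emeasure lebesgue (ball (c::'a::euclidean_space) \<rho>)"
  by (simp add: emeasure_ball)

lemma emeasure_lebesgue_ball_finite: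
  "emeasure lebesgue (ball (c::'a::euclidean_space) \<rho>) < \<infinity>"
  by (cases "0 \<le> \<rho>") (simp_all add: emeasure_ball ball_empty)

lemma emeasure_lebesgue_ball_scale:
  assumes "0 \<le> a"
  shows "emeasure lebesgue (ball (c::'a::euclidean_space) (a * \<rho>)) \<le>
    ennreal a ^ DIM('a) * emeasure lebesgue (ball (c'::'a) \<rho>)"
proof (cases "0 \<le> \<rho>")
  case True
  then show ?thesis
    using assms by (simp add: emeasure_ball power_mult_distrib ennreal_power mult_ac
        flip: ennreal_mult)
next
  case False
  then show ?thesis
    using assms by (simp add: ball_empty mult_nonneg_nonpos)
qed

lemma mult_right_le_cancel_ennreal:
  assumes "0 < m" "m < \<infinity>"
  shows "a * m \<le> b * m \<longleftrightarrow> a \<le> (b::ennreal)"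
proof -
  have "m \<noteq> 0" "m \<noteq> top"
    using assms by auto
  from ennreal_mult_le_mult_iff[OF this, of a b] show ?thesis
    by (simp only: mult.commute[of m])
qed

lemma less_divide_ennreal_iff:
  assumes "0 < b" "b < \<infinity>"
  shows "t < a / b \<longleftrightarrow> t * b < (a::ennreal)"
proof -
  have "a / b * b = a"
    using assms by (simp add: ennreal_divide_times)
  then show ?thesis
    using mult_right_le_cancel_ennreal[OF assms, of "a / b" t] by (simp only: not_le[symmetric])
qed

lemma AE_lebesgue_ball_ex:
  assumes "AE x in lebesgue. P x" "0 < \<rho>"
  obtains x where "x \<in> ball (c::'a::euclidean_space) \<rho>" "P x"
proof (rule ccontr)
  assume "\<not> thesis"
  then have "AE x in lebesgue. x \<notin> ball c \<rho>"
    using assms that by (auto elim!: eventually_mono)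
  then have "emeasure lebesgue (ball c \<rho>) = 0"
    by (subst (asm) AE_iff_measurable[where N = "ball c \<rho>"]) auto
  then show False
    using emeasure_lebesgue_ball_pos[OF assms(2), of c] by simp
qed

section \<open>A_1 weights on balls and the doubling property\<close>

lemma A1_D:
  assumes "A1 w"
  shows "w \<in> borel_measurable lebesgue" "\<And>x. 0 < w x" "AE x in lebesgue. w x < \<infinity>"
  using assms by (auto simp: A1_def)

lemma A1_ball_finite:
  assumes "A1 w"
  shows "(\<integral>\<^sup>+ y\<in>ball c \<rho>. w y \<partial>lebesgue) < \<infinity>"
proof (cases "0 < \<rho>")
  case True
  obtain C where C: "C < \<infinity>" "\<And>c \<rho> x. x \<in> ball c \<rho> \<Longrightarrow>
      (\<integral>\<^sup>+ y\<in>ball c \<rho>. w y \<partial>lebesgue) \<le> C * emeasure lebesgue (ball c \<rho>) * w x"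
    using assms unfolding A1_def by blast
  obtain x where "x \<in> ball c \<rho>" "w x < \<infinity>"
    using AE_lebesgue_ball_ex[OF A1_D(3)[OF assms] True] .
  then show ?thesis
    using C(2)[of x c \<rho>] C(1) emeasure_lebesgue_ball_finite[of c \<rho>]
    by (auto intro: le_less_trans simp: ennreal_mult_less_top)
qed (simp add: ball_empty)

lemma A1_ball_pos:
  assumes "A1 w" "0 < \<rho>"
  shows "0 < (\<integral>\<^sup>+ y\<in>ball c \<rho>. w y \<partial>lebesgue)"
proof (rule ccontr)
  note [measurable] = A1_D(1)[OF assms(1)]
  assume "\<not> ?thesis"
  then have "AE y in lebesgue. w y * indicator (ball c \<rho>) y = 0"
    by (subst (asm) not_gr_zero, subst (asm) nn_integral_0_iff_AE) auto
  then obtain x where "x \<in> ball c \<rho>" "w x * indicator (ball c \<rho>) x = 0"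
    using AE_lebesgue_ball_ex[OF _ assms(2)] by blast
  then show False
    using A1_D(2)[OF assms(1), of x] by simp
qed

text \<open>Integrate over \<open>y\<close> in the small ball the A_1 inequality of the large ball
  at \<open>y\<close>. The dilation 5 is the one in Vitali's covering lemma.\<close>

lemma A1_doubling:
  fixes w :: "'a::euclidean_space \<Rightarrow> ennreal"
  assumes "A1 w"
  obtains D where "D < \<infinity>" "\<And>c \<rho>. (\<integral>\<^sup>+ y\<in>ball c (5 * \<rho>). w y \<partial>lebesgue)
      \<le> D * (\<integral>\<^sup>+ y\<in>ball c \<rho>. w y \<partial>lebesgue)"
proof -
  note [measurable] = A1_D(1)[OF assms(1)]
  obtain C where C: "C < \<infinity>" "\<And>c \<rho> x. x \<in> ball c \<rho> \<Longrightarrow>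
      (\<integral>\<^sup>+ y\<in>ball c \<rho>. w y \<partial>lebesgue) \<le> C * emeasure lebesgue (ball c \<rho>) * w x"
    using assms unfolding A1_def by blast
  let ?D = "C * ennreal 5 ^ DIM('a)"
  show thesis
  proof
    show "?D < \<infinity>"
      using C by (auto simp: ennreal_mult_less_top power_less_top_ennreal)
    fix c \<rho>
    let ?I = "\<integral>\<^sup>+ y\<in>ball c (5 * \<rho>). w y \<partial>lebesgue"
    let ?m = "emeasure lebesgue (ball c \<rho>)"
    show "?I \<le> ?D * (\<integral>\<^sup>+ y\<in>ball c \<rho>. w y \<partial>lebesgue)"
    proof (cases "0 < \<rho>")
      case True
      have "?I * ?m = (\<integral>\<^sup>+ y\<in>ball c \<rho>. ?I \<partial>lebesgue)"
        by (simp add: nn_integral_cmult)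
      also have "\<dots> \<le> (\<integral>\<^sup>+ y\<in>ball c \<rho>. ?D * ?m * w y \<partial>lebesgue)"
      proof (intro nn_integral_mono)
        fix y
        have "?I \<le> ?D * ?m * w y" if "y \<in> ball c \<rho>"
        proof -
          have "y \<in> ball c (5 * \<rho>)"
            using that True by auto
          then have "?I \<le> C * emeasure lebesgue (ball c (5 * \<rho>)) * w y"
            by (rule C(2))
          also have "\<dots> \<le> C * (ennreal 5 ^ DIM('a) * ?m) * w y"
            by (intro mult_right_mono mult_left_mono emeasure_lebesgue_ball_scale) auto
          finally show ?thesis
            by (simp add: mult.assoc)
        qed
        then show "?I * indicator (ball c \<rho>) y \<le> ?D * ?m * w y * indicator (ball c \<rho>) y"
          by (auto split: split_indicator)
      qed
      also have "\<dots> = ?D * ?m * (\<integral>\<^sup>+ y\<in>ball c \<rho>. w y \<partial>lebesgue)"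
        by (subst nn_integral_cmult[symmetric]) (auto simp: mult.assoc)
      also have "\<dots> = ?D * (\<integral>\<^sup>+ y\<in>ball c \<rho>. w y \<partial>lebesgue) * ?m"
        by (simp add: mult_ac)
      finally show ?thesis
        by (simp only: mult_right_le_cancel_ennreal[OF emeasure_lebesgue_ball_pos[OF True]
              emeasure_lebesgue_ball_finite])
    qed (simp add: ball_empty)
  qed
qed

section \<open>The maximal operator of a weight and its weak type bound\<close>

lemma less_wmax_iff:
  "t < wmax w g x \<longleftrightarrow> (\<exists>c \<rho>. x \<in> ball c \<rho> \<and>
     t < (\<integral>\<^sup>+ y\<in>ball c \<rho>. g y * w y \<partial>lebesgue) / (\<integral>\<^sup>+ y\<in>ball c \<rho>. w y \<partial>lebesgue))"
  unfolding wmax_def less_SUP_iff by (simp only: split_paired_Ex mem_Collect_eq prod.case bex_simps Bex_def)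

lemma wmax_open: "open {x. t < wmax w g x}"
proof -
  have "\<exists>T. open T \<and> x \<in> T \<and> T \<subseteq> {x. t < wmax w g x}" if less: "t < wmax w g x" for x
  proof -
    obtain c \<rho> where c: "x \<in> ball c \<rho>"
      "t < (\<integral>\<^sup>+ y\<in>ball c \<rho>. g y * w y \<partial>lebesgue) / (\<integral>\<^sup>+ y\<in>ball c \<rho>. w y \<partial>lebesgue)"
      using less unfolding less_wmax_iff by blast
    then have "ball c \<rho> \<subseteq> {x. t < wmax w g x}"
      unfolding less_wmax_iff by blast
    then show ?thesis
      using c open_ball by blast
  qed
  then show ?thesis
    by (subst open_subopen) simp
qed

lemma wmax_sets: "{x. t < wmax w g x} \<in> sets lebesgue"
  by (auto intro!: lborelD borel_open wmax_open)

lemma wmax_measurable [measurable]: "wmax w g \<in> borel_measurable lebesgue"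
  by (rule borel_measurableI_greater) (simp add: wmax_sets)

lemma wmax_upper:
  assumes "x \<in> ball c \<rho>"
  shows "(\<integral>\<^sup>+ y\<in>ball c \<rho>. g y * w y \<partial>lebesgue) / (\<integral>\<^sup>+ y\<in>ball c \<rho>. w y \<partial>lebesgue) \<le> wmax w g x"
  using assms less_wmax_iff[of "wmax w g x" w g x] by (meson leI less_irrefl)

lemma wmax_least:
  assumes "\<And>c \<rho>. x \<in> ball c \<rho> \<Longrightarrow>
    (\<integral>\<^sup>+ y\<in>ball c \<rho>. g y * w y \<partial>lebesgue) / (\<integral>\<^sup>+ y\<in>ball c \<rho>. w y \<partial>lebesgue) \<le> z"
  shows "wmax w g x \<le> z"
  using assms less_wmax_iff[of z w g x] by (meson leI leD)

lemma wmax_sublinear: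
  assumes [measurable]: "w \<in> borel_measurable lebesgue" "\<And>j. u j \<in> borel_measurable lebesgue"
  shows "wmax w (\<lambda>x. \<Sum>j. a j * u j x) x \<le> (\<Sum>j. a j * wmax w (u j) x)"
proof (rule wmax_least)
  fix c \<rho> assume x: "x \<in> ball c \<rho>"
  have "(\<integral>\<^sup>+ y\<in>ball c \<rho>. (\<Sum>j. a j * u j y) * w y \<partial>lebesgue)
      = (\<integral>\<^sup>+ y. (\<Sum>j. a j * (u j y * w y * indicator (ball c \<rho>) y)) \<partial>lebesgue)"
    by (intro nn_integral_cong) (simp add: mult.assoc flip: ennreal_suminf_multc)
  also have "\<dots> = (\<Sum>j. a j * (\<integral>\<^sup>+ y\<in>ball c \<rho>. u j y * w y \<partial>lebesgue))"
    by (subst nn_integral_suminf, measurable) (subst nn_integral_cmult, auto)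
  finally have "(\<integral>\<^sup>+ y\<in>ball c \<rho>. (\<Sum>j. a j * u j y) * w y \<partial>lebesgue) / (\<integral>\<^sup>+ y\<in>ball c \<rho>. w y \<partial>lebesgue)
      = (\<Sum>j. a j * ((\<integral>\<^sup>+ y\<in>ball c \<rho>. u j y * w y \<partial>lebesgue) / (\<integral>\<^sup>+ y\<in>ball c \<rho>. w y \<partial>lebesgue)))"
    by (simp add: ennreal_times_divide)
  also have "\<dots> \<le> (\<Sum>j. a j * wmax w (u j) x)"
    by (intro suminf_le mult_left_mono wmax_upper x) auto
  finally show "(\<integral>\<^sup>+ y\<in>ball c \<rho>. (\<Sum>j. a j * u j y) * w y \<partial>lebesgue) / (\<integral>\<^sup>+ y\<in>ball c \<rho>. w y \<partial>lebesgue)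
      \<le> (\<Sum>j. a j * wmax w (u j) x)" .
qed

text \<open>Vitali's argument: on a ball whose average exceeds \<open>t\<close>, \<open>t\<close>
  times the \<open>\<mu>\<close>-measure is below the \<open>\<nu>\<close>-measure. Disjoint such
  balls are selected whose 5-fold dilates cover the set, and doubling pays for the dilation, so
  \<open>D\<close> is the doubling constant.\<close>

lemma wmax_weak_type:
  fixes w :: "'a::euclidean_space \<Rightarrow> ennreal"
  assumes w: "A1 w"
  obtains D where "D < \<infinity>" "\<And>g t. g \<in> borel_measurable lebesgue \<Longrightarrow>
      t * (\<integral>\<^sup>+ x\<in>{x. t < wmax w g x}. w x \<partial>lebesgue) \<le> D * (\<integral>\<^sup>+ x. g x * w x \<partial>lebesgue)"
proof -
  note [measurable] = A1_D(1)[OF w]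
  obtain D where D: "D < \<infinity>" "\<And>c \<rho>. (\<integral>\<^sup>+ y\<in>ball c (5 * \<rho>). w y \<partial>lebesgue)
      \<le> D * (\<integral>\<^sup>+ y\<in>ball c \<rho>. w y \<partial>lebesgue)"
    using A1_doubling[OF w] by blast
  show thesis
  proof (rule that[OF D(1)])
    fix g :: "'a \<Rightarrow> ennreal" and t :: ennreal
    assume [measurable]: "g \<in> borel_measurable lebesgue"
    define \<mu> where "\<mu> = density lebesgue w"
    define \<nu> where "\<nu> = density lebesgue (\<lambda>x. g x * w x)"
    have sets [simp, measurable_cong]: "sets \<mu> = sets lebesgue" "sets \<nu> = sets lebesgue"
      by (auto simp: \<mu>_def \<nu>_def)
    have \<mu>: "emeasure \<mu> A = (\<integral>\<^sup>+ x\<in>A. w x \<partial>lebesgue)"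
      and \<nu>: "emeasure \<nu> A = (\<integral>\<^sup>+ x\<in>A. g x * w x \<partial>lebesgue)" if "A \<in> sets lebesgue" for A
      using that by (auto simp: \<mu>_def \<nu>_def emeasure_density)
    \<comment> \<open>The covering lemma wants bounded radii; the sets \<open>E n\<close> obtained
      with radii up to \<open>n\<close> increase to the superlevel set.\<close>
    define K where "K n = {(c, \<rho>). 0 < \<rho> \<and> \<rho> \<le> real n \<and>
        t * emeasure \<mu> (ball c \<rho>) < emeasure \<nu> (ball c \<rho>)}" for n
    define E where "E n = (\<Union>i\<in>K n. ball (fst i) (snd i))" for n
    have E_open: "open (E n)" for n
      by (auto simp: E_def)
    have avg_iff: "t < emeasure \<nu> (ball c \<rho>) / emeasure \<mu> (ball c \<rho>) \<longleftrightarrow>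
        t * emeasure \<mu> (ball c \<rho>) < emeasure \<nu> (ball c \<rho>)" if "0 < \<rho>" for c \<rho>
      using A1_ball_pos[OF w that, of c] A1_ball_finite[OF w, of c \<rho>]
      by (simp add: \<mu> less_divide_ennreal_iff)
    have "{x. t < wmax w g x} = (\<Union>n. E n)"
    proof (intro set_eqI iffI)
      fix x assume "x \<in> {x. t < wmax w g x}"
      then obtain c \<rho> where c: "x \<in> ball c \<rho>"
          "t < (\<integral>\<^sup>+ y\<in>ball c \<rho>. g y * w y \<partial>lebesgue) / (\<integral>\<^sup>+ y\<in>ball c \<rho>. w y \<partial>lebesgue)"
        unfolding less_wmax_iff mem_Collect_eq by blast
      then have \<rho>: "0 < \<rho>"
        by (metis ball_eq_empty empty_iff not_less)
      obtain n where "\<rho> \<le> real n"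
        using real_arch_simple by blast
      then have "(c, \<rho>) \<in> K n"
        using \<rho> c avg_iff[OF \<rho>, of c] by (simp add: K_def \<mu> \<nu>)
      then show "x \<in> (\<Union>n. E n)"
        using c by (force simp: E_def)
    next
      fix x assume "x \<in> (\<Union>n. E n)"
      then obtain c \<rho> where "x \<in> ball c \<rho>" "0 < \<rho>" "t < emeasure \<nu> (ball c \<rho>) / emeasure \<mu> (ball c \<rho>)"
        using avg_iff by (fastforce simp: E_def K_def)
      then show "x \<in> {x. t < wmax w g x}"
        using wmax_upper[of x c \<rho> g w] by (auto simp: \<mu> \<nu>)
    qed
    moreover have "t * emeasure \<mu> (E n) \<le> D * emeasure \<nu> UNIV" for n
    proof -
      have K: "0 < snd i \<and> snd i \<le> real n" if "i \<in> K n" for i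
        using that by (auto simp: K_def)
      obtain J where J: "countable J" "J \<subseteq> K n"
          "pairwise (\<lambda>i j. disjnt (ball (fst i) (snd i)) (ball (fst j) (snd j))) J"
          "E n \<subseteq> (\<Union>i\<in>J. ball (fst i) (5 * snd i))"
        by (rule Vitali_covering_lemma_balls[OF eq_refl[OF E_def] K]) auto
      \<comment> \<open>Turns the countable family \<open>J\<close> into a sequence, filled up with
        empty balls of radius 0.\<close>
      define b where "b k = (if k \<in> to_nat_on J ` J then from_nat_into J k else (0, 0))" for k
      have b_J: "b (to_nat_on J i) = i" if "i \<in> J" for i
        using that J(1) by (simp add: b_def)
      have b_cases: "b k \<in> J \<and> k = to_nat_on J (b k) \<or> b k = (0, 0)" for k
        using J(1) by (auto simp: b_def)
      have disj: "disjoint_family (\<lambda>k. ball (fst (b k)) (snd (b k)))"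
      proof (clarsimp simp: disjoint_family_on_def)
        fix k l :: nat assume "k \<noteq> l"
        then have "b k = (0, 0) \<or> b l = (0, 0) \<or> b k \<in> J \<and> b l \<in> J \<and> b k \<noteq> b l"
          using b_cases by metis
        then show "ball (fst (b k)) (snd (b k)) \<inter> ball (fst (b l)) (snd (b l)) = {}"
          using J(3) by (auto simp: pairwise_def disjnt_def)
      qed
      have est: "t * emeasure \<mu> (ball (fst (b k)) (5 * snd (b k))) \<le> D * emeasure \<nu> (ball (fst (b k)) (snd (b k)))" for k
        using b_cases[of k]
      proof
        assume "b k \<in> J \<and> k = to_nat_on J (b k)"
        then have "b k \<in> K n"
          using J by auto
        have "t * emeasure \<mu> (ball (fst (b k)) (5 * snd (b k)))
            \<le> t * (D * emeasure \<mu> (ball (fst (b k)) (snd (b k))))"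
          using D(2) by (intro mult_left_mono) (auto simp: \<mu>)
        also have "\<dots> = D * (t * emeasure \<mu> (ball (fst (b k)) (snd (b k))))"
          by (simp add: mult_ac)
        also have "\<dots> \<le> D * emeasure \<nu> (ball (fst (b k)) (snd (b k)))"
          using \<open>b k \<in> K n\<close> by (intro mult_left_mono) (auto simp: K_def)
        finally show ?thesis .
      qed auto
      have "E n \<subseteq> (\<Union>k. ball (fst (b k)) (5 * snd (b k)))"
      proof
        fix x assume "x \<in> E n"
        then obtain i where "i \<in> J" "x \<in> ball (fst i) (5 * snd i)"
          using J(4) by blast
        then have "x \<in> ball (fst (b (to_nat_on J i))) (5 * snd (b (to_nat_on J i)))"
          by (simp add: b_J)
        then show "x \<in> (\<Union>k. ball (fst (b k)) (5 * snd (b k)))"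
          by blast
      qed
      then have "emeasure \<mu> (E n) \<le> emeasure \<mu> (\<Union>k. ball (fst (b k)) (5 * snd (b k)))"
        by (intro emeasure_mono) auto
      also have "\<dots> \<le> (\<Sum>k. emeasure \<mu> (ball (fst (b k)) (5 * snd (b k))))"
        by (intro emeasure_subadditive_countably) auto
      finally have "t * emeasure \<mu> (E n) \<le> (\<Sum>k. t * emeasure \<mu> (ball (fst (b k)) (5 * snd (b k))))"
        by (simp add: mult_left_mono)
      also have "\<dots> \<le> (\<Sum>k. D * emeasure \<nu> (ball (fst (b k)) (snd (b k))))"
        by (intro suminf_le est) auto
      also have "\<dots> = D * emeasure \<nu> (\<Union>k. ball (fst (b k)) (snd (b k)))"
        using disj by (subst suminf_emeasure[symmetric]) auto
      also have "\<dots> \<le> D * emeasure \<nu> UNIV"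
        by (intro mult_left_mono emeasure_mono) auto
      finally show ?thesis .
    qed
    moreover have "incseq E"
      unfolding incseq_def E_def K_def by force
    then have "emeasure \<mu> (\<Union>n. E n) = (SUP n. emeasure \<mu> (E n))"
      using E_open by (intro SUP_emeasure_incseq[symmetric]) auto
    ultimately have "t * emeasure \<mu> {x. t < wmax w g x} \<le> D * emeasure \<nu> UNIV"
      by (auto simp: SUP_mult_left_ennreal intro: SUP_least)
    then show "t * (\<integral>\<^sup>+ x\<in>{x. t < wmax w g x}. w x \<partial>lebesgue) \<le> D * (\<integral>\<^sup>+ x. g x * w x \<partial>lebesgue)"
      by (simp add: \<mu>[OF wmax_sets] \<nu>)
  qed
qed

section \<open>The layer-cake formula and the strong type bound\<close>

lemma sigma_finite_lebesgue: "sigma_finite_measure (lebesgue :: 'a::euclidean_space measure)"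
proof
  obtain A :: "'a set set" where A: "countable A" "A \<subseteq> sets lborel" "\<Union>A = space lborel"
      "\<forall>a\<in>A. emeasure lborel a \<noteq> \<infinity>"
    using lborel.sigma_finite_countable by blast
  then show "\<exists>A::'a set set. countable A \<and> A \<subseteq> sets lebesgue \<and> \<Union>A = space lebesgue \<and>
      (\<forall>a\<in>A. emeasure lebesgue a \<noteq> \<infinity>)"
    by (intro exI[of _ A]) auto
qed

lemma nn_integral_powr_initial_segment:
  assumes "0 < s" "0 \<le> r"
  shows "(\<integral>\<^sup>+ t. ennreal (s * t powr (s - 1)) * indicator {0<..<r} t \<partial>lborel) = ennreal (r powr s)"
proof -
  have "((\<lambda>t. s * t powr (s - 1)) has_integral (s * (r powr (s - 1 + 1) / (s - 1 + 1)))) {0..r}"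
    using assms by (intro has_integral_mult_right has_integral_powr_from_0) auto
  moreover have "s * (r powr (s - 1 + 1) / (s - 1 + 1)) = r powr s"
    using assms by simp
  ultimately have "((\<lambda>t. s * t powr (s - 1)) has_integral (r powr s)) {0..r}"
    by (simp only:)
  then have "(\<integral>\<^sup>+ t. ennreal (s * t powr (s - 1)) * indicator {0..r} t \<partial>lborel) = ennreal (r powr s)"
    using assms by (intro nn_integral_has_integral_lebesgue') simp_all
  moreover have "(\<integral>\<^sup>+ t. ennreal (s * t powr (s - 1)) * indicator {0<..<r} t \<partial>lborel)
      = (\<integral>\<^sup>+ t. ennreal (s * t powr (s - 1)) * indicator {0..r} t \<partial>lborel)"
    using AE_lborel_singleton[of 0] AE_lborel_singleton[of r]
    by (intro nn_integral_cong_AE, eventually_elim) (auto split: split_indicator)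
  ultimately show ?thesis
    by simp
qed

lemma ennreal_top_if_ge_of_nat:
  assumes "\<And>n. of_nat n \<le> (z::ennreal)"
  shows "z = top"
proof (rule ccontr)
  assume "z \<noteq> top"
  then obtain n where "z < of_nat n"
    using ennreal_Ex_less_of_nat by (auto simp: less_top)
  then show False
    using assms[of n] by simp
qed

lemma enn_powr_layer_cake:
  assumes "0 < s"
  shows "enn_powr y s = (\<integral>\<^sup>+ t. ennreal (s * t powr (s - 1)) * indicator {t. 0 < t \<and> ennreal t < y} t \<partial>lborel)"
proof (cases y)
  case (real r)
  then have "{t. 0 < t \<and> ennreal t < y} = {0<..<r}"
    by (auto simp: ennreal_less_iff)
  then show ?thesis
    using real assms by (simp add: nn_integral_powr_initial_segment enn_powr_ennreal)
next
  case top
  \<comment> \<open>For infinite \<open>y\<close> the integral dominates the one over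
    \<open>{0<..<r}\<close> for every \<open>r\<close>; here \<open>r\<close> is chosen with
    \<open>r powr s = n\<close>.\<close>
  have "of_nat n \<le> (\<integral>\<^sup>+ t. ennreal (s * t powr (s - 1)) * indicator {t. 0 < t \<and> ennreal t < y} t \<partial>lborel)" for n
  proof -
    define r where "r = real n powr (1 / s)"
    have "of_nat n = ennreal (r powr s)"
      using assms by (simp add: r_def powr_powr ennreal_of_nat_eq_real_of_nat)
    also have "\<dots> = (\<integral>\<^sup>+ t. ennreal (s * t powr (s - 1)) * indicator {0<..<r} t \<partial>lborel)"
      using assms by (intro nn_integral_powr_initial_segment[symmetric]) (auto simp: r_def)
    also have "\<dots> \<le> (\<integral>\<^sup>+ t. ennreal (s * t powr (s - 1)) * indicator {t. 0 < t \<and> ennreal t < y} t \<partial>lborel)"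
      using top by (intro nn_integral_mono mult_left_mono) (auto split: split_indicator)
    finally show ?thesis .
  qed
  then have "(\<integral>\<^sup>+ t. ennreal (s * t powr (s - 1)) * indicator {t. 0 < t \<and> ennreal t < y} t \<partial>lborel) = top"
    by (rule ennreal_top_if_ge_of_nat)
  then show ?thesis
    using top assms by simp
qed

text \<open>Marcinkiewicz interpolation by hand: at level \<open>t\<close> only the part of
  \<open>g\<close> above \<open>t / 2\<close> matters. Integrating the weak bounds over
  \<open>t\<close> and exchanging the integrals leaves the range \<open>t < 2 * g x\<close>, which
  returns \<open>2 * g x\<close> to the power \<open>q - 1\<close>.\<close>

lemma wmax_strong_type:
  fixes w :: "'a::euclidean_space \<Rightarrow> ennreal"
  assumes w: "A1 w" and q: "1 < q"
  obtains K where "K < \<infinity>" "\<And>g. g \<in> borel_measurable lebesgue \<Longrightarrow>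
      wmod lebesgue (\<lambda>_. q) w (wmax w g) \<le> K * wmod lebesgue (\<lambda>_. q) w g"
proof -
  interpret lebesgue: sigma_finite_measure "lebesgue :: 'a measure"
    by (rule sigma_finite_lebesgue)
  interpret pair_sigma_finite "lebesgue :: 'a measure" "lborel :: real measure" ..
  note [measurable] = A1_D(1)[OF w]
  obtain D where D: "D < \<infinity>" "\<And>g t. g \<in> borel_measurable lebesgue \<Longrightarrow>
      t * (\<integral>\<^sup>+ x\<in>{x. t < wmax w g x}. w x \<partial>lebesgue) \<le> D * (\<integral>\<^sup>+ x. g x * w x \<partial>lebesgue)"
    using wmax_weak_type[OF w] by blast
  \<comment> \<open>Chosen with \<open>c * (q - 1) = 2 * q\<close>, so that
    \<open>q t^(q-1) * (2 / t)\<close> is \<open>c\<close> times the layer-cake density of exponent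
    \<open>q - 1\<close>.\<close>
  define c where "c = 2 * q / (q - 1)"
  define K where "K = ennreal c * D * enn_powr 2 (q - 1)"
  have c: "0 < c"
    using q by (simp add: c_def)
  show thesis
  proof
    have "enn_powr 2 (q - 1) < \<infinity>"
      using enn_powr_ennreal[of 2 "q - 1"] by (simp add: ennreal_less_top)
    then show "K < \<infinity>"
      using D(1) by (simp add: K_def ennreal_mult_less_top)
    fix g :: "'a \<Rightarrow> ennreal"
    assume [measurable]: "g \<in> borel_measurable lebesgue"
    have trunc: "(\<integral>\<^sup>+ x\<in>{x. ennreal t < wmax w g x}. w x \<partial>lebesgue)
        \<le> ennreal (2 / t) * (D * (\<integral>\<^sup>+ x\<in>{x. ennreal (t / 2) < g x}. g x * w x \<partial>lebesgue))" if t: "0 < t" for t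
    proof -
      \<comment> \<open>The discarded part of \<open>g\<close> is at most \<open>t / 2\<close> and
        adds at most \<open>t / 2\<close> to any average.\<close>
      define h where "h x = g x * indicator {x. ennreal (t / 2) < g x} x" for x
      have [measurable]: "h \<in> borel_measurable lebesgue"
        unfolding h_def by measurable
      have split: "wmax w g x \<le> wmax w h x + ennreal (t / 2)" for x
      proof (rule wmax_least)
        fix c \<rho> assume x: "x \<in> ball c \<rho>"
        then have "0 < \<rho>"
          by (metis ball_eq_empty empty_iff not_less)
        let ?W = "\<integral>\<^sup>+ y\<in>ball c \<rho>. w y \<partial>lebesgue"
        have W: "0 < ?W" "?W < \<infinity>"
          using A1_ball_pos[OF w \<open>0 < \<rho>\<close>] A1_ball_finite[OF w] by auto
        have "(\<integral>\<^sup>+ y\<in>ball c \<rho>. g y * w y \<partial>lebesgue)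
            \<le> (\<integral>\<^sup>+ y. h y * w y * indicator (ball c \<rho>) y + ennreal (t / 2) * (w y * indicator (ball c \<rho>) y) \<partial>lebesgue)"
        proof (intro nn_integral_mono)
          fix y
          have "g y \<le> h y + ennreal (t / 2)"
            by (auto simp: h_def not_less split: split_indicator)
          then have "g y * (w y * indicator (ball c \<rho>) y) \<le> (h y + ennreal (t / 2)) * (w y * indicator (ball c \<rho>) y)"
            by (rule mult_right_mono) simp
          then show "g y * w y * indicator (ball c \<rho>) y
              \<le> h y * w y * indicator (ball c \<rho>) y + ennreal (t / 2) * (w y * indicator (ball c \<rho>) y)"
            by (simp add: distrib_right mult.assoc)
        qed
        also have "\<dots> = (\<integral>\<^sup>+ y\<in>ball c \<rho>. h y * w y \<partial>lebesgue) + ennreal (t / 2) * ?W"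
          by (subst nn_integral_add, measurable) (subst nn_integral_cmult, auto)
        finally have "(\<integral>\<^sup>+ y\<in>ball c \<rho>. g y * w y \<partial>lebesgue) / ?W
            \<le> ((\<integral>\<^sup>+ y\<in>ball c \<rho>. h y * w y \<partial>lebesgue) + ennreal (t / 2) * ?W) / ?W"
          by (rule divide_right_mono_ennreal)
        also have "\<dots> = (\<integral>\<^sup>+ y\<in>ball c \<rho>. h y * w y \<partial>lebesgue) / ?W + ennreal (t / 2)"
          using W by (simp add: add_divide_distrib_ennreal ennreal_mult_divide_eq)
        also have "\<dots> \<le> wmax w h x + ennreal (t / 2)"
          by (intro add_right_mono wmax_upper x)
        finally show "(\<integral>\<^sup>+ y\<in>ball c \<rho>. g y * w y \<partial>lebesgue) / ?W \<le> wmax w h x + ennreal (t / 2)" .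
      qed
      have "{x. ennreal t < wmax w g x} \<subseteq> {x. ennreal (t / 2) < wmax w h x}"
      proof (intro subsetI CollectI, rule ccontr)
        fix x assume "x \<in> {x. ennreal t < wmax w g x}" "\<not> ennreal (t / 2) < wmax w h x"
        then have "wmax w g x \<le> ennreal (t / 2) + ennreal (t / 2)"
          by (intro order_trans[OF split] add_right_mono) simp
        also have "\<dots> = ennreal t"
          using t by (simp flip: ennreal_plus)
        finally show False
          using \<open>x \<in> {x. ennreal t < wmax w g x}\<close> by simp
      qed
      then have "(\<integral>\<^sup>+ x\<in>{x. ennreal t < wmax w g x}. w x \<partial>lebesgue)
          \<le> (\<integral>\<^sup>+ x\<in>{x. ennreal (t / 2) < wmax w h x}. w x \<partial>lebesgue)"
        by (intro nn_integral_mono mult_left_mono) (auto split: split_indicator)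
      also have "\<dots> = ennreal (2 / t) * (ennreal (t / 2) * (\<integral>\<^sup>+ x\<in>{x. ennreal (t / 2) < wmax w h x}. w x \<partial>lebesgue))"
        using t by (simp add: mult.assoc[symmetric] flip: ennreal_mult)
      also have "\<dots> \<le> ennreal (2 / t) * (D * (\<integral>\<^sup>+ x. h x * w x \<partial>lebesgue))"
        by (intro mult_left_mono D(2)) auto
      also have "(\<integral>\<^sup>+ x. h x * w x \<partial>lebesgue) = (\<integral>\<^sup>+ x\<in>{x. ennreal (t / 2) < g x}. g x * w x \<partial>lebesgue)"
        by (intro nn_integral_cong) (simp add: h_def mult_ac)
      finally show ?thesis .
    qed
    have "wmod lebesgue (\<lambda>_. q) w (wmax w g)
        = (\<integral>\<^sup>+ x. (\<integral>\<^sup>+ t. ennreal (q * t powr (q - 1)) * indicator {t. 0 < t \<and> ennreal t < wmax w g x} t * w x \<partial>lborel) \<partial>lebesgue)"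
      unfolding wmod_def using q
      by (subst enn_powr_layer_cake) (auto simp: nn_integral_multc)
    also have "\<dots> = (\<integral>\<^sup>+ t. (\<integral>\<^sup>+ x. ennreal (q * t powr (q - 1)) * indicator {t. 0 < t \<and> ennreal t < wmax w g x} t * w x \<partial>lebesgue) \<partial>lborel)"
      by (rule Fubini'[symmetric]) measurable
    also have "\<dots> \<le> (\<integral>\<^sup>+ t. (\<integral>\<^sup>+ x. ennreal c * D * (ennreal ((q - 1) * t powr (q - 1 - 1)) *
          indicator {t. 0 < t \<and> ennreal t < 2 * g x} t * (g x * w x)) \<partial>lebesgue) \<partial>lborel)"
    proof (rule nn_integral_mono)
      fix t :: real
      show "(\<integral>\<^sup>+ x. ennreal (q * t powr (q - 1)) * indicator {t. 0 < t \<and> ennreal t < wmax w g x} t * w x \<partial>lebesgue)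
        \<le> (\<integral>\<^sup>+ x. ennreal c * D * (ennreal ((q - 1) * t powr (q - 1 - 1)) *
          indicator {t. 0 < t \<and> ennreal t < 2 * g x} t * (g x * w x)) \<partial>lebesgue)"
      proof (cases "0 < t")
        case True
        have half: "ennreal (t / 2) < y \<longleftrightarrow> ennreal t < 2 * y" for y
          using True by (cases y) (auto simp: ennreal_less_iff ennreal_mult_top simp flip: ennreal_numeral ennreal_mult)
        have coeff: "ennreal (q * t powr (q - 1)) * ennreal (2 / t) = ennreal c * ennreal ((q - 1) * t powr (q - 1 - 1))"
        proof -
          have "t powr (q - 1 - 1) = t powr (q - 1) / t" "c * (q - 1) = 2 * q"
            using True q powr_diff[of t "q - 1" 1] by (auto simp: c_def)
          then have "q * t powr (q - 1) * (2 / t) = c * ((q - 1) * t powr (q - 1 - 1))"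
            by (simp add: mult.assoc[symmetric])
          then show ?thesis
            using True q c ennreal_mult[of "q * t powr (q - 1)" "2 / t"]
              ennreal_mult[of c "(q - 1) * t powr (q - 1 - 1)"] by simp
        qed
        have "(\<integral>\<^sup>+ x. ennreal (q * t powr (q - 1)) * indicator {t. 0 < t \<and> ennreal t < wmax w g x} t * w x \<partial>lebesgue)
            = (\<integral>\<^sup>+ x. ennreal (q * t powr (q - 1)) * (w x * indicator {x. ennreal t < wmax w g x} x) \<partial>lebesgue)"
          using True by (intro nn_integral_cong) (auto split: split_indicator)
        also have "\<dots> = ennreal (q * t powr (q - 1)) * (\<integral>\<^sup>+ x\<in>{x. ennreal t < wmax w g x}. w x \<partial>lebesgue)"
          by (rule nn_integral_cmult) measurable
        also have "\<dots> \<le> ennreal (q * t powr (q - 1)) * (ennreal (2 / t) *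
            (D * (\<integral>\<^sup>+ x\<in>{x. ennreal (t / 2) < g x}. g x * w x \<partial>lebesgue)))"
          by (intro mult_left_mono trunc True) auto
        also have "\<dots> = ennreal c * D * ennreal ((q - 1) * t powr (q - 1 - 1)) *
            (\<integral>\<^sup>+ x\<in>{x. ennreal (t / 2) < g x}. g x * w x \<partial>lebesgue)"
          unfolding mult.assoc[symmetric] coeff by (simp add: mult_ac)
        also have "\<dots> = (\<integral>\<^sup>+ x. ennreal c * D * ennreal ((q - 1) * t powr (q - 1 - 1)) *
            (g x * w x * indicator {x. ennreal (t / 2) < g x} x) \<partial>lebesgue)"
          by (rule nn_integral_cmult[symmetric]) measurable
        also have "\<dots> = (\<integral>\<^sup>+ x. ennreal c * D * (ennreal ((q - 1) * t powr (q - 1 - 1)) *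
          indicator {t. 0 < t \<and> ennreal t < 2 * g x} t * (g x * w x)) \<partial>lebesgue)"
          using True by (intro nn_integral_cong) (simp add: half mult.assoc split: split_indicator)
        finally show ?thesis .
      qed simp
    qed
    also have "\<dots> = (\<integral>\<^sup>+ x. (\<integral>\<^sup>+ t. ennreal c * D * (ennreal ((q - 1) * t powr (q - 1 - 1)) *
          indicator {t. 0 < t \<and> ennreal t < 2 * g x} t * (g x * w x)) \<partial>lborel) \<partial>lebesgue)"
      by (rule Fubini') measurable
    also have "\<dots> = (\<integral>\<^sup>+ x. ennreal c * D * (enn_powr (2 * g x) (q - 1) * (g x * w x)) \<partial>lebesgue)"
      using q by (subst enn_powr_layer_cake) (auto simp: nn_integral_multc nn_integral_cmult)
    also have "\<dots> = (\<integral>\<^sup>+ x. K * (enn_powr (g x) q * w x) \<partial>lebesgue)"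
    proof (intro nn_integral_cong)
      fix x
      have "enn_powr (g x) (q - 1) * g x = enn_powr (g x) q"
      proof (cases "g x")
        case (real r)
        then have "r powr (q - 1) * r = r powr q"
          using q powr_add[of r "q - 1" 1] by (cases "r = 0") auto
        then show ?thesis
          using q real ennreal_mult[of "r powr (q - 1)" r] by (simp add: enn_powr_ennreal)
      qed (use q in \<open>simp add: ennreal_top_mult\<close>)
      moreover have "ennreal c * D * (enn_powr (2 * g x) (q - 1) * (g x * w x))
          = K * (enn_powr (g x) (q - 1) * g x * w x)"
        using q by (simp add: K_def enn_powr_mult mult.assoc)
      ultimately show "ennreal c * D * (enn_powr (2 * g x) (q - 1) * (g x * w x)) = K * (enn_powr (g x) q * w x)"
        by simp
    qed
    also have "\<dots> = K * wmod lebesgue (\<lambda>_. q) w g"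
      unfolding wmod_def by (rule nn_integral_cmult) measurable
    finally show "wmod lebesgue (\<lambda>_. q) w (wmax w g) \<le> K * wmod lebesgue (\<lambda>_. q) w g" .
  qed
qed

section \<open>The unweighted maximal operator on spaces with an A_1 weight\<close>

lemma divide_le_mult_divide_ennreal:
  fixes a b C m W :: ennreal
  assumes m: "0 < m" "m < \<infinity>" and W: "0 < W" "W < \<infinity>" and le: "a * W \<le> C * m * b"
  shows "a / m \<le> C * (b / W)"
proof -
  have "a / m = a * W / W / m"
    using W by (subst ennreal_mult_divide_eq) auto
  also have "\<dots> \<le> C * m * b / W / m"
    by (intro divide_right_mono_ennreal le)
  also have "\<dots> = C * (b / W) * (m / m)"
    by (simp add: divide_ennreal_def mult_ac)
  also have "\<dots> = C * (b / W)"
    using m by simp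
  finally show ?thesis .
qed

lemma mem_ball_radius_pos: "x \<in> ball c \<rho> \<Longrightarrow> 0 < \<rho>"
  using zero_le_dist[of c x] by (simp del: zero_le_dist)

text \<open>Both bounds multiply the integral of \<open>u\<close> by the A_1 inequality. Used at the
  integration point it puts \<open>w y\<close> next to \<open>u y\<close> and gives the first; used
  at \<open>x\<close> it puts \<open>w x\<close> in front and gives the second. They serve
  \<open>L^q(w)\<close> and \<open>L^q(w^(1-q))\<close> respectively.\<close>

lemma wmax_one_le:
  fixes w :: "'a::euclidean_space \<Rightarrow> ennreal"
  assumes w: "A1 w"
  shows "\<exists>C. C < \<infinity> \<and> (\<forall>u\<in>borel_measurable lebesgue. \<forall>x.
      wmax (\<lambda>_. 1) u x \<le> C * wmax w u x \<and> wmax (\<lambda>_. 1) u x \<le> C * (w x * wmax w (\<lambda>y. u y / w y) x))"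
proof -
  note [measurable] = A1_D(1)[OF w]
  obtain C where C: "C < \<infinity>" "\<And>c \<rho> x. x \<in> ball c \<rho> \<Longrightarrow>
      (\<integral>\<^sup>+ y\<in>ball c \<rho>. w y \<partial>lebesgue) \<le> C * emeasure lebesgue (ball c \<rho>) * w x"
    using w unfolding A1_def by blast
  show ?thesis
  proof (intro exI[of _ C] conjI[OF C(1)] ballI allI)
    fix u :: "'a \<Rightarrow> ennreal" and x
    assume [measurable]: "u \<in> borel_measurable lebesgue"
    show "wmax (\<lambda>_. 1) u x \<le> C * wmax w u x \<and> wmax (\<lambda>_. 1) u x \<le> C * (w x * wmax w (\<lambda>y. u y / w y) x)"
    proof (intro conjI wmax_least)
      fix c \<rho> assume x: "x \<in> ball c \<rho>"
      then have \<rho>: "0 < \<rho>"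
        by (rule mem_ball_radius_pos)
      let ?W = "\<integral>\<^sup>+ y\<in>ball c \<rho>. w y \<partial>lebesgue" and ?m = "emeasure lebesgue (ball c \<rho>)"
      have "(\<integral>\<^sup>+ y\<in>ball c \<rho>. u y \<partial>lebesgue) * ?W = (\<integral>\<^sup>+ y. u y * indicator (ball c \<rho>) y * ?W \<partial>lebesgue)"
        by (rule nn_integral_multc[symmetric]) measurable
      also have "\<dots> \<le> (\<integral>\<^sup>+ y. C * ?m * (u y * w y * indicator (ball c \<rho>) y) \<partial>lebesgue)"
      proof (rule nn_integral_mono)
        fix y
        have "u y * ?W \<le> u y * (C * ?m * w y)" if "y \<in> ball c \<rho>"
          by (intro mult_left_mono C(2) that) simp
        then show "u y * indicator (ball c \<rho>) y * ?W \<le> C * ?m * (u y * w y * indicator (ball c \<rho>) y)"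
          by (cases "y \<in> ball c \<rho>") (simp_all add: mult.left_commute mult.assoc del: mem_ball emeasure_completion)
      qed
      also have "\<dots> = C * ?m * (\<integral>\<^sup>+ y\<in>ball c \<rho>. u y * w y \<partial>lebesgue)"
        by (rule nn_integral_cmult) measurable
      finally have "(\<integral>\<^sup>+ y\<in>ball c \<rho>. u y \<partial>lebesgue) / ?m \<le> C * ((\<integral>\<^sup>+ y\<in>ball c \<rho>. u y * w y \<partial>lebesgue) / ?W)"
        by (rule divide_le_mult_divide_ennreal[OF emeasure_lebesgue_ball_pos[OF \<rho>] emeasure_lebesgue_ball_finite
              A1_ball_pos[OF w \<rho>] A1_ball_finite[OF w]])
      also have "\<dots> \<le> C * wmax w u x"
        by (intro mult_left_mono wmax_upper x) simp
      finally show "(\<integral>\<^sup>+ y\<in>ball c \<rho>. u y * 1 \<partial>lebesgue) / (\<integral>\<^sup>+ y\<in>ball c \<rho>. 1 \<partial>lebesgue) \<le> C * wmax w u x"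
        by (simp add: nn_integral_indicator del: emeasure_completion)
    next
      fix c \<rho> assume x: "x \<in> ball c \<rho>"
      then have \<rho>: "0 < \<rho>"
        by (rule mem_ball_radius_pos)
      let ?W = "\<integral>\<^sup>+ y\<in>ball c \<rho>. w y \<partial>lebesgue" and ?m = "emeasure lebesgue (ball c \<rho>)"
      let ?a = "\<integral>\<^sup>+ y\<in>ball c \<rho>. u y \<partial>lebesgue"
      have "?a * ?W \<le> ?a * (C * ?m * w x)"
        by (intro mult_left_mono C(2) x) simp
      then have "?a * ?W \<le> C * ?m * (w x * ?a)"
        by (simp add: mult_ac del: emeasure_completion)
      then have "?a / ?m \<le> C * (w x * ?a / ?W)"
        by (rule divide_le_mult_divide_ennreal[OF emeasure_lebesgue_ball_pos[OF \<rho>] emeasure_lebesgue_ball_finite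
              A1_ball_pos[OF w \<rho>] A1_ball_finite[OF w]])
      also have "?a = (\<integral>\<^sup>+ y\<in>ball c \<rho>. u y / w y * w y \<partial>lebesgue)"
        using A1_D(3)[OF w]
      proof (intro nn_integral_cong_AE, eventually_elim)
        fix y assume "w y < \<infinity>"
        then show "u y * indicator (ball c \<rho>) y = u y / w y * w y * indicator (ball c \<rho>) y"
          using A1_D(2)[OF w, of y] by (simp add: ennreal_divide_times)
      qed
      also have "C * (w x * (\<integral>\<^sup>+ y\<in>ball c \<rho>. u y / w y * w y \<partial>lebesgue) / ?W) \<le> C * (w x * wmax w (\<lambda>y. u y / w y) x)"
        unfolding ennreal_times_divide[symmetric]
        by (intro mult_left_mono wmax_upper x) auto
      finally show "(\<integral>\<^sup>+ y\<in>ball c \<rho>. u y * 1 \<partial>lebesgue) / (\<integral>\<^sup>+ y\<in>ball c \<rho>. 1 \<partial>lebesgue)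
          \<le> C * (w x * wmax w (\<lambda>y. u y / w y) x)"
        using \<open>?a = _\<close> by (simp add: nn_integral_indicator del: emeasure_completion)
    qed
  qed
qed

lemma maximal_A1_bound:
  fixes w :: "'a::euclidean_space \<Rightarrow> ennreal"
  assumes w: "A1 w" and q: "1 < q"
  obtains K where "K < \<infinity>" "\<And>u. u \<in> borel_measurable lebesgue \<Longrightarrow>
      wmod lebesgue (\<lambda>_. q) w (wmax (\<lambda>_. 1) u) \<le> K * wmod lebesgue (\<lambda>_. q) w u"
proof -
  note [measurable] = A1_D(1)[OF w]
  obtain C where C_all: "C < \<infinity> \<and> (\<forall>u\<in>borel_measurable lebesgue. \<forall>x.
      wmax (\<lambda>_. 1) u x \<le> C * wmax w u x \<and> wmax (\<lambda>_. 1) u x \<le> C * (w x * wmax w (\<lambda>y. u y / w y) x))"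
    using wmax_one_le[OF w] by (rule exE)
  note C = conjunct1[OF C_all] conjunct2[OF C_all, rule_format]
  obtain K where K: "K < \<infinity>" "\<And>g. g \<in> borel_measurable lebesgue \<Longrightarrow>
      wmod lebesgue (\<lambda>_. q) w (wmax w g) \<le> K * wmod lebesgue (\<lambda>_. q) w g"
    using wmax_strong_type[OF w q] by blast
  show thesis
  proof
    show "enn_powr C q * K < \<infinity>"
      using enn_powr_finite[OF C(1), of q] K(1) q by (simp add: ennreal_mult_less_top)
    fix u :: "'a \<Rightarrow> ennreal"
    assume u [measurable]: "u \<in> borel_measurable lebesgue"
    have "wmod lebesgue (\<lambda>_. q) w (wmax (\<lambda>_. 1) u) \<le> wmod lebesgue (\<lambda>_. q) w (\<lambda>x. C * wmax w u x)"
      using q C(2)[OF u] by (intro wmod_mono) auto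
    also have "\<dots> = enn_powr C q * wmod lebesgue (\<lambda>_. q) w (wmax w u)"
      using q by (intro wmod_cmult) auto
    also have "\<dots> \<le> enn_powr C q * (K * wmod lebesgue (\<lambda>_. q) w u)"
      by (intro mult_left_mono K(2) u) simp
    finally show "wmod lebesgue (\<lambda>_. q) w (wmax (\<lambda>_. 1) u) \<le> enn_powr C q * K * wmod lebesgue (\<lambda>_. q) w u"
      by (simp add: mult.assoc)
  qed
qed

text \<open>Multiplication by \<open>w\<close> carries \<open>L^q(w)\<close> isometrically to
  \<open>L^q(w^(1-q))\<close>, since \<open>w^q w^(1-q) = w\<close> almost everywhere. With the
  second bound of \<open>wmax_one_le\<close> this reduces the claim to the operator of
  \<open>w dx\<close> on \<open>L^q(w)\<close>.\<close>

lemma maximal_A1_dual_bound: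
  fixes w :: "'a::euclidean_space \<Rightarrow> ennreal"
  assumes w: "A1 w" and q: "1 < q"
  obtains K where "K < \<infinity>" "\<And>u. u \<in> borel_measurable lebesgue \<Longrightarrow>
      wmod lebesgue (\<lambda>_. q) (\<lambda>x. enn_powr (w x) (1 - q)) (wmax (\<lambda>_. 1) u)
      \<le> K * wmod lebesgue (\<lambda>_. q) (\<lambda>x. enn_powr (w x) (1 - q)) u"
proof -
  note [measurable] = A1_D(1)[OF w]
  let ?v = "\<lambda>x. enn_powr (w x) (1 - q)"
  obtain C where C_all: "C < \<infinity> \<and> (\<forall>u\<in>borel_measurable lebesgue. \<forall>x.
      wmax (\<lambda>_. 1) u x \<le> C * wmax w u x \<and> wmax (\<lambda>_. 1) u x \<le> C * (w x * wmax w (\<lambda>y. u y / w y) x))"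
    using wmax_one_le[OF w] by (rule exE)
  note C = conjunct1[OF C_all] conjunct2[OF C_all, rule_format]
  obtain K where K: "K < \<infinity>" "\<And>g. g \<in> borel_measurable lebesgue \<Longrightarrow>
      wmod lebesgue (\<lambda>_. q) w (wmax w g) \<le> K * wmod lebesgue (\<lambda>_. q) w g"
    using wmax_strong_type[OF w q] by blast
  have transfer: "wmod lebesgue (\<lambda>_. q) ?v (\<lambda>x. w x * h x) = wmod lebesgue (\<lambda>_. q) w h" for h
    unfolding wmod_def using A1_D(3)[OF w]
  proof (intro nn_integral_cong_AE, eventually_elim)
    fix x assume "w x < \<infinity>"
    then have "enn_powr (w x) q * enn_powr (w x) (1 - q) = w x"
      using A1_D(2)[OF w, of x] enn_powr_add_pos[of "w x" q "1 - q"] by simp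
    moreover have "enn_powr (w x * h x) q * ?v x = enn_powr (h x) q * (enn_powr (w x) q * enn_powr (w x) (1 - q))"
      using q by (simp add: enn_powr_mult mult_ac)
    ultimately show "enn_powr (w x * h x) q * ?v x = enn_powr (h x) q * w x"
      by simp
  qed
  show thesis
  proof
    show "enn_powr C q * K < \<infinity>"
      using enn_powr_finite[OF C(1), of q] K(1) q by (simp add: ennreal_mult_less_top)
    fix u :: "'a \<Rightarrow> ennreal"
    assume u [measurable]: "u \<in> borel_measurable lebesgue"
    have "wmod lebesgue (\<lambda>_. q) ?v (wmax (\<lambda>_. 1) u)
        \<le> wmod lebesgue (\<lambda>_. q) ?v (\<lambda>x. C * (w x * wmax w (\<lambda>y. u y / w y) x))"
      using q C(2)[OF u] by (intro wmod_mono) auto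
    also have "\<dots> = enn_powr C q * wmod lebesgue (\<lambda>_. q) w (wmax w (\<lambda>y. u y / w y))"
      using q by (subst wmod_cmult) (auto simp: transfer)
    also have "\<dots> \<le> enn_powr C q * (K * wmod lebesgue (\<lambda>_. q) w (\<lambda>y. u y / w y))"
      by (intro mult_left_mono K(2)) auto
    also have "wmod lebesgue (\<lambda>_. q) w (\<lambda>y. u y / w y) = wmod lebesgue (\<lambda>_. q) ?v (\<lambda>x. w x * (u x / w x))"
      by (rule transfer[symmetric])
    also have "\<dots> = wmod lebesgue (\<lambda>_. q) ?v u"
      unfolding wmod_def using A1_D(3)[OF w]
    proof (intro nn_integral_cong_AE, eventually_elim)
      fix x assume "w x < \<infinity>"
      then have "w x * (u x / w x) = u x"
        using A1_D(2)[OF w, of x] by (simp add: mult.commute[of "w x"] ennreal_divide_times)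
      then show "enn_powr (w x * (u x / w x)) q * ?v x = enn_powr (u x) q * ?v x"
        by simp
    qed
    finally show "wmod lebesgue (\<lambda>_. q) ?v (wmax (\<lambda>_. 1) u) \<le> enn_powr C q * K * wmod lebesgue (\<lambda>_. q) ?v u"
      by (simp add: mult.assoc)
  qed
qed

text \<open>Positivity at every point comes for free: a zero of \<open>W\<close> at \<open>x\<close>
  makes \<open>W\<close> vanish almost everywhere on each ball about \<open>x\<close>, hence on the
  whole space, which \<open>nz\<close> excludes.\<close>

lemma A1_I:
  fixes W :: "'a::euclidean_space \<Rightarrow> ennreal"
  assumes [measurable]: "W \<in> borel_measurable lebesgue"
    and C: "C < \<infinity>" "\<And>c \<rho> x. x \<in> ball c \<rho> \<Longrightarrow>
      (\<integral>\<^sup>+ y\<in>ball c \<rho>. W y \<partial>lebesgue) \<le> C * emeasure lebesgue (ball c \<rho>) * W x"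
    and fin: "AE x in lebesgue. W x < \<infinity>" and nz: "\<not> (AE x in lebesgue. W x = 0)"
  shows "A1 W"
proof -
  have "0 < W x" for x
  proof (rule ccontr)
    assume "\<not> 0 < W x"
    then have "W x = 0"
      by simp
    have "AE y in lebesgue. W y * indicator (ball x (real (Suc n))) y = 0" for n
    proof -
      have "(\<integral>\<^sup>+ y\<in>ball x (real (Suc n)). W y \<partial>lebesgue) = 0"
        using C(2)[of x x "real (Suc n)"] \<open>W x = 0\<close> by simp
      then show ?thesis
        by (subst (asm) nn_integral_0_iff_AE) auto
    qed
    then have "AE y in lebesgue. \<forall>n. W y * indicator (ball x (real (Suc n))) y = 0"
      unfolding AE_all_countable by blast
    then have "AE y in lebesgue. W y = 0"
    proof eventually_elim
      case (elim y)
      obtain n where "dist x y < real n"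
        using reals_Archimedean2 by blast
      then have "y \<in> ball x (real (Suc n))"
        by simp
      then show ?case
        using elim[rule_format, of n] by (simp del: mem_ball)
    qed
    then show False
      using nz by simp
  qed
  then show ?thesis
    unfolding A1_def using assms by auto
qed

lemma A1_majorant_sequence:
  fixes v :: "'a::euclidean_space \<Rightarrow> ennreal" and u :: "nat \<Rightarrow> 'a \<Rightarrow> ennreal"
  assumes [measurable]: "v \<in> borel_measurable lebesgue" "\<And>j. u j \<in> borel_measurable lebesgue"
    and v: "AE x in lebesgue. v x \<noteq> 0" and m: "1 \<le> m"
    and K: "K < \<infinity>" "\<And>u. u \<in> borel_measurable lebesgue \<Longrightarrow>
      wmod lebesgue (\<lambda>_. m) v (wmax (\<lambda>_. 1) u) \<le> K * wmod lebesgue (\<lambda>_. m) v u"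
    and u: "\<And>j. wmod lebesgue (\<lambda>_. m) v (u j) \<le> 1" "wmod lebesgue (\<lambda>_. m) v (u 0) \<noteq> 0"
  obtains W where "A1 W" "wmod lebesgue (\<lambda>_. m) v W \<le> 1" "\<And>j x. u j x \<le> ennreal (4 ^ (j + 2)) * W x"
proof -
  \<comment> \<open>\<open>1 \<le> B\<close> makes \<open>inverse B\<close> to the power
    \<open>m\<close> at most \<open>inverse B\<close>, and \<open>K \<le> B\<close> absorbs the
    operator bound.\<close>
  define B where "B = max 1 K"
  have B: "1 \<le> B" "K \<le> B" "B < \<infinity>"
    using K(1) by (auto simp: B_def)
  have B': "B \<noteq> 0" "B \<noteq> \<infinity>"
    using B(1,3) by auto
  have "1 / B \<le> 1" "B / B = 1"
    using B B' by (auto intro!: divide_le_posI_ennreal simp: less_top zero_less_iff_neq_zero)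
  then have inv_B: "inverse B \<le> 1" "inverse B * B = 1"
    by (simp_all add: divide_ennreal_def mult.commute)
  have N_mod: "wmod lebesgue (\<lambda>_. m) v (\<lambda>x. wmax (\<lambda>_. 1) u x / B) \<le> 1"
    if [measurable]: "u \<in> borel_measurable lebesgue" and "wmod lebesgue (\<lambda>_. m) v u \<le> 1" for u
  proof -
    have "wmod lebesgue (\<lambda>_. m) v (\<lambda>x. wmax (\<lambda>_. 1) u x / B)
        = enn_powr (inverse B) m * wmod lebesgue (\<lambda>_. m) v (wmax (\<lambda>_. 1) u)"
      using m by (subst wmod_cmult[symmetric]) (auto simp: divide_ennreal_def mult.commute)
    also have "\<dots> \<le> inverse B * (K * 1)"
      using that m inv_B
      by (intro mult_mono enn_powr_le_self order_trans[OF K(2)]) (auto intro: mult_left_mono)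
    also have "\<dots> \<le> inverse B * B"
      using B by (auto intro!: mult_left_mono)
    finally show ?thesis
      using inv_B by simp
  qed
  obtain W where W [measurable]: "W \<in> borel_measurable lebesgue" and W': "wmod lebesgue (\<lambda>_. m) v W \<le> 1" "\<And>j x. u j x \<le> ennreal (4 ^ (j + 2)) * W x"
    "\<And>x. wmax (\<lambda>_. 1) W x \<le> 4 * B * W x" "\<not> (AE x in lebesgue. W x = 0)"
  proof (rule rubio_de_francia_sequence[where N = "wmax (\<lambda>_. 1)" and B = B and r = "\<lambda>_. m" and v = v and u = u and M = lebesgue])
    show "wmax (\<lambda>_. 1) (\<lambda>x. \<Sum>j. (1/4) ^ Suc j * u j x) x \<le> (\<Sum>j. (1/4) ^ Suc j * wmax (\<lambda>_. 1) (u j) x)"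
      if "\<And>j. u j \<in> borel_measurable lebesgue" for u :: "nat \<Rightarrow> 'a \<Rightarrow> ennreal" and x
      using that by (intro wmax_sublinear) auto
  qed (use B' m u N_mod in auto)
  have "A1 W"
  proof (rule A1_I[OF W, where C = "4 * B"])
    show "4 * B < \<infinity>"
      using B by (simp add: ennreal_mult_less_top)
    show "AE x in lebesgue. W x < \<infinity>"
      by (rule wmod_finite_AE[of "\<lambda>_. m" _ v]) (use W'(1) v m in \<open>auto intro: le_less_trans\<close>)
    show "\<not> (AE x in lebesgue. W x = 0)"
      by (rule W')
    fix c \<rho> x assume x: "x \<in> ball (c::'a) \<rho>"
    then have "0 < \<rho>"
      by (rule mem_ball_radius_pos)
    let ?m = "emeasure lebesgue (ball c \<rho>)"
    have "(\<integral>\<^sup>+ y\<in>ball c \<rho>. W y \<partial>lebesgue) / ?m \<le> wmax (\<lambda>_. 1) W x"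
      using wmax_upper[OF x, of W "\<lambda>_. 1"] by (simp add: nn_integral_indicator del: emeasure_completion)
    also have "\<dots> \<le> 4 * B * W x"
      by (rule W')
    finally have "(\<integral>\<^sup>+ y\<in>ball c \<rho>. W y \<partial>lebesgue) / ?m * ?m \<le> 4 * B * W x * ?m"
      by (rule mult_right_mono) simp
    then show "(\<integral>\<^sup>+ y\<in>ball c \<rho>. W y \<partial>lebesgue) \<le> 4 * B * ?m * W x"
      using emeasure_lebesgue_ball_pos[OF \<open>0 < \<rho>\<close>, of c] emeasure_lebesgue_ball_finite[of c \<rho>]
      by (simp add: ennreal_divide_times mult.assoc mult.commute[of "W x"] del: emeasure_completion)
  qed
  then show thesis
    using W'(1,2) that by blast
qed

subsection \<open>Products of \<open>A\<^sub>1\<close> weights\<close>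

text \<open>The ball has the centre of the cube and radius \<open>n * l\<close>: coordinate
  distances of at most \<open>l / 2\<close> sum to at most \<open>n * l / 2\<close>. It lies in a
  cube of side \<open>2 * n * l\<close>, whence the volume ratio.\<close>

lemma cube_subset_ball:
  fixes Q :: "(real ^ 'n) set"
  assumes "Q \<in> cubes"
  obtains c \<rho> where "Q \<subseteq> ball c \<rho>"
    "emeasure lebesgue (ball c \<rho>) \<le> ennreal (2 * real CARD('n)) ^ CARD('n) * emeasure lebesgue Q"
    "0 < emeasure lebesgue Q" "emeasure lebesgue Q < \<infinity>" "Q \<in> sets lebesgue"
proof -
  obtain a l where Q: "Q = cbox a (a + (\<chi> i. l))" "0 < l"
    using assms by (auto simp: cubes_def)
  define n where "n = real CARD('n)"
  have n: "1 \<le> n"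
    unfolding n_def by (simp add: Suc_le_eq)
  define c where "c = a + (\<chi> i. l / 2)"
  define \<rho> where "\<rho> = n * l"
  have \<rho>: "0 < \<rho>"
    using n Q by (simp add: \<rho>_def)
  have vol: "emeasure lborel (cbox u (u + (\<chi> i. s)) :: (real ^ 'n) set) = ennreal (s ^ CARD('n))" if "0 \<le> s" for u s
  proof -
    have "measure lborel (cbox u (u + (\<chi> i. s)) :: (real ^ 'n) set) = s ^ CARD('n)"
      using that by (subst content_cbox_cart) (auto simp: interval_ne_empty_cart)
    then show ?thesis
      using emeasure_eq_ennreal_measure[of lborel "cbox u (u + (\<chi> i. s))"]
        emeasure_lborel_cbox_finite[of u "u + (\<chi> i. s)"] by (simp add: less_top)
  qed
  have ball_sub: "ball c \<rho> \<subseteq> cbox (c - (\<chi> i. \<rho>)) ((c - (\<chi> i. \<rho>)) + (\<chi> i. 2 * \<rho>))"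
  proof
    fix x assume "x \<in> ball c \<rho>"
    then have "\<bar>(c - x) $ i\<bar> < \<rho>" for i
      using component_le_norm_cart[of "c - x" i] by (simp add: dist_norm)
    then show "x \<in> cbox (c - (\<chi> i. \<rho>)) ((c - (\<chi> i. \<rho>)) + (\<chi> i. 2 * \<rho>))"
      by (simp add: mem_box_cart abs_less_iff) (smt (verit))
  qed
  have Q_vol: "emeasure lebesgue Q = ennreal (l ^ CARD('n))"
    unfolding Q(1) using vol[of l a] Q(2) by simp
  show thesis
  proof
    show "Q \<subseteq> ball c \<rho>"
    proof
      fix x assume "x \<in> Q"
      then have "a $ i \<le> x $ i" "x $ i \<le> a $ i + l" for i
        by (auto simp: Q mem_box_cart)
      then have "\<bar>(c - x) $ i\<bar> \<le> l / 2" for i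
        using Q(2) by (simp add: c_def abs_le_iff) (smt (verit) field_sum_of_halves)
      then have "(\<Sum>i\<in>UNIV. \<bar>(c - x) $ i\<bar>) \<le> (\<Sum>i\<in>(UNIV::'n set). l / 2)"
        by (intro sum_mono) auto
      then have "norm (c - x) \<le> n * (l / 2)"
        using norm_le_l1_cart[of "c - x"] by (simp add: n_def)
      also have "\<dots> < \<rho>"
        using n Q(2) by (simp add: \<rho>_def)
      finally show "x \<in> ball c \<rho>"
        by (simp add: dist_norm)
    qed
    have "emeasure lebesgue (ball c \<rho>) \<le> ennreal ((2 * \<rho>) ^ CARD('n))"
      using emeasure_mono[OF ball_sub, of lborel] vol[of "2 * \<rho>" "c - (\<chi> i. \<rho>)"] \<rho> by simp
    also have "(2 * \<rho>) ^ CARD('n) = (2 * n) ^ CARD('n) * l ^ CARD('n)"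
      by (simp add: \<rho>_def power_mult_distrib)
    also have "ennreal \<dots> = ennreal (2 * n) ^ CARD('n) * emeasure lebesgue Q"
      unfolding Q_vol using n Q(2) by (subst ennreal_mult) (simp_all add: ennreal_power)
    finally show "emeasure lebesgue (ball c \<rho>) \<le> ennreal (2 * real CARD('n)) ^ CARD('n) * emeasure lebesgue Q"
      by (simp only: n_def)
    show "0 < emeasure lebesgue Q" "emeasure lebesgue Q < \<infinity>"
      using Q(2) by (simp_all add: Q_vol del: emeasure_completion)
    show "Q \<in> sets lebesgue"
      by (simp add: Q)
  qed
qed

text \<open>Passes from the balls of \<open>A1\<close> to the cubes of \<open>Aq\<close> by
  enclosing a cube in a ball of comparable volume. Averages are exhibited as positive reals so that
  their powers can cancel later.\<close>

lemma A1_cube: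
  fixes w :: "real ^ 'n \<Rightarrow> ennreal"
  assumes w: "A1 w"
  shows "\<exists>C. 0 < C \<and> (\<forall>Q\<in>cubes. (\<forall>x\<in>Q. average Q w \<le> ennreal C * w x) \<and>
    (\<exists>a. 0 < a \<and> average Q w = ennreal a))"
proof -
  note [measurable] = A1_D(1)[OF w]
  obtain C where C: "C < \<infinity>" "\<And>c \<rho> x. x \<in> ball c \<rho> \<Longrightarrow>
      (\<integral>\<^sup>+ y\<in>ball c \<rho>. w y \<partial>lebesgue) \<le> C * emeasure lebesgue (ball c \<rho>) * w x"
    using w unfolding A1_def by blast
  define \<kappa> where "\<kappa> = ennreal (2 * real CARD('n)) ^ CARD('n)"
  have \<kappa>: "\<kappa> < \<infinity>"
    by (simp add: \<kappa>_def power_less_top_ennreal)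
  have avg: "(\<forall>x\<in>Q. average Q w \<le> C * \<kappa> * w x) \<and> average Q w < \<infinity> \<and> 0 < average Q w"
    if Q: "Q \<in> cubes" for Q :: "(real ^ 'n) set"
  proof -
    obtain c \<rho> where B: "Q \<subseteq> ball c \<rho>"
      "emeasure lebesgue (ball c \<rho>) \<le> \<kappa> * emeasure lebesgue Q"
      "0 < emeasure lebesgue Q" "emeasure lebesgue Q < \<infinity>"
      and [measurable]: "Q \<in> sets lebesgue"
      using cube_subset_ball[OF Q] unfolding \<kappa>_def by blast
    let ?m = "emeasure lebesgue Q"
    have le_ball: "(\<integral>\<^sup>+ y\<in>Q. w y \<partial>lebesgue) \<le> (\<integral>\<^sup>+ y\<in>ball c \<rho>. w y \<partial>lebesgue)"
      using B(1) by (intro nn_integral_mono mult_left_mono) (auto split: split_indicator)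
    have "average Q w \<le> C * \<kappa> * w x" if "x \<in> Q" for x
    proof -
      have "(\<integral>\<^sup>+ y\<in>Q. w y \<partial>lebesgue) \<le> C * emeasure lebesgue (ball c \<rho>) * w x"
        using le_ball C(2)[of x c \<rho>] B(1) that by (meson order_trans subsetD)
      also have "\<dots> \<le> C * (\<kappa> * ?m) * w x"
        by (intro mult_right_mono mult_left_mono B) auto
      finally have "(\<integral>\<^sup>+ y\<in>Q. w y \<partial>lebesgue) \<le> ?m * (C * \<kappa> * w x)"
        by (simp only: mult_ac)
      then show ?thesis
        unfolding average_def by (intro divide_le_posI_ennreal B(3))
    qed
    moreover have "average Q w < \<infinity>"
      using le_ball A1_ball_finite[OF w, of c \<rho>] B(3) unfolding average_def
      by (auto simp: less_top[symmetric] ennreal_divide_eq_top_iff top_unique simp del: emeasure_completion)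
    moreover have "0 < average Q w"
    proof (rule ccontr)
      assume "\<not> 0 < average Q w"
      then have "(\<integral>\<^sup>+ y\<in>Q. w y \<partial>lebesgue) = 0"
        using B(4) by (simp add: average_def ennreal_zero_less_divide del: emeasure_completion)
      then have "AE y in lebesgue. w y * indicator Q y = 0"
        by (subst (asm) nn_integral_0_iff_AE) auto
      then have "AE y in lebesgue. y \<notin> Q"
        by eventually_elim (use A1_D(2)[OF w] in \<open>auto simp: indicator_def split: if_splits, metis less_irrefl\<close>)
      then have "?m = 0"
        by (subst (asm) AE_iff_measurable[where N = Q]) auto
      then show False
        using B(3) by (simp del: emeasure_completion)
    qed
    ultimately show ?thesis
      by blast
  qed
  have "C * \<kappa> < \<infinity>"
    using C(1) \<kappa> by (simp add: ennreal_mult_less_top)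
  then obtain d where d: "C * \<kappa> = ennreal d" "0 \<le> d"
    by (cases "C * \<kappa>") auto
  \<comment> \<open>The added 1 makes the constant positive, fit for division.\<close>
  define D where "D = d + 1"
  have D: "C * \<kappa> \<le> ennreal D" "0 < D"
    using d by (auto simp: D_def intro: ennreal_leI)
  show ?thesis
  proof (rule exI[of _ D], intro conjI ballI D(2))
    fix Q :: "(real ^ 'n) set" assume Q: "Q \<in> cubes"
    show "average Q w \<le> ennreal D * w x" if "x \<in> Q" for x
      using avg[OF Q] that D(1) by (meson mult_right_mono order_trans zero_le)
    show "\<exists>a. 0 < a \<and> average Q w = ennreal a"
      using avg[OF Q] by (cases "average Q w") auto
  qed
qed

lemma average_mono_AE:
  assumes [measurable]: "h \<in> borel_measurable lebesgue" "Q \<in> sets lebesgue"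
    and "AE x in lebesgue. x \<in> Q \<longrightarrow> f x \<le> k * h x"
  shows "average Q f \<le> k * average Q h"
proof -
  have "(\<integral>\<^sup>+ x\<in>Q. f x \<partial>lebesgue) \<le> (\<integral>\<^sup>+ x. k * (h x * indicator Q x) \<partial>lebesgue)"
    using assms(3) by (intro nn_integral_mono_AE, eventually_elim) (auto split: split_indicator)
  also have "\<dots> = k * (\<integral>\<^sup>+ x\<in>Q. h x \<partial>lebesgue)"
    by (rule nn_integral_cmult) measurable
  finally show ?thesis
    unfolding average_def ennreal_times_divide by (rule divide_right_mono_ennreal)
qed

lemma A1_finite_AE_real:
  assumes "A1 w"
  shows "AE x in lebesgue. ennreal (enn2real (w x)) = w x \<and> 0 < enn2real (w x)"
  using A1_D(3)[OF assms]
  by eventually_elim (use A1_D(2)[OF assms] in \<open>auto simp: enn2real_positive_iff less_top\<close>)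

text \<open>The easy half of Jones factorisation. On a cube the A_1 condition bounds
  \<open>u\<close> and \<open>v\<close> below by multiples of their averages \<open>a\<close> and
  \<open>b\<close>; this bounds their negative powers above, and the averages cancel in the product,
  leaving \<open>Cu * Cv powr (q - 1)\<close>.\<close>

lemma A1_factor_in_Aq:
  fixes u v :: "real ^ 'n \<Rightarrow> ennreal"
  assumes u: "A1 u" and v: "A1 v" and q: "1 < q"
  shows "(\<lambda>x. enn2real (u x) * enn2real (v x) powr (1 - q)) \<in> Aq q"
proof -
  note [measurable] = A1_D(1)[OF u] A1_D(1)[OF v]
  define w where "w x = enn2real (u x) * enn2real (v x) powr (1 - q)" for x
  have [measurable]: "w \<in> borel_measurable lebesgue"
    unfolding w_def by measurable
  have w_nonneg: "0 \<le> w x" for x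
    by (simp add: w_def)
  have w_le: "ennreal (w x) \<le> ennreal (c powr (1 - q)) * u x"
    if "ennreal (enn2real (u x)) = u x" "0 < c" "c \<le> enn2real (v x)" for x c
  proof -
    have "w x \<le> c powr (1 - q) * enn2real (u x)"
      unfolding w_def mult.commute[of "enn2real (u x)"]
      using that q by (intro mult_right_mono powr_mono2') auto
    then have "ennreal (w x) \<le> ennreal (c powr (1 - q)) * ennreal (enn2real (u x))"
      by (simp add: ennreal_leI flip: ennreal_mult)
    then show ?thesis
      using that(1) by simp
  qed
  have "weight w"
    unfolding weight_def
  proof (intro conjI allI impI w_nonneg)
    \<comment> \<open>On a ball containing \<open>K\<close> the A_1 condition keeps \<open>v\<close>
      away from 0 almost everywhere, so \<open>v powr (1 - q)\<close> is bounded there, while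
      \<open>u\<close> is integrable on the ball.\<close>
    fix K :: "(real ^ 'n) set" assume "compact K"
    then obtain R where R: "0 < R" "K \<subseteq> ball 0 R"
      using bounded_subset_ballD[OF compact_imp_bounded] by blast
    have [measurable]: "K \<in> sets lebesgue"
      using \<open>compact K\<close> by (simp add: borel_compact)
    let ?B = "ball (0::real ^ 'n) R"
    obtain C where C: "C < \<infinity>" "\<And>c \<rho> x. x \<in> ball c \<rho> \<Longrightarrow>
        (\<integral>\<^sup>+ y\<in>ball c \<rho>. v y \<partial>lebesgue) \<le> C * emeasure lebesgue (ball c \<rho>) * v x"
      using v unfolding A1_def by blast
    have "C * emeasure lebesgue ?B < \<infinity>"
      using C(1) emeasure_lebesgue_ball_finite[of "0 :: real ^ 'n" R]
      by (simp add: ennreal_mult_less_top del: emeasure_completion)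
    then obtain k where k: "C * emeasure lebesgue ?B = ennreal k" "0 \<le> k"
      by (cases "C * emeasure lebesgue ?B") auto
    obtain V where V: "(\<integral>\<^sup>+ y\<in>?B. v y \<partial>lebesgue) = ennreal V" "0 < V"
      using A1_ball_pos[OF v R(1), of 0] A1_ball_finite[OF v, of 0 R]
      by (cases "\<integral>\<^sup>+ y\<in>?B. v y \<partial>lebesgue") auto
    have "(\<integral>\<^sup>+ x. ennreal (w x) * indicator K x \<partial>lebesgue)
        \<le> (\<integral>\<^sup>+ x. ennreal ((V / (k + 1)) powr (1 - q)) * (u x * indicator ?B x) \<partial>lebesgue)"
      using A1_finite_AE_real[OF u] A1_finite_AE_real[OF v]
    proof (intro nn_integral_mono_AE, eventually_elim)
      case (elim x)
      show ?case
      proof (cases "x \<in> K")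
        case True
        then have x: "x \<in> ?B"
          using R by blast
        have "ennreal V \<le> ennreal k * v x"
          using C(2)[OF x] k V by simp
        also have "\<dots> = ennreal (k * enn2real (v x))"
          using elim k by (simp add: ennreal_mult')
        finally have "V \<le> k * enn2real (v x)"
          using k by (subst (asm) ennreal_le_iff) auto
        also have "\<dots> \<le> (k + 1) * enn2real (v x)"
          by (intro mult_right_mono) auto
        finally have "V / (k + 1) \<le> enn2real (v x)"
          using k by (simp add: divide_le_eq mult.commute)
        then have "ennreal (w x) \<le> ennreal ((V / (k + 1)) powr (1 - q)) * u x"
          using elim V k by (intro w_le) auto
        then show ?thesis
          using True x by simp
      qed simp
    qed
    also have "\<dots> = ennreal ((V / (k + 1)) powr (1 - q)) * (\<integral>\<^sup>+ x\<in>?B. u x \<partial>lebesgue)"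
      by (rule nn_integral_cmult) measurable
    also have "\<dots> < \<infinity>"
      using A1_ball_finite[OF u, of 0 R] by (simp add: ennreal_mult_less_top)
    finally have fin: "(\<integral>\<^sup>+ x. ennreal (w x) * indicator K x \<partial>lebesgue) < \<infinity>" .
    have "(\<integral>\<^sup>+ x. ennreal (norm (indicator K x *\<^sub>R w x)) \<partial>lebesgue) = (\<integral>\<^sup>+ x. ennreal (w x) * indicator K x \<partial>lebesgue)"
      using w_nonneg by (intro nn_integral_cong) (auto split: split_indicator)
    then show "set_integrable lebesgue K w"
      unfolding set_integrable_def using fin by (intro integrableI_bounded) auto
  qed
  moreover
  obtain Cu where Cu: "0 < Cu \<and> (\<forall>Q\<in>cubes. (\<forall>x\<in>Q. average Q u \<le> ennreal Cu * u x) \<and>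
    (\<exists>a. 0 < a \<and> average Q u = ennreal a))"
    using A1_cube[OF u] ..
  obtain Cv where Cv: "0 < Cv \<and> (\<forall>Q\<in>cubes. (\<forall>x\<in>Q. average Q v \<le> ennreal Cv * v x) \<and>
    (\<exists>a. 0 < a \<and> average Q v = ennreal a))"
    using A1_cube[OF v] ..
  have "Aq_bound q w (Cu * Cv powr (q - 1))"
    unfolding Aq_bound_def
  proof (intro conjI ballI)
    show "0 \<le> Cu * Cv powr (q - 1)"
      using Cu by simp
    fix Q :: "(real ^ 'n) set" assume Q: "Q \<in> cubes"
    have [measurable]: "Q \<in> sets lebesgue"
      using cube_subset_ball[OF Q] by blast
    obtain a where a: "0 < a" "average Q u = ennreal a"
      using Cu Q by blast
    obtain b where b: "0 < b" "average Q v = ennreal b"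
      using Cv Q by blast
    \<comment> \<open>With this exponent the factor \<open>v powr (1 - q)\<close> turns back into
      \<open>v\<close> in the second average.\<close>
    have q': "1 - conj_exponent q = - 1 / (q - 1)"
      using q by (simp add: conj_exponent_def field_simps)
    have avg_le: "average Q u \<le> ennreal Cu * u x" "average Q v \<le> ennreal Cv * v x" if "x \<in> Q" for x
      using conjunct2[OF Cu, rule_format, OF Q] conjunct2[OF Cv, rule_format, OF Q] that by blast+
    have lower: "AE x in lebesgue. x \<in> Q \<longrightarrow> a / Cu \<le> enn2real (u x) \<and> b / Cv \<le> enn2real (v x)"
      using A1_finite_AE_real[OF u] A1_finite_AE_real[OF v]
    proof (eventually_elim, intro impI)
      fix x assume elim: "ennreal (enn2real (u x)) = u x \<and> 0 < enn2real (u x)"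
          "ennreal (enn2real (v x)) = v x \<and> 0 < enn2real (v x)" "x \<in> Q"
      have "ennreal a \<le> ennreal Cu * ennreal (enn2real (u x))"
          "ennreal b \<le> ennreal Cv * ennreal (enn2real (v x))"
        using avg_le[of x] a b elim by simp_all
      then have "a \<le> Cu * enn2real (u x)" "b \<le> Cv * enn2real (v x)"
        using Cu Cv by (simp_all flip: ennreal_mult')
      then show "a / Cu \<le> enn2real (u x) \<and> b / Cv \<le> enn2real (v x)"
        using Cu Cv by (simp add: divide_le_eq mult.commute)
    qed
    have "average Q (\<lambda>x. ennreal (w x)) \<le> ennreal ((b / Cv) powr (1 - q)) * average Q u"
    proof (rule average_mono_AE)
      show "AE x in lebesgue. x \<in> Q \<longrightarrow> ennreal (w x) \<le> ennreal ((b / Cv) powr (1 - q)) * u x"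
        using lower A1_finite_AE_real[OF u]
        by eventually_elim (use b Cv in \<open>auto intro!: w_le\<close>)
    qed measurable
    then have 1: "average Q (\<lambda>x. ennreal (w x)) \<le> ennreal ((b / Cv) powr (1 - q) * a)"
      using a by (simp add: ennreal_mult')
    have "average Q (\<lambda>x. enn_powr (ennreal (w x)) (1 - conj_exponent q))
        \<le> ennreal ((a / Cu) powr (- 1 / (q - 1))) * average Q v"
    proof (rule average_mono_AE)
      show "AE x in lebesgue. x \<in> Q \<longrightarrow> enn_powr (ennreal (w x)) (1 - conj_exponent q)
          \<le> ennreal ((a / Cu) powr (- 1 / (q - 1))) * v x"
        using lower A1_finite_AE_real[OF u] A1_finite_AE_real[OF v]
      proof (eventually_elim, intro impI)
        fix x assume elim: "ennreal (enn2real (u x)) = u x \<and> 0 < enn2real (u x)"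
          "ennreal (enn2real (v x)) = v x \<and> 0 < enn2real (v x)"
          and "x \<in> Q \<longrightarrow> a / Cu \<le> enn2real (u x) \<and> b / Cv \<le> enn2real (v x)" "x \<in> Q"
        then have bounds: "a / Cu \<le> enn2real (u x)" "b / Cv \<le> enn2real (v x)"
          by auto
        have "0 < w x"
          using elim by (simp add: w_def)
        moreover have "w x powr (- 1 / (q - 1)) = enn2real (u x) powr (- 1 / (q - 1)) * enn2real (v x)"
        proof -
          have "(1 - q) * (- 1 / (q - 1)) = 1"
            using q by (simp add: field_simps)
          then show ?thesis
            using elim by (simp only: w_def powr_mult powr_powr) simp
        qed
        moreover have "enn2real (u x) powr (- 1 / (q - 1)) \<le> (a / Cu) powr (- 1 / (q - 1))"
          using bounds a Cu q by (intro powr_mono2') auto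
        ultimately have "enn_powr (ennreal (w x)) (1 - conj_exponent q)
            \<le> ennreal ((a / Cu) powr (- 1 / (q - 1)) * enn2real (v x))"
          by (simp add: enn_powr_ennreal q' ennreal_leI mult_right_mono)
        then show "enn_powr (ennreal (w x)) (1 - conj_exponent q)
            \<le> ennreal ((a / Cu) powr (- 1 / (q - 1))) * v x"
          using elim by (simp add: ennreal_mult')
      qed
    qed measurable
    then have "average Q (\<lambda>x. enn_powr (ennreal (w x)) (1 - conj_exponent q))
        \<le> ennreal ((a / Cu) powr (- 1 / (q - 1)) * b)"
      using b by (simp add: ennreal_mult')
    then have "enn_powr (average Q (\<lambda>x. enn_powr (ennreal (w x)) (1 - conj_exponent q))) (q - 1)
        \<le> enn_powr (ennreal ((a / Cu) powr (- 1 / (q - 1)) * b)) (q - 1)"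
      using q by (intro enn_powr_mono) auto
    also have "\<dots> = ennreal (Cu / a * b powr (q - 1))"
    proof -
      have "((a / Cu) powr (- 1 / (q - 1)) * b) powr (q - 1) = Cu / a * b powr (q - 1)"
      proof -
        have "((a / Cu) powr (- 1 / (q - 1))) powr (q - 1) = (a / Cu) powr (- 1)"
          using q by (simp only: powr_powr) simp
        also have "\<dots> = Cu / a"
          using a Cu by (simp add: powr_minus_divide)
        finally show ?thesis
          using b by (simp only: powr_mult)
      qed
      then show ?thesis
        using a b q Cu by (simp add: enn_powr_ennreal)
    qed
    finally have "average Q (\<lambda>x. ennreal (w x)) *
        enn_powr (average Q (\<lambda>x. enn_powr (ennreal (w x)) (1 - conj_exponent q))) (q - 1)
        \<le> ennreal ((b / Cv) powr (1 - q) * a) * ennreal (Cu / a * b powr (q - 1))"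
      using 1 by (intro mult_mono) auto
    also have "\<dots> = ennreal (Cu * Cv powr (q - 1))"
    proof -
      have "(b / Cv) powr (1 - q) * b powr (q - 1) = Cv powr (q - 1)"
      proof -
        have "(b / Cv) powr (1 - q) * (b / Cv) powr (q - 1) = 1"
          using b Cv by (simp flip: powr_add)
        moreover have "b powr (q - 1) = (b / Cv) powr (q - 1) * Cv powr (q - 1)"
          using b Cv by (simp flip: powr_mult)
        ultimately show ?thesis
          by (simp only: mult.assoc[symmetric])
      qed
      moreover have "((b / Cv) powr (1 - q) * a) * (Cu / a * b powr (q - 1))
          = Cu * ((b / Cv) powr (1 - q) * b powr (q - 1))"
        using a by simp
      ultimately have "((b / Cv) powr (1 - q) * a) * (Cu / a * b powr (q - 1)) = Cu * Cv powr (q - 1)"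
        by (simp only:)
      then show ?thesis
        using a b Cu by (simp flip: ennreal_mult)
    qed
    finally show "average Q (\<lambda>x. ennreal (w x)) *
        enn_powr (average Q (\<lambda>x. enn_powr (ennreal (w x)) (1 - conj_exponent q))) (q - 1)
        \<le> ennreal (Cu * Cv powr (q - 1))" .
  qed
  ultimately show ?thesis
    unfolding Aq_def w_def by blast
qed

subsection \<open>Extrapolation to a constant exponent\<close>

text \<open>For \<open>H = \<Omega> powr a * \<omega> powr b\<close> the last hypothesis amounts to
  \<open>y \<le> K powr a * H\<close>, and the weight on the left is
  \<open>H powr (- e) * \<omega> powr ds\<close>. The surplus \<open>y powr e\<close> is thus
  absorbed by the weight at the price \<open>K powr (a * e)\<close>.\<close>

lemma extrapolation_down_majorant_estimate:
  fixes y \<omega> \<Omega> K :: real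
  assumes y: "0 \<le> y" and pos: "0 < \<omega>" "0 < \<Omega>" "0 < K" and a: "0 < a" and e: "0 < e" and s: "0 < s"
    and ae: "a * e = \<delta> * (p - 1)" and be: "b * e = ds - \<delta>"
    and le: "(y * \<omega> powr (- b)) powr (1 / a) \<le> K * \<Omega>"
  shows "y powr (s + e) * (\<omega> * \<Omega> powr (1 - p)) powr \<delta> \<le> K powr (\<delta> * (p - 1)) * (y powr s * \<omega> powr ds)"
proof -
  have "((y * \<omega> powr (- b)) powr (1 / a)) powr a \<le> (K * \<Omega>) powr a"
    using a by (intro powr_mono2 le) auto
  then have "y * \<omega> powr (- b) \<le> (K * \<Omega>) powr a"
    using a y by (simp add: powr_powr)
  then have "y * \<omega> powr (- b) * \<omega> powr b \<le> (K * \<Omega>) powr a * \<omega> powr b"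
    by (rule mult_right_mono) simp
  then have "y \<le> (K * \<Omega>) powr a * \<omega> powr b"
    using pos by (simp add: mult.assoc flip: powr_add)
  then have "y powr e \<le> ((K * \<Omega>) powr a * \<omega> powr b) powr e"
    using y e by (intro powr_mono2) auto
  also have "\<dots> = K powr (\<delta> * (p - 1)) * \<Omega> powr (\<delta> * (p - 1)) * \<omega> powr (ds - \<delta>)"
    by (simp add: powr_mult powr_powr ae be)
  finally have "y powr s * y powr e * (\<omega> powr \<delta> * \<Omega> powr (- (\<delta> * (p - 1))))
      \<le> y powr s * (K powr (\<delta> * (p - 1)) * \<Omega> powr (\<delta> * (p - 1)) * \<omega> powr (ds - \<delta>))
        * (\<omega> powr \<delta> * \<Omega> powr (- (\<delta> * (p - 1))))"
    by (intro mult_right_mono mult_left_mono) auto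
  also have "\<dots> = K powr (\<delta> * (p - 1)) * (y powr s * (\<omega> powr (ds - \<delta>) * \<omega> powr \<delta>))
      * (\<Omega> powr (\<delta> * (p - 1)) * \<Omega> powr (- (\<delta> * (p - 1))))"
    by (simp only: mult_ac)
  also have "\<dots> = K powr (\<delta> * (p - 1)) * (y powr s * \<omega> powr ds)"
    using pos by (simp flip: powr_add)
  also have "y powr s * y powr e = y powr (s + e)"
    by (simp add: powr_add)
  also have "\<omega> powr \<delta> * \<Omega> powr (- (\<delta> * (p - 1))) = (\<omega> * \<Omega> powr (1 - p)) powr \<delta>"
    by (simp add: powr_mult powr_powr algebra_simps)
  finally show ?thesis .
qed

text \<open>Goes in the opposite direction, by comparing \<open>y\<close> with
  \<open>\<epsilon> * H\<close> for the same \<open>H\<close>. Large \<open>y\<close> satisfy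
  \<open>y powr (- e) \<le> (\<epsilon> * H) powr (- e)\<close>, which yields the first term; small
  \<open>y\<close> satisfy \<open>y powr s \<le> (\<epsilon> * H) powr s\<close>, and
  \<open>b * s + ds = 1\<close> leaves exactly one power of \<open>\<omega>\<close> in the
  second.\<close>

lemma extrapolation_down_splitting:
  fixes y \<omega> \<Omega> \<epsilon> :: real
  assumes y: "0 \<le> y" and pos: "0 < \<omega>" "0 < \<Omega>" "0 < \<epsilon>" and e: "0 < e" and s: "0 < s"
    and ae: "a * e = \<delta> * (p - 1)" and be: "b * e = ds - \<delta>" and bs: "b * s + ds = 1"
  shows "y powr s * \<omega> powr ds
    \<le> \<epsilon> powr (- e) * (y powr (s + e) * (\<omega> * \<Omega> powr (1 - p)) powr \<delta>) + \<epsilon> powr s * (\<Omega> powr (s * a) * \<omega>)"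
proof -
  define H where "H = \<Omega> powr a * \<omega> powr b"
  have H: "0 < H"
    using pos by (simp add: H_def)
  have nonneg: "0 \<le> \<epsilon> powr (- e) * (y powr (s + e) * (\<omega> * \<Omega> powr (1 - p)) powr \<delta>)"
      "0 \<le> \<epsilon> powr s * (\<Omega> powr (s * a) * \<omega>)"
    using pos by auto
  show ?thesis
  proof (cases "\<epsilon> * H \<le> y")
    case True
    then have y_pos: "0 < y"
      using H pos by (meson less_le_trans mult_pos_pos)
    have "y powr (- e) \<le> (\<epsilon> * H) powr (- e)"
      using True H pos e by (intro powr_mono2') auto
    also have "\<dots> = \<epsilon> powr (- e) * (\<Omega> powr (- (\<delta> * (p - 1))) * \<omega> powr (\<delta> - ds))"
      using ae be by (simp add: H_def powr_mult powr_powr)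
    finally have "y powr (s + e) * y powr (- e) * \<omega> powr ds
        \<le> y powr (s + e) * (\<epsilon> powr (- e) * (\<Omega> powr (- (\<delta> * (p - 1))) * \<omega> powr (\<delta> - ds))) * \<omega> powr ds"
      by (intro mult_right_mono mult_left_mono) auto
    also have "\<dots> = \<epsilon> powr (- e) * (y powr (s + e) * ((\<omega> powr (\<delta> - ds) * \<omega> powr ds) * \<Omega> powr (- (\<delta> * (p - 1)))))"
      by (simp only: mult_ac)
    also have "\<omega> powr (\<delta> - ds) * \<omega> powr ds = \<omega> powr \<delta>"
      by (simp flip: powr_add)
    also have "\<omega> powr \<delta> * \<Omega> powr (- (\<delta> * (p - 1))) = (\<omega> * \<Omega> powr (1 - p)) powr \<delta>"
      by (simp add: powr_mult powr_powr algebra_simps)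
    also have "y powr (s + e) * y powr (- e) = y powr s"
      by (simp flip: powr_add)
    finally show ?thesis
      using nonneg by linarith
  next
    case False
    then have "y powr s \<le> (\<epsilon> * H) powr s"
      using y s by (intro powr_mono2) auto
    also have "\<dots> = \<epsilon> powr s * (\<Omega> powr (s * a) * \<omega> powr (b * s))"
      by (simp add: H_def powr_mult powr_powr mult.commute[of s a])
    finally have "y powr s * \<omega> powr ds \<le> \<epsilon> powr s * (\<Omega> powr (s * a) * \<omega> powr (b * s)) * \<omega> powr ds"
      by (rule mult_right_mono) simp
    also have "\<dots> = \<epsilon> powr s * (\<Omega> powr (s * a) * (\<omega> powr (b * s) * \<omega> powr ds))"
      by (simp only: mult_ac)
    also have "\<omega> powr (b * s) * \<omega> powr ds = \<omega>"
      using pos bs by (simp flip: powr_add)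
    finally show ?thesis
      using nonneg by linarith
  qed
qed

text \<open>Young's inequality for the exponents \<open>(p + P) / p\<close> and
  \<open>(p + P) / P\<close>, by comparing \<open>\<Omega> powr \<delta>\<close> with
  \<open>y powr P * \<omega> powr ds\<close>. The two equations identify the resulting powers of
  \<open>\<Omega>\<close> and \<open>\<omega>\<close> as \<open>q\<close> and
  \<open>1 - q\<close>.\<close>

lemma extrapolation_up_Young:
  fixes y \<omega> \<Omega> :: real
  assumes y: "0 \<le> y" and pos: "0 < \<omega>" "0 < \<Omega>" and P: "0 < P" and p: "0 < p"
    and qP: "q * P = \<delta> * (p + P)" and q1: "(q - 1) * P = ds * p"
  shows "y powr p * \<Omega> powr \<delta> \<le> y powr (p + P) * \<omega> powr ds + \<Omega> powr q * \<omega> powr (1 - q)"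
proof (cases "\<Omega> powr \<delta> \<le> y powr P * \<omega> powr ds")
  case True
  then have "y powr p * \<Omega> powr \<delta> \<le> y powr p * (y powr P * \<omega> powr ds)"
    by (rule mult_left_mono) simp
  then show ?thesis
    using pos by (simp add: powr_add mult.assoc add_increasing2)
next
  case False
  then have "y powr P * \<omega> powr ds * \<omega> powr (- ds) \<le> \<Omega> powr \<delta> * \<omega> powr (- ds)"
    by (intro mult_right_mono) auto
  then have "y powr P \<le> \<Omega> powr \<delta> * \<omega> powr (- ds)"
    using pos by (simp add: mult.assoc flip: powr_add)
  then have "(y powr P) powr (p / P) \<le> (\<Omega> powr \<delta> * \<omega> powr (- ds)) powr (p / P)"
    using P p by (intro powr_mono2) auto
  then have "y powr p \<le> \<Omega> powr (\<delta> * (p / P)) * \<omega> powr (- ds * (p / P))"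
    using P by (simp add: powr_powr powr_mult)
  also have "- ds * (p / P) = 1 - q"
    using q1 P by (simp add: field_simps)
  finally have "y powr p * \<Omega> powr \<delta> \<le> \<Omega> powr (\<delta> * (p / P)) * \<omega> powr (1 - q) * \<Omega> powr \<delta>"
    by (rule mult_right_mono) simp
  also have "\<dots> = \<Omega> powr (\<delta> * (p / P) + \<delta>) * \<omega> powr (1 - q)"
    by (simp add: powr_add mult_ac)
  also have "\<delta> * (p / P) + \<delta> = q"
    using qP P by (simp add: field_simps)
  finally show ?thesis
    by (simp add: add_increasing)
qed

section \<open>Sequences that violate the inequality, and their growth\<close>

lemma normalised_violating_sequence:
  fixes G :: "(('a \<Rightarrow> ennreal) \<times> ('a \<Rightarrow> ennreal)) set"
  assumes [measurable]: "v \<in> borel_measurable M"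
    and G: "\<And>f g. (f, g) \<in> G \<Longrightarrow> f \<in> borel_measurable M \<and> g \<in> borel_measurable M"
    and s: "0 < s"
    and violated: "\<not> (\<exists>C::real. \<forall>(f, g)\<in>G. wmod M (\<lambda>_. s) v f < \<infinity> \<longrightarrow>
      wmod M (\<lambda>_. s) v f \<le> ennreal C * wmod M (\<lambda>_. s) v g)"
  shows "\<exists>f g a. \<forall>j::nat. (f j, g j) \<in> G \<and> 0 < a j \<and> wmod M (\<lambda>_. s) v (\<lambda>x. ennreal (a j) * f j x) = 1 \<and>
    wmod M (\<lambda>_. s) v (\<lambda>x. ennreal (16 ^ j * a j) * g j x) \<le> 1"
proof -
  have "\<exists>f g a. (f, g) \<in> G \<and> 0 < a \<and> wmod M (\<lambda>_. s) v (\<lambda>x. ennreal a * f x) = 1 \<and>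
    wmod M (\<lambda>_. s) v (\<lambda>x. ennreal (16 ^ j * a) * g x) \<le> 1" for j :: nat
  proof -
    \<comment> \<open>\<open>(16 ^ j) powr s\<close> is the factor by which a modular of exponent
      \<open>s\<close> grows when its argument is multiplied by \<open>16 ^ j\<close>. Strictness of
      the failure makes the modular of \<open>f\<close> positive, so it can be normalised.\<close>
    have "\<not> (\<forall>(f, g)\<in>G. wmod M (\<lambda>_. s) v f < \<infinity> \<longrightarrow>
        wmod M (\<lambda>_. s) v f \<le> ennreal ((16 ^ j) powr s) * wmod M (\<lambda>_. s) v g)"
      using violated by blast
    then obtain f g where fg: "(f, g) \<in> G" and fin: "wmod M (\<lambda>_. s) v f < \<infinity>"
      and less: "ennreal ((16 ^ j) powr s) * wmod M (\<lambda>_. s) v g < wmod M (\<lambda>_. s) v f"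
      by (metis (no_types, lifting) case_prodI2 not_le)
    note [measurable] = G[OF fg, THEN conjunct1] G[OF fg, THEN conjunct2]
    obtain t where t: "wmod M (\<lambda>_. s) v f = ennreal t" "0 \<le> t"
      using fin by (cases "wmod M (\<lambda>_. s) v f") auto
    have "0 < t"
    proof (rule ccontr)
      assume "\<not> 0 < t"
      with t less show False
        by simp
    qed
    define a where "a = t powr (- 1 / s)"
    have a: "0 < a"
      using \<open>0 < t\<close> by (simp add: a_def)
    have "a powr s = t powr (- 1)"
      unfolding a_def powr_powr using s by simp
    then have a_powr: "a powr s = 1 / t"
      using \<open>0 < t\<close> by (simp add: powr_minus_divide)
    have "wmod M (\<lambda>_. s) v (\<lambda>x. ennreal a * f x) = ennreal (1 / t) * ennreal t"
      using s a a_powr t by (simp add: wmod_scale)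
    also have "\<dots> = 1"
      using \<open>0 < t\<close> by (simp flip: ennreal_mult)
    finally have 1: "wmod M (\<lambda>_. s) v (\<lambda>x. ennreal a * f x) = 1" .
    have "wmod M (\<lambda>_. s) v (\<lambda>x. ennreal (16 ^ j * a) * g x)
        = ennreal (1 / t) * (ennreal ((16 ^ j) powr s) * wmod M (\<lambda>_. s) v g)"
    proof -
      have "(16 ^ j * a) powr s = 1 / t * (16 ^ j) powr s"
        by (simp add: powr_mult a_powr)
      then have "ennreal ((16 ^ j * a) powr s) = ennreal (1 / t) * ennreal ((16 ^ j) powr s)"
        using \<open>0 < t\<close> by (simp only: ennreal_mult') (simp add: ennreal_mult'[symmetric])
      then show ?thesis
        using s a by (subst wmod_scale) (auto simp: mult.assoc)
    qed
    also have "\<dots> \<le> ennreal (1 / t) * ennreal t"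
      using less t by (intro mult_left_mono) auto
    also have "\<dots> = 1"
      using \<open>0 < t\<close> by (simp flip: ennreal_mult)
    finally show ?thesis
      using fg a 1 by blast
  qed
  then show ?thesis
    by metis
qed

text \<open>The hypothesis concerns the unscaled pair, since the family need not contain multiples
  of its members. Homogeneity of degree \<open>s\<close> carries it over to the normalised
  pair.\<close>

lemma wmod_scaled_transfer:
  assumes [measurable]: "v \<in> borel_measurable M" "f \<in> borel_measurable M" "g \<in> borel_measurable M"
    and s: "1 \<le> s" and a: "0 < a"
    and le: "wmod M (\<lambda>_. s) v f < \<infinity> \<Longrightarrow> wmod M (\<lambda>_. s) v f \<le> ennreal C * wmod M (\<lambda>_. s) v g"
    and fin: "wmod M (\<lambda>_. s) v (\<lambda>x. ennreal a * f x) < \<infinity>"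
  shows "ennreal ((16 ^ j) powr s) * wmod M (\<lambda>_. s) v (\<lambda>x. ennreal a * f x)
    \<le> ennreal C * wmod M (\<lambda>_. s) v (\<lambda>x. ennreal (16 ^ j * a) * g x)"
proof -
  have eq: "wmod M (\<lambda>_. s) v (\<lambda>x. ennreal a * f x) = ennreal (a powr s) * wmod M (\<lambda>_. s) v f"
    using s a by (simp add: wmod_scale)
  have "wmod M (\<lambda>_. s) v f \<noteq> top"
    using fin a unfolding eq by (auto simp: ennreal_mult_top)
  then have "wmod M (\<lambda>_. s) v f \<le> ennreal C * wmod M (\<lambda>_. s) v g"
    by (intro le) (simp add: less_top)
  then have "ennreal ((16 ^ j) powr s) * (ennreal (a powr s) * wmod M (\<lambda>_. s) v f)
      \<le> ennreal ((16 ^ j) powr s) * (ennreal (a powr s) * (ennreal C * wmod M (\<lambda>_. s) v g))"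
    by (intro mult_left_mono) auto
  also have "\<dots> = ennreal C * wmod M (\<lambda>_. s) v (\<lambda>x. ennreal (16 ^ j * a) * g x)"
    using s a by (subst wmod_scale) (simp_all add: powr_mult ennreal_mult mult_ac)
  finally show ?thesis
    unfolding eq .
qed

lemma no_geometric_growth:
  fixes \<kappa> D :: real
  assumes "0 < \<kappa>" "\<And>j. \<kappa> * 4 ^ j \<le> D"
  shows False
proof -
  obtain j where "D / \<kappa> < 4 ^ j"
    using real_arch_pow[of 4] by auto
  then show False
    using assms(1) assms(2)[of j] by (simp add: divide_less_eq mult.commute)
qed

text \<open>The gain \<open>16 ^ j\<close> against the loss \<open>4 ^ (j + 2)\<close> of the
  majorant leaves \<open>4 ^ j\<close>; the 16 on the right is \<open>4 ^ 2\<close>.\<close>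

lemma geometric_gap:
  fixes \<kappa> D t :: real
  assumes "16 ^ j * t \<le> D" "\<kappa> \<le> 4 ^ (j + 2) * t"
  shows "\<kappa> * 4 ^ j \<le> 16 * D"
proof -
  have "16 ^ j * \<kappa> \<le> 16 ^ j * (4 ^ (j + 2) * t)"
    by (intro mult_left_mono assms) simp
  also have "\<dots> = 4 ^ (j + 2) * (16 ^ j * t)"
    by (simp only: mult.left_commute)
  also have "\<dots> \<le> 4 ^ (j + 2) * D"
    by (intro mult_left_mono assms) simp
  finally have "16 ^ j * \<kappa> \<le> 4 ^ (j + 2) * D" .
  moreover have "(16::real) ^ j = 4 ^ j * 4 ^ j"
    by (simp flip: power_mult_distrib)
  ultimately have "4 ^ j * (\<kappa> * 4 ^ j) \<le> 4 ^ j * (16 * D)"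
    by (simp add: power_add mult_ac)
  then show ?thesis
    by (rule mult_left_le_imp_le) simp
qed

lemma A1_one: "A1 (\<lambda>_::'a::euclidean_space. 1)"
  unfolding A1_def by (intro conjI exI[of _ 1]) (auto simp: nn_integral_indicator)

text \<open>
  The \<open>\<delta>\<close>-th power of a product \<open>u v\<^sup>1\<^sup>-\<^sup>p\<close>, which is an \<open>A\<^sub>p\<close> weight if \<open>u\<close> and \<open>v\<close> are in \<open>A\<^sub>1\<close>. The
  conversion \<open>enn2real\<close> replaces the value \<open>\<infinity>\<close> by \<open>0\<close>, on a null set only.
\<close>

definition factored_weight ::
    "real \<Rightarrow> real \<Rightarrow> ('a \<Rightarrow> ennreal) \<Rightarrow> ('a \<Rightarrow> ennreal) \<Rightarrow> 'a \<Rightarrow> ennreal" where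
  "factored_weight p \<delta> u v x = ennreal ((enn2real (u x) * enn2real (v x) powr (1 - p)) powr \<delta>)"

lemma factored_weight_measurable:
  assumes "A1 u" "A1 v"
  shows "factored_weight p \<delta> u v \<in> borel_measurable lebesgue"
proof -
  note [measurable] = A1_D(1)[OF assms(1)] A1_D(1)[OF assms(2)]
  show ?thesis
    unfolding factored_weight_def by measurable
qed

lemma factored_weight_one:
  assumes "A1 u"
  shows "AE x in lebesgue. factored_weight p \<delta> u (\<lambda>_. 1) x = enn_powr (u x) \<delta>"
  using A1_D(3)[OF assms]
proof eventually_elim
  fix x assume "u x < \<infinity>"
  then obtain r where "u x = ennreal r" "0 < r"
    using A1_D(2)[OF assms, of x] by (cases "u x") auto
  then show "factored_weight p \<delta> u (\<lambda>_. 1) x = enn_powr (u x) \<delta>"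
    by (simp add: factored_weight_def enn_powr_ennreal)
qed

text \<open>The surplus power \<open>P\<close> of the function is moved into the weight. Its
  majorant is a single A_1 weight \<open>W\<close>, so the known inequality is applied with the
  factors \<open>W\<close> and 1.\<close>

lemma A1_extrapolation_up:
  fixes G :: "(('a::euclidean_space \<Rightarrow> ennreal) \<times> ('a \<Rightarrow> ennreal)) set"
  assumes G: "\<And>f g. (f, g) \<in> G \<Longrightarrow> f \<in> borel_measurable lebesgue \<and> g \<in> borel_measurable lebesgue"
    and \<delta>: "0 < \<delta>" "\<delta> < 1" and p: "1 < p" and P: "0 < P"
    and ds: "ds * p = p - (p + P) * (1 - \<delta>)" "0 < ds"
    and hyp: "\<And>u v. A1 u \<Longrightarrow> A1 v \<Longrightarrow> \<exists>C::real. \<forall>(f, g)\<in>G.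
      wmod lebesgue (\<lambda>_. p) (factored_weight p \<delta> u v) f < \<infinity> \<longrightarrow>
      wmod lebesgue (\<lambda>_. p) (factored_weight p \<delta> u v) f
        \<le> ennreal C * wmod lebesgue (\<lambda>_. p) (factored_weight p \<delta> u v) g"
    and w: "A1 w"
  shows "\<exists>C::real. \<forall>(f, g)\<in>G. wmod lebesgue (\<lambda>_. p + P) (\<lambda>x. enn_powr (w x) ds) f < \<infinity> \<longrightarrow>
      wmod lebesgue (\<lambda>_. p + P) (\<lambda>x. enn_powr (w x) ds) f
        \<le> ennreal C * wmod lebesgue (\<lambda>_. p + P) (\<lambda>x. enn_powr (w x) ds) g"
proof (rule ccontr)
  note [measurable] = A1_D(1)[OF w]
  let ?J = "wmod lebesgue (\<lambda>_. p + P) (\<lambda>x. enn_powr (w x) ds)"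
  \<comment> \<open>Forced by the demand that \<open>u0\<close> to the power \<open>q\<close> times
    \<open>w\<close> to the power \<open>1 - q\<close> be the integrand of \<open>?J\<close>.
    Positivity of \<open>ds\<close> then gives \<open>1 < q\<close>.\<close>
  define q where "q = \<delta> * (p + P) / P"
  have qP: "q * P = \<delta> * (p + P)" and q1: "(q - 1) * P = ds * p"
  proof -
    show "q * P = \<delta> * (p + P)"
      using P by (simp add: q_def)
    then show "(q - 1) * P = ds * p"
      using ds by (simp add: algebra_simps)
  qed
  have "0 < (q - 1) * P"
    unfolding q1 using ds(2) p by (intro mult_pos_pos) auto
  then have q: "1 < q"
    using P by (simp add: zero_less_mult_iff)
  let ?v = "\<lambda>x. enn_powr (w x) (1 - q)"
  assume violated: "\<not> ?thesis"
  have "\<exists>f g a. \<forall>j::nat. (f j, g j) \<in> G \<and> 0 < a j \<and> ?J (\<lambda>x. ennreal (a j) * f j x) = 1 \<and>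
      ?J (\<lambda>x. ennreal (16 ^ j * a j) * g j x) \<le> 1"
    by (rule normalised_violating_sequence[OF _ G _ violated]) (use p P in auto)
  then obtain f g a where seq_all: "\<forall>j::nat. (f j, g j) \<in> G \<and> 0 < a j \<and> ?J (\<lambda>x. ennreal (a j) * f j x) = 1 \<and>
      ?J (\<lambda>x. ennreal (16 ^ j * a j) * g j x) \<le> 1"
    by (elim exE)
  then have seq: "\<And>j. (f j, g j) \<in> G" "\<And>j. 0 < a j"
      "\<And>j. ?J (\<lambda>x. ennreal (a j) * f j x) = 1" "\<And>j. ?J (\<lambda>x. ennreal (16 ^ j * a j) * g j x) \<le> 1"
    by simp_all
  note [measurable] = G[OF seq(1), THEN conjunct1] G[OF seq(1), THEN conjunct2]
  define \<phi> where "\<phi> j x = ennreal (a j) * f j x" for j x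
  define \<gamma> where "\<gamma> j x = ennreal (16 ^ j * a j) * g j x" for j x
  have [measurable]: "\<phi> j \<in> borel_measurable lebesgue" "\<gamma> j \<in> borel_measurable lebesgue" for j
    unfolding \<phi>_def \<gamma>_def by measurable
  have J: "?J (\<phi> j) = 1" "?J (\<gamma> j) \<le> 1" for j
    unfolding \<phi>_def \<gamma>_def by (rule seq)+
  \<comment> \<open>Chosen so that \<open>u0\<^sup>\<delta> = \<phi>\<^sup>P w\<^sup>d\<^sup>s\<close>, which turns \<open>\<phi>\<^sup>p u0\<^sup>\<delta>\<close> into the integrand of \<open>J\<close>.\<close>
  define u0 where "u0 j x = enn_powr (enn_powr (\<phi> j x) P * enn_powr (w x) ds) (1 / \<delta>)" for j x
  have [measurable]: "u0 j \<in> borel_measurable lebesgue" for j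
    unfolding u0_def by measurable
  have u0_mod: "wmod lebesgue (\<lambda>_. q) ?v (u0 j) = 1" for j
  proof -
    have "wmod lebesgue (\<lambda>_. q) ?v (u0 j) = ?J (\<phi> j)"
      unfolding wmod_def using A1_D(3)[OF w]
    proof (intro nn_integral_cong_AE, eventually_elim)
      fix x assume fin: "w x < \<infinity>"
      have "enn_powr (u0 j x) q = enn_powr (enn_powr (\<phi> j x) P * enn_powr (w x) ds) ((p + P) / P)"
        unfolding u0_def using \<delta> q by (subst enn_powr_powr) (simp_all add: q_def)
      also have "\<dots> = enn_powr (\<phi> j x) (p + P) * enn_powr (w x) (ds * ((p + P) / P))"
        using p P ds by (simp add: enn_powr_mult enn_powr_powr)
      finally have "enn_powr (u0 j x) q * ?v x
          = enn_powr (\<phi> j x) (p + P) * enn_powr (w x) (ds * ((p + P) / P) + (1 - q))"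
        using fin A1_D(2)[OF w, of x] by (simp add: enn_powr_add_pos mult.assoc del: divide_inverse)
      also have "ds * ((p + P) / P) + (1 - q) = ds"
        using q1 P by (simp add: field_simps)
      finally show "enn_powr (u0 j x) q * ?v x = enn_powr (\<phi> j x) (p + P) * enn_powr (w x) ds" .
    qed
    then show ?thesis
      using J by simp
  qed
  obtain K where K: "K < \<infinity>" "\<And>u. u \<in> borel_measurable lebesgue \<Longrightarrow>
      wmod lebesgue (\<lambda>_. q) ?v (wmax (\<lambda>_. 1) u) \<le> K * wmod lebesgue (\<lambda>_. q) ?v u"
    using maximal_A1_dual_bound[OF w q] by blast
  have v_nz: "AE x in lebesgue. ?v x \<noteq> 0"
    using A1_D(3)[OF w] by eventually_elim (rule enn_powr_pos_nonzero[OF A1_D(2)[OF w]])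
  obtain W where W: "A1 W" "wmod lebesgue (\<lambda>_. q) ?v W \<le> 1" "\<And>j x. u0 j x \<le> ennreal (4 ^ (j + 2)) * W x"
  proof (rule A1_majorant_sequence[of ?v u0 q K])
    show "wmod lebesgue (\<lambda>_. q) ?v (wmax (\<lambda>_. 1) u) \<le> K * wmod lebesgue (\<lambda>_. q) ?v u"
      if "u \<in> borel_measurable lebesgue" for u
      by (rule K(2)[OF that])
  qed (use K(1) q in \<open>simp_all add: u0_mod v_nz\<close>)
  note [measurable] = A1_D(1)[OF W(1)]
  let ?I = "wmod lebesgue (\<lambda>_. p) (factored_weight p \<delta> W (\<lambda>_. 1))"
  obtain C where C: "\<And>f g. (f, g) \<in> G \<Longrightarrow> ?I f < \<infinity> \<Longrightarrow> ?I f \<le> ennreal C * ?I g"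
    using hyp[OF W(1) A1_one] by blast
  have I: "?I h = wmod lebesgue (\<lambda>_. p) (\<lambda>x. enn_powr (W x) \<delta>) h" for h
    by (rule wmod_cong_AE[OF factored_weight_one[OF W(1)]])
  \<comment> \<open>Young's inequality bounds \<open>?I\<close> on the whole unit ball of
    \<open>?J\<close>. This covers the \<open>\<gamma> j\<close> too, although only the
    \<open>\<phi> j\<close> enter the majorised sequence.\<close>
  have I_le: "?I h \<le> 2" if [measurable]: "h \<in> borel_measurable lebesgue" and h: "?J h \<le> 1" for h
  proof -
    have "AE x in lebesgue. h x < \<infinity>"
    proof (rule wmod_finite_AE[of "\<lambda>_. p + P" _ "\<lambda>x. enn_powr (w x) ds"])
      show "AE x in lebesgue. enn_powr (w x) ds \<noteq> 0"
        using A1_D(3)[OF w] by eventually_elim (rule enn_powr_pos_nonzero[OF A1_D(2)[OF w]])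
    qed (use h p P in \<open>auto intro: le_less_trans\<close>)
    then have "AE x in lebesgue. enn_powr (h x) p * enn_powr (W x) \<delta>
        \<le> enn_powr (h x) (p + P) * enn_powr (w x) ds + enn_powr (W x) q * ?v x"
      using A1_D(3)[OF w] A1_D(3)[OF W(1)]
    proof eventually_elim
      fix x assume "h x < \<infinity>" "w x < \<infinity>" "W x < \<infinity>"
      then obtain y \<omega> \<Omega> where r: "h x = ennreal y" "0 \<le> y" "w x = ennreal \<omega>" "0 < \<omega>" "W x = ennreal \<Omega>" "0 < \<Omega>"
        using A1_D(2)[OF w, of x] A1_D(2)[OF W(1), of x] by (cases "h x"; cases "w x"; cases "W x") auto
      have "y powr p * \<Omega> powr \<delta> \<le> y powr (p + P) * \<omega> powr ds + \<Omega> powr q * \<omega> powr (1 - q)"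
        using r P p qP q1 by (intro extrapolation_up_Young) auto
      then have "ennreal (y powr p * \<Omega> powr \<delta>) \<le> ennreal (y powr (p + P) * \<omega> powr ds + \<Omega> powr q * \<omega> powr (1 - q))"
        by (rule ennreal_leI)
      then show "enn_powr (h x) p * enn_powr (W x) \<delta>
        \<le> enn_powr (h x) (p + P) * enn_powr (w x) ds + enn_powr (W x) q * ?v x"
        using r p P by (simp add: enn_powr_ennreal ennreal_mult)
    qed
    then have "?I h \<le> ?J h + wmod lebesgue (\<lambda>_. q) ?v W"
      unfolding I unfolding wmod_def
      by (subst nn_integral_add[symmetric]) (auto intro: nn_integral_mono_AE)
    also have "\<dots> \<le> 1 + 1"
      by (intro add_mono h W)
    finally show ?thesis
      by simp
  qed
  \<comment> \<open>The majorant of \<open>u0 j\<close> replaces the surplus power of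
    \<open>\<phi> j\<close>, so \<open>?I\<close> cannot be too small.\<close>
  have lower: "1 \<le> ennreal ((4 ^ (j + 2)) powr \<delta>) * ?I (\<phi> j)" for j
  proof -
    have "1 = ?J (\<phi> j)"
      using J by simp
    also have "\<dots> \<le> (\<integral>\<^sup>+ x. ennreal ((4 ^ (j + 2)) powr \<delta>) * (enn_powr (\<phi> j x) p * enn_powr (W x) \<delta>) \<partial>lebesgue)"
      unfolding wmod_def
    proof (rule nn_integral_mono)
      fix x
      have "enn_powr (\<phi> j x) P * enn_powr (w x) ds = enn_powr (u0 j x) \<delta>"
        unfolding u0_def using \<delta> by (subst enn_powr_powr) auto
      also have "\<dots> \<le> enn_powr (ennreal (4 ^ (j + 2)) * W x) \<delta>"
        using \<delta> W(3) by (intro enn_powr_mono) auto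
      also have "\<dots> = ennreal ((4 ^ (j + 2)) powr \<delta>) * enn_powr (W x) \<delta>"
        using \<delta> by (simp add: enn_powr_mult enn_powr_ennreal)
      finally have "enn_powr (\<phi> j x) p * (enn_powr (\<phi> j x) P * enn_powr (w x) ds)
          \<le> enn_powr (\<phi> j x) p * (ennreal ((4 ^ (j + 2)) powr \<delta>) * enn_powr (W x) \<delta>)"
        by (rule mult_left_mono) simp
      then show "enn_powr (\<phi> j x) (p + P) * enn_powr (w x) ds
          \<le> ennreal ((4 ^ (j + 2)) powr \<delta>) * (enn_powr (\<phi> j x) p * enn_powr (W x) \<delta>)"
        using p P by (simp add: enn_powr_add mult.assoc mult.left_commute)
    qed
    also have "\<dots> = ennreal ((4 ^ (j + 2)) powr \<delta>) * ?I (\<phi> j)"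
      unfolding I unfolding wmod_def by (rule nn_integral_cmult) measurable
    finally show ?thesis .
  qed
  \<comment> \<open>\<open>ennreal\<close> sends negative constants to 0, hence
    \<open>max C 0\<close>; 32 is the bound 2 on \<open>?I\<close> times the 16 of
    \<open>geometric_gap\<close>.\<close>
  have "1 * 4 ^ j \<le> 32 * max C 0" for j
  proof -
    have fin: "?I (\<phi> j) \<le> 2" "?I (\<gamma> j) \<le> 2"
      using I_le J by (auto simp: J)
    then obtain t where t: "?I (\<phi> j) = ennreal t" "0 \<le> t"
      by (cases "?I (\<phi> j)") (auto simp: top_unique)
    have "ennreal ((16 ^ j) powr p) * ?I (\<phi> j) \<le> ennreal C * ?I (\<gamma> j)"
      unfolding \<phi>_def \<gamma>_def
    proof (rule wmod_scaled_transfer)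
      show "?I (\<lambda>x. ennreal (a j) * f j x) < \<infinity>"
        using t by (simp add: \<phi>_def[abs_def])
    qed (use seq p C factored_weight_measurable[OF W(1) A1_one] in auto)
    also have "\<dots> \<le> ennreal (max C 0) * ennreal 2"
      using fin by (intro mult_mono ennreal_leI) auto
    also have "\<dots> = ennreal (max C 0 * 2)"
      by (rule ennreal_mult[symmetric]) auto
    finally have "(16 ^ j) powr p * t \<le> max C 0 * 2"
      using t by (simp flip: ennreal_mult)
    moreover have "1 \<le> (4 ^ (j + 2)) powr \<delta> * t"
      using lower[of j] t by (simp flip: ennreal_mult)
    moreover have "(4 ^ (j + 2)) powr \<delta> \<le> (4::real) ^ (j + 2)"
      using powr_mono[OF less_imp_le[OF \<delta>(2)] one_le_power[of "4::real" "j + 2"]] by simp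
    moreover have "(16::real) ^ j \<le> (16 ^ j) powr p"
      using powr_mono[OF less_imp_le[OF p] one_le_power[of "16::real" j]] by simp
    ultimately have bounds: "16 ^ j * t \<le> max C 0 * 2" "1 \<le> 4 ^ (j + 2) * t"
      using t(2) by (meson mult_right_mono order_trans)+
    from geometric_gap[OF this] show ?thesis
      by simp
  qed
  then show False
    using no_geometric_growth[of 1 "32 * max C 0"] by simp
qed

text \<open>The known inequality has the larger exponent \<open>p = s + e\<close>, and the factored
  weight of \<open>w\<close> and \<open>V\<close> compensates for the surplus \<open>e\<close> by a
  negative power of a majorant. Its integral \<open>?I\<close> is compared with \<open>?J\<close>
  from above by \<open>extrapolation_down_majorant_estimate\<close> and from below by
  \<open>extrapolation_down_splitting\<close>.\<close>

lemma A1_extrapolation_down: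
  fixes G :: "(('a::euclidean_space \<Rightarrow> ennreal) \<times> ('a \<Rightarrow> ennreal)) set"
  assumes G: "\<And>f g. (f, g) \<in> G \<Longrightarrow> f \<in> borel_measurable lebesgue \<and> g \<in> borel_measurable lebesgue"
    and \<delta>: "0 < \<delta>" "\<delta> < 1" and s: "1 < s" and e: "0 < e"
    and lower: "e < s * (\<delta> * (s + e - 1))"
    and ds: "ds * (s + e) = (s + e) - s * (1 - \<delta>)" "0 < ds"
    and hyp: "\<And>u v. A1 u \<Longrightarrow> A1 v \<Longrightarrow> \<exists>C::real. \<forall>(f, g)\<in>G.
      wmod lebesgue (\<lambda>_. s + e) (factored_weight (s + e) \<delta> u v) f < \<infinity> \<longrightarrow>
      wmod lebesgue (\<lambda>_. s + e) (factored_weight (s + e) \<delta> u v) f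
        \<le> ennreal C * wmod lebesgue (\<lambda>_. s + e) (factored_weight (s + e) \<delta> u v) g"
    and w: "A1 w"
  shows "\<exists>C::real. \<forall>(f, g)\<in>G. wmod lebesgue (\<lambda>_. s) (\<lambda>x. enn_powr (w x) ds) f < \<infinity> \<longrightarrow>
      wmod lebesgue (\<lambda>_. s) (\<lambda>x. enn_powr (w x) ds) f
        \<le> ennreal C * wmod lebesgue (\<lambda>_. s) (\<lambda>x. enn_powr (w x) ds) g"
proof (rule ccontr)
  note [measurable] = A1_D(1)[OF w]
  let ?J = "wmod lebesgue (\<lambda>_. s) (\<lambda>x. enn_powr (w x) ds)"
  define p where "p = s + e"
  have p: "1 < p" "0 < p"
    using s e by (auto simp: p_def)
  define \<theta> where "\<theta> = \<delta> * (p - 1)"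
  have \<theta>: "0 < \<theta>" "\<theta> \<le> p - 1"
    using \<delta> p mult_right_mono[of \<delta> 1 "p - 1"] by (auto simp: \<theta>_def)
  \<comment> \<open>\<open>b\<close> and \<open>c\<close> are found by matching the factored weight
    with \<open>H powr (- e) * w powr ds\<close>. The relation \<open>b * s + ds = 1\<close> then
    turns \<open>H powr s * w powr ds\<close> into \<open>V powr m * w\<close>, the integrand of the
    modular of \<open>L^m(w)\<close>.\<close>
  define b where "b = (1 - \<delta>) / p"
  define c where "c = \<theta> / e"
  have c: "0 < c" and ce: "c * e = \<delta> * (p - 1)"
    using \<theta> e by (auto simp: c_def \<theta>_def)
  have bp: "b * p = 1 - \<delta>"
    using p by (simp add: b_def)
  have dsp: "ds * p = p - s * (1 - \<delta>)"
    using ds by (simp add: p_def)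
  have be: "b * e = ds - \<delta>"
  proof -
    have "(b * e) * p = (1 - \<delta>) * e"
      using bp by (simp add: mult_ac)
    also have "\<dots> = (ds - \<delta>) * p"
      using dsp by (simp add: p_def algebra_simps)
    finally show ?thesis
      using p by simp
  qed
  have bs: "b * s + ds = 1"
  proof -
    have "(b * s + ds) * p = (b * p) * s + ds * p"
      by (simp add: algebra_simps)
    also have "\<dots> = 1 * p"
      unfolding bp dsp by (simp add: algebra_simps)
    finally show ?thesis
      using p by simp
  qed
  \<comment> \<open>\<open>1 < m\<close>, required by the maximal theorem on \<open>L^m(w)\<close>,
    is the assumption \<open>lower\<close> divided by \<open>e\<close>.\<close>
  define m where "m = s * c"
  have m: "1 < m"
    using lower e by (simp add: m_def c_def \<theta>_def p_def)
  assume violated: "\<not> ?thesis"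
  have "\<exists>f g a. \<forall>j::nat. (f j, g j) \<in> G \<and> 0 < a j \<and> ?J (\<lambda>x. ennreal (a j) * f j x) = 1 \<and>
      ?J (\<lambda>x. ennreal (16 ^ j * a j) * g j x) \<le> 1"
    by (rule normalised_violating_sequence[OF _ G _ violated]) (use s in auto)
  then obtain f g a where seq_all: "\<forall>j::nat. (f j, g j) \<in> G \<and> 0 < a j \<and> ?J (\<lambda>x. ennreal (a j) * f j x) = 1 \<and>
      ?J (\<lambda>x. ennreal (16 ^ j * a j) * g j x) \<le> 1"
    by (elim exE)
  then have seq: "\<And>j. (f j, g j) \<in> G" "\<And>j. 0 < a j"
      "\<And>j. ?J (\<lambda>x. ennreal (a j) * f j x) = 1" "\<And>j. ?J (\<lambda>x. ennreal (16 ^ j * a j) * g j x) \<le> 1"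
    by simp_all
  note [measurable] = G[OF seq(1), THEN conjunct1] G[OF seq(1), THEN conjunct2]
  define \<phi> where "\<phi> j x = ennreal (a j) * f j x" for j x
  define \<gamma> where "\<gamma> j x = ennreal (16 ^ j * a j) * g j x" for j x
  have [measurable]: "\<phi> j \<in> borel_measurable lebesgue" "\<gamma> j \<in> borel_measurable lebesgue" for j
    unfolding \<phi>_def \<gamma>_def by measurable
  have J: "?J (\<phi> j) = 1" "?J (\<gamma> j) \<le> 1" for j
    unfolding \<phi>_def \<gamma>_def by (rule seq)+
  \<comment> \<open>The two sequences are interleaved because the upper estimate of
    \<open>?I\<close> by \<open>?J\<close> rests on the function being majorised by
    \<open>V\<close>, and it is wanted for the \<open>\<gamma> j\<close> as well. The sequence
    starts with \<open>\<phi> 0\<close>, whose modular is nonzero.\<close>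
  define \<psi> where "\<psi> i = (if even i then \<phi> (i div 2) else \<gamma> (i div 2))" for i :: nat
  have \<psi>_meas [measurable]: "\<psi> i \<in> borel_measurable lebesgue" for i
    unfolding \<psi>_def by (cases "even i") simp_all
  have J_\<psi>: "?J (\<psi> i) \<le> 1" for i
    using J by (simp add: \<psi>_def)
  have w_nz: "AE x in lebesgue. enn_powr (w x) ds \<noteq> 0"
    using A1_D(3)[OF w] by eventually_elim (rule enn_powr_pos_nonzero[OF A1_D(2)[OF w]])
  have \<psi>_finite: "AE x in lebesgue. \<psi> i x < \<infinity>" for i
  proof (rule wmod_finite_AE[of "\<lambda>_. s" _ "\<lambda>x. enn_powr (w x) ds"])
    show "?J (\<psi> i) < \<infinity>"
      using J_\<psi>[of i] by (auto intro: le_less_trans)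
  qed (use s w_nz in auto)
  \<comment> \<open>Solves \<open>\<psi> = v0\<^sup>c w\<^sup>b\<close>. For \<open>H = V\<^sup>c w\<^sup>b\<close> the factored weight of \<open>w\<close> and \<open>V\<close> is \<open>H\<^sup>-\<^sup>e w\<^sup>d\<^sup>s\<close>.\<close>
  define v0 where "v0 i x = enn_powr (\<psi> i x * enn_powr (w x) (- b)) (1 / c)" for i x
  have [measurable]: "v0 i \<in> borel_measurable lebesgue" for i
    unfolding v0_def by measurable
  have v0_mod: "wmod lebesgue (\<lambda>_. m) w (v0 i) = ?J (\<psi> i)" for i
    unfolding wmod_def using A1_D(3)[OF w]
  proof (intro nn_integral_cong_AE, eventually_elim)
    fix x assume fin: "w x < \<infinity>"
    have "enn_powr (v0 i x) m = enn_powr (\<psi> i x * enn_powr (w x) (- b)) s"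
      unfolding v0_def using c s by (subst enn_powr_powr) (simp_all add: m_def)
    also have "\<dots> = enn_powr (\<psi> i x) s * enn_powr (w x) (- b * s)"
      using s A1_D(2)[OF w, of x] fin by (simp add: enn_powr_mult enn_powr_powr_pos)
    finally have "enn_powr (v0 i x) m * w x = enn_powr (\<psi> i x) s * (enn_powr (w x) (- b * s) * enn_powr (w x) 1)"
      by (simp add: mult.assoc)
    also have "enn_powr (w x) (- b * s) * enn_powr (w x) 1 = enn_powr (w x) (- b * s + 1)"
      by (rule enn_powr_add_pos[symmetric, OF A1_D(2)[OF w] fin])
    also have "- b * s + 1 = ds"
      using bs by simp
    finally show "enn_powr (v0 i x) m * w x = enn_powr (\<psi> i x) s * enn_powr (w x) ds" .
  qed
  obtain K where K: "K < \<infinity>" "\<And>u. u \<in> borel_measurable lebesgue \<Longrightarrow>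
      wmod lebesgue (\<lambda>_. m) w (wmax (\<lambda>_. 1) u) \<le> K * wmod lebesgue (\<lambda>_. m) w u"
    using maximal_A1_bound[OF w m] by blast
  obtain V where V: "A1 V" "wmod lebesgue (\<lambda>_. m) w V \<le> 1" "\<And>i x. v0 i x \<le> ennreal (4 ^ (i + 2)) * V x"
  proof (rule A1_majorant_sequence[of w v0 m K])
    show "wmod lebesgue (\<lambda>_. m) w (wmax (\<lambda>_. 1) u) \<le> K * wmod lebesgue (\<lambda>_. m) w u"
      if "u \<in> borel_measurable lebesgue" for u
      by (rule K(2)[OF that])
    show "AE x in lebesgue. w x \<noteq> 0"
      using A1_D(2)[OF w] by (simp add: zero_less_iff_neq_zero)
    show "wmod lebesgue (\<lambda>_. m) w (v0 0) \<noteq> 0"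
      unfolding v0_mod using J(1)[of 0] by (simp add: \<psi>_def)
    show "wmod lebesgue (\<lambda>_. m) w (v0 j) \<le> 1" for j
      unfolding v0_mod by (rule J_\<psi>)
  qed (use K(1) m in simp_all)
  note [measurable] = A1_D(1)[OF V(1)] factored_weight_measurable[OF w V(1)]
  let ?I = "wmod lebesgue (\<lambda>_. p) (factored_weight p \<delta> w V)"
  obtain C where C: "\<And>f g. (f, g) \<in> G \<Longrightarrow> ?I f < \<infinity> \<Longrightarrow> ?I f \<le> ennreal C * ?I g"
    using hyp[OF w V(1)] unfolding p_def by blast
  have finite_reals: "AE x in lebesgue. \<exists>y \<omega> \<Omega>. \<psi> i x = ennreal y \<and> 0 \<le> y \<and> w x = ennreal \<omega> \<and> 0 < \<omega> \<and>
      V x = ennreal \<Omega> \<and> 0 < \<Omega>" for i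
    using \<psi>_finite[of i] A1_D(3)[OF w] A1_D(3)[OF V(1)]
  proof eventually_elim
    fix x assume "\<psi> i x < \<infinity>" "w x < \<infinity>" "V x < \<infinity>"
    then show "\<exists>y \<omega> \<Omega>. \<psi> i x = ennreal y \<and> 0 \<le> y \<and> w x = ennreal \<omega> \<and> 0 < \<omega> \<and> V x = ennreal \<Omega> \<and> 0 < \<Omega>"
      using A1_D(2)[OF w, of x] A1_D(2)[OF V(1), of x] by (cases "\<psi> i x"; cases "w x"; cases "V x") auto
  qed
  have I_le: "?I (\<psi> i) \<le> ennreal ((4 ^ (i + 2)) powr \<theta>)" for i
  proof -
    have "?I (\<psi> i) \<le> (\<integral>\<^sup>+ x. ennreal ((4 ^ (i + 2)) powr \<theta>) * (enn_powr (\<psi> i x) s * enn_powr (w x) ds) \<partial>lebesgue)"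
      unfolding wmod_def using finite_reals[of i]
    proof (intro nn_integral_mono_AE, eventually_elim)
      fix x assume "\<exists>y \<omega> \<Omega>. \<psi> i x = ennreal y \<and> 0 \<le> y \<and> w x = ennreal \<omega> \<and> 0 < \<omega> \<and> V x = ennreal \<Omega> \<and> 0 < \<Omega>"
      then obtain y \<omega> \<Omega> where r: "\<psi> i x = ennreal y" "0 \<le> y" "w x = ennreal \<omega>" "0 < \<omega>" "V x = ennreal \<Omega>" "0 < \<Omega>"
        by blast
      have "v0 i x = ennreal ((y * \<omega> powr (- b)) powr (1 / c))"
        using r c by (simp add: v0_def enn_powr_ennreal flip: ennreal_mult)
      then have "ennreal ((y * \<omega> powr (- b)) powr (1 / c)) \<le> ennreal (4 ^ (i + 2) * \<Omega>)"
        using V(3)[of i x] r by (simp add: ennreal_mult)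
      then have "(y * \<omega> powr (- b)) powr (1 / c) \<le> 4 ^ (i + 2) * \<Omega>"
        using r by (subst (asm) ennreal_le_iff) auto
      then have "y powr (s + e) * (\<omega> * \<Omega> powr (1 - p)) powr \<delta>
          \<le> (4 ^ (i + 2)) powr (\<delta> * (p - 1)) * (y powr s * \<omega> powr ds)"
        using r c e s ce be by (intro extrapolation_down_majorant_estimate[OF _ _ _ _ _ _ _ ce be]) auto
      then have "ennreal (y powr p * (\<omega> * \<Omega> powr (1 - p)) powr \<delta>)
          \<le> ennreal ((4 ^ (i + 2)) powr \<theta> * (y powr s * \<omega> powr ds))"
        unfolding \<theta>_def p_def by (rule ennreal_leI)
      then show "enn_powr (\<psi> i x) p * factored_weight p \<delta> w V x
          \<le> ennreal ((4 ^ (i + 2)) powr \<theta>) * (enn_powr (\<psi> i x) s * enn_powr (w x) ds)"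
        using r p s by (simp add: enn_powr_ennreal ennreal_mult factored_weight_def del: power_Suc)
    qed
    also have "\<dots> = ennreal ((4 ^ (i + 2)) powr \<theta>) * ?J (\<psi> i)"
      unfolding wmod_def by (rule nn_integral_cmult) measurable
    also have "\<dots> \<le> ennreal ((4 ^ (i + 2)) powr \<theta>) * 1"
      by (intro mult_left_mono J_\<psi>) simp
    finally show ?thesis
      by simp
  qed
  \<comment> \<open>With \<open>\<epsilon> powr s = 1 / 2\<close> the remainder in the splitting
    takes up at most half of the total 1, \<open>V\<close> being in the unit ball; the other half
    bounds \<open>?I (\<phi> j)\<close> from below.\<close>
  define \<epsilon> :: real where "\<epsilon> = (1 / 2) powr (1 / s)"
  have \<epsilon>: "0 < \<epsilon>" "\<epsilon> powr s = 1 / 2"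
    using s by (simp_all add: \<epsilon>_def powr_powr)
  have lower_bound: "1 \<le> ennreal (\<epsilon> powr (- e)) * ?I (\<phi> j) + ennreal (\<epsilon> powr s)" for j
  proof -
    have \<phi>: "\<phi> j = \<psi> (2 * j)"
      by (simp add: \<psi>_def)
    have "1 = ?J (\<phi> j)"
      using J by simp
    also have "\<dots> \<le> (\<integral>\<^sup>+ x. ennreal (\<epsilon> powr (- e)) * (enn_powr (\<phi> j x) p * factored_weight p \<delta> w V x)
        + ennreal (\<epsilon> powr s) * (enn_powr (V x) m * w x) \<partial>lebesgue)"
      unfolding wmod_def using finite_reals[of "2 * j", folded \<phi>]
    proof (intro nn_integral_mono_AE, eventually_elim)
      fix x assume "\<exists>y \<omega> \<Omega>. \<phi> j x = ennreal y \<and> 0 \<le> y \<and> w x = ennreal \<omega> \<and> 0 < \<omega> \<and> V x = ennreal \<Omega> \<and> 0 < \<Omega>"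
      then obtain y \<omega> \<Omega> where r: "\<phi> j x = ennreal y" "0 \<le> y" "w x = ennreal \<omega>" "0 < \<omega>" "V x = ennreal \<Omega>" "0 < \<Omega>"
        by blast
      have "y powr s * \<omega> powr ds
          \<le> \<epsilon> powr (- e) * (y powr (s + e) * (\<omega> * \<Omega> powr (1 - p)) powr \<delta>) + \<epsilon> powr s * (\<Omega> powr (s * c) * \<omega>)"
        using r \<epsilon> e s by (intro extrapolation_down_splitting[OF _ _ _ _ _ _ ce be bs]) auto
      then have "ennreal (y powr s * \<omega> powr ds)
          \<le> ennreal (\<epsilon> powr (- e) * (y powr p * (\<omega> * \<Omega> powr (1 - p)) powr \<delta>) + \<epsilon> powr s * (\<Omega> powr m * \<omega>))"
        unfolding m_def p_def by (rule ennreal_leI)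
      also have "\<dots> = ennreal (\<epsilon> powr (- e)) * (enn_powr (\<phi> j x) p * factored_weight p \<delta> w V x)
          + ennreal (\<epsilon> powr s) * (enn_powr (V x) m * w x)"
        using r p m by (simp only: factored_weight_def) (simp add: enn_powr_ennreal ennreal_plus ennreal_mult)
      also have "ennreal (y powr s * \<omega> powr ds) = enn_powr (\<phi> j x) s * enn_powr (w x) ds"
        using r s by (simp add: enn_powr_ennreal ennreal_mult)
      finally show "enn_powr (\<phi> j x) s * enn_powr (w x) ds \<le> ennreal (\<epsilon> powr (- e)) *
          (enn_powr (\<phi> j x) p * factored_weight p \<delta> w V x) + ennreal (\<epsilon> powr s) * (enn_powr (V x) m * w x)" .
    qed
    also have "\<dots> = ennreal (\<epsilon> powr (- e)) * ?I (\<phi> j) + ennreal (\<epsilon> powr s) * wmod lebesgue (\<lambda>_. m) w V"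
      unfolding wmod_def by (subst nn_integral_add, measurable) (subst (1 2) nn_integral_cmult, auto)
    also have "\<dots> \<le> ennreal (\<epsilon> powr (- e)) * ?I (\<phi> j) + ennreal (\<epsilon> powr s) * 1"
      by (intro add_left_mono mult_left_mono V(2)) simp
    finally show ?thesis
      by simp
  qed
  \<comment> \<open>\<open>\<gamma> j\<close> has index \<open>2 * j + 1\<close>, so its loss is
    \<open>4 ^ (2 * j + 3) = 64 * 16 ^ j\<close> to the power \<open>\<theta>\<close>.\<close>
  define D where "D = max C 0 * 64 powr \<theta>"
  have "(\<epsilon> powr e / 2) * 4 ^ j \<le> D" for j
  proof -
    have \<phi>\<gamma>: "\<phi> j = \<psi> (2 * j)" "\<gamma> j = \<psi> (2 * j + 1)"
      by (simp_all add: \<psi>_def)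
    have fin: "?I (\<phi> j) < \<infinity>"
      unfolding \<phi>\<gamma> by (rule le_less_trans[OF I_le]) simp
    then obtain t where t: "?I (\<phi> j) = ennreal t" "0 \<le> t"
      by (cases "?I (\<phi> j)") auto
    have "ennreal ((16 ^ j) powr p) * ?I (\<phi> j) \<le> ennreal C * ?I (\<gamma> j)"
      unfolding \<phi>_def \<gamma>_def
    proof (rule wmod_scaled_transfer)
      show "?I (\<lambda>x. ennreal (a j) * f j x) < \<infinity>"
        using fin by (simp add: \<phi>_def[abs_def])
    qed (use seq p C in auto)
    also have "\<dots> \<le> ennreal (max C 0) * ennreal ((4 ^ (2 * j + 1 + 2)) powr \<theta>)"
      unfolding \<phi>\<gamma>(2) by (intro mult_mono ennreal_leI I_le) auto
    also have "\<dots> = ennreal (max C 0 * (4 ^ (2 * j + 1 + 2)) powr \<theta>)"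
      by (rule ennreal_mult[symmetric]) auto
    also have "ennreal ((16 ^ j) powr p) * ?I (\<phi> j) = ennreal ((16 ^ j) powr p * t)"
      using t by (simp add: ennreal_mult)
    finally have "(16 ^ j) powr p * t \<le> max C 0 * (4 ^ (2 * j + 1 + 2)) powr \<theta>"
      by (subst (asm) ennreal_le_iff) auto
    also have "(4::real) ^ (2 * j + 1 + 2) = 64 * 16 ^ j"
      by (simp add: power_add power_mult)
    also have "max C 0 * (64 * 16 ^ j) powr \<theta> = D * (16 ^ j) powr \<theta>"
      by (simp add: D_def powr_mult)
    \<comment> \<open>By \<open>\<theta> \<le> p - 1\<close> the loss stays below
      \<open>(16 ^ j) powr (p - 1)\<close>, while the gain is \<open>(16 ^ j) powr p\<close>: one
      factor \<open>16 ^ j\<close> survives.\<close>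
    also have "\<dots> \<le> D * (16 ^ j) powr (p - 1)"
      using \<theta> one_le_power[of "16::real" j] by (intro mult_left_mono powr_mono) (auto simp: D_def)
    finally have "(16 ^ j) powr (p - 1) * (16 ^ j * t) \<le> (16 ^ j) powr (p - 1) * D"
      using powr_add[of "16 ^ j :: real" "p - 1" 1] by (simp add: mult_ac)
    then have t_le: "16 ^ j * t \<le> D"
      by (rule mult_left_le_imp_le) simp
    have "ennreal 1 \<le> ennreal (\<epsilon> powr (- e) * t + \<epsilon> powr s)"
      using lower_bound[of j] t by (simp only: ennreal_1) (simp add: ennreal_mult)
    then have "1 / 2 \<le> \<epsilon> powr (- e) * t"
      using t \<epsilon>(2) by (subst (asm) ennreal_le_iff) auto
    then have "\<epsilon> powr e * (1 / 2) \<le> \<epsilon> powr e * (\<epsilon> powr (- e) * t)"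
      by (rule mult_left_mono) simp
    also have "\<dots> = t"
      using \<epsilon> by (simp add: mult.assoc[symmetric] flip: powr_add)
    finally have "16 ^ j * (\<epsilon> powr e * (1 / 2)) \<le> 16 ^ j * t"
      by (rule mult_left_mono) simp
    also note t_le
    finally have "16 ^ j * (\<epsilon> powr e / 2) \<le> D"
      by (simp only: times_divide_eq_right mult_1_right)
    moreover have "4 ^ j * (\<epsilon> powr e / 2) \<le> 16 ^ j * (\<epsilon> powr e / 2)"
      by (intro mult_right_mono power_mono) auto
    ultimately show ?thesis
      by (simp add: mult.commute)
  qed
  then show False
    using no_geometric_growth[of "\<epsilon> powr e / 2" D] \<epsilon> by simp
qed

text \<open>The upper bound on \<open>s\<close> makes \<open>ds\<close> positive, as both directions
  require; the lower bound gives \<open>1 < s\<close> and the condition \<open>lower\<close> when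
  \<open>s < p\<close>. For \<open>s = p\<close> the power \<open>ds\<close> is
  \<open>\<delta>\<close> and the hypothesis applies with second factor 1.\<close>

lemma A1_extrapolation:
  fixes G :: "(('a::euclidean_space \<Rightarrow> ennreal) \<times> ('a \<Rightarrow> ennreal)) set"
  assumes G: "\<And>f g. (f, g) \<in> G \<Longrightarrow> f \<in> borel_measurable lebesgue \<and> g \<in> borel_measurable lebesgue"
    and \<delta>: "0 < \<delta>" "\<delta> < 1" and p: "1 < p" and s: "p < s * (1 + \<delta> * (p - 1))" "s * (1 - \<delta>) < p"
    and ds: "ds = (p - s * (1 - \<delta>)) / p"
    and hyp: "\<And>u v. A1 u \<Longrightarrow> A1 v \<Longrightarrow> \<exists>C::real. \<forall>(f, g)\<in>G.
      wmod lebesgue (\<lambda>_. p) (factored_weight p \<delta> u v) f < \<infinity> \<longrightarrow>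
      wmod lebesgue (\<lambda>_. p) (factored_weight p \<delta> u v) f
        \<le> ennreal C * wmod lebesgue (\<lambda>_. p) (factored_weight p \<delta> u v) g"
    and w: "A1 w"
  shows "\<exists>C::real. \<forall>(f, g)\<in>G. wmod lebesgue (\<lambda>_. s) (\<lambda>x. enn_powr (w x) ds) f < \<infinity> \<longrightarrow>
      wmod lebesgue (\<lambda>_. s) (\<lambda>x. enn_powr (w x) ds) f
        \<le> ennreal C * wmod lebesgue (\<lambda>_. s) (\<lambda>x. enn_powr (w x) ds) g"
proof -
  have ds_p: "ds * p = p - s * (1 - \<delta>)" "0 < ds"
    using p s by (simp_all add: ds)
  consider "s = p" | "p < s" | "s < p"
    by linarith
  then show ?thesis
  proof cases
    case 1
    have "ds = \<delta>"
      using p by (simp add: ds 1 algebra_simps)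
    then have "wmod lebesgue (\<lambda>_. s) (\<lambda>x. enn_powr (w x) ds) h
        = wmod lebesgue (\<lambda>_. p) (factored_weight p \<delta> w (\<lambda>_. 1)) h" for h
      using 1 wmod_cong_AE[OF factored_weight_one[OF w]] by metis
    then show ?thesis
      using hyp[OF w A1_one] by simp
  next
    case 2
    then have "s = p + (s - p)" "0 < s - p"
      by auto
    then show ?thesis
      using A1_extrapolation_up[OF G \<delta> p \<open>0 < s - p\<close> _ ds_p(2) hyp w] ds_p(1) by simp
  next
    case 3
    have "1 < s"
    proof (rule ccontr)
      assume "\<not> 1 < s"
      then have "s * (1 + \<delta> * (p - 1)) \<le> 1 * (1 + \<delta> * (p - 1))"
        using \<delta> p by (intro mult_right_mono) auto
      also have "1 * (1 + \<delta> * (p - 1)) \<le> 1 * (1 + 1 * (p - 1))"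
        using \<delta> p by (intro mult_left_mono add_left_mono mult_right_mono) auto
      finally show False
        using s(1) by simp
    qed
    have eq: "s + (p - s) = p"
      by simp
    have "p - s < s * (\<delta> * (p - 1))"
      using s(1) by (simp add: algebra_simps)
    then show ?thesis
      using A1_extrapolation_down[of G \<delta> s "p - s" ds w, unfolded eq, OF G \<delta> \<open>1 < s\<close> _ _ ds_p hyp w] 3 by simp
  qed
qed

subsection \<open>Variable exponents\<close>

text \<open>Centred, to match \<open>maximal\<close>, in contrast to \<open>wmax\<close>.\<close>

definition cmax :: "('a::euclidean_space \<Rightarrow> ennreal) \<Rightarrow> 'a \<Rightarrow> ennreal" where
  "cmax u x = (SUP \<rho>\<in>{0<..}. (\<integral>\<^sup>+ y\<in>ball x \<rho>. u y \<partial>lebesgue) / emeasure lebesgue (ball x \<rho>))"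

lemma maximal_enn2ereal: "maximal (\<lambda>x. enn2ereal (u x)) x = enn2ereal (cmax u x)"
  by (simp add: maximal_def cmax_def)

lemma cmax_upper:
  "0 < \<rho> \<Longrightarrow> (\<integral>\<^sup>+ y\<in>ball x \<rho>. u y \<partial>lebesgue) / emeasure lebesgue (ball x \<rho>) \<le> cmax u x"
  unfolding cmax_def by (rule SUP_upper) simp

lemma cmax_sublinear:
  assumes [measurable]: "\<And>j. u j \<in> borel_measurable lebesgue"
  shows "cmax (\<lambda>x. \<Sum>j. a j * u j x) x \<le> (\<Sum>j. a j * cmax (u j) x)"
  unfolding cmax_def[of "\<lambda>x. \<Sum>j. a j * u j x"]
proof (rule SUP_least)
  fix \<rho> :: real assume "\<rho> \<in> {0<..}"
  then have \<rho>: "0 < \<rho>"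
    by simp
  have "(\<integral>\<^sup>+ y\<in>ball x \<rho>. (\<Sum>j. a j * u j y) \<partial>lebesgue)
      = (\<integral>\<^sup>+ y. (\<Sum>j. a j * (u j y * indicator (ball x \<rho>) y)) \<partial>lebesgue)"
    by (intro nn_integral_cong) (simp add: mult.assoc flip: ennreal_suminf_multc)
  also have "\<dots> = (\<Sum>j. a j * (\<integral>\<^sup>+ y\<in>ball x \<rho>. u j y \<partial>lebesgue))"
    by (subst nn_integral_suminf, measurable) (subst nn_integral_cmult, auto)
  finally have "(\<integral>\<^sup>+ y\<in>ball x \<rho>. (\<Sum>j. a j * u j y) \<partial>lebesgue) / emeasure lebesgue (ball x \<rho>)
      = (\<Sum>j. a j * ((\<integral>\<^sup>+ y\<in>ball x \<rho>. u j y \<partial>lebesgue) / emeasure lebesgue (ball x \<rho>)))"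
    by (simp add: ennreal_times_divide del: emeasure_completion)
  also have "\<dots> \<le> (\<Sum>j. a j * cmax (u j) x)"
    by (intro suminf_le mult_left_mono cmax_upper \<rho>) auto
  finally show "(\<integral>\<^sup>+ y\<in>ball x \<rho>. (\<Sum>j. a j * u j y) \<partial>lebesgue) / emeasure lebesgue (ball x \<rho>)
      \<le> (\<Sum>j. a j * cmax (u j) x)" .
qed

text \<open>A ball of radius \<open>\<rho>\<close> containing \<open>x\<close> lies in the ball of
  radius \<open>2 * \<rho>\<close> about \<open>x\<close>, so the centred bound yields the uncentred
  condition at the price of 2 to the dimension.\<close>

lemma A1_of_cmax_bound:
  fixes W :: "'a::euclidean_space \<Rightarrow> ennreal"
  assumes W: "W \<in> borel_measurable lebesgue" and B: "B < \<infinity>" "\<And>x. cmax W x \<le> B * W x"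
    and fin: "AE x in lebesgue. W x < \<infinity>" and nz: "\<not> (AE x in lebesgue. W x = 0)"
  shows "A1 W"
proof (rule A1_I[OF W _ _ fin nz, where C = "B * ennreal 2 ^ DIM('a)"])
  show "B * ennreal 2 ^ DIM('a) < \<infinity>"
    using B(1) by (auto simp: ennreal_mult_less_top power_less_top_ennreal)
  fix c \<rho> x assume x: "x \<in> ball (c::'a) \<rho>"
  then have \<rho>: "0 < \<rho>"
    by (rule mem_ball_radius_pos)
  let ?m = "emeasure lebesgue (ball x (2 * \<rho>))"
  have m: "0 < ?m" "?m < \<infinity>"
    using \<rho> emeasure_lebesgue_ball_pos[of "2 * \<rho>" x] emeasure_lebesgue_ball_finite[of x "2 * \<rho>"] by simp_all
  have sub: "ball c \<rho> \<subseteq> ball x (2 * \<rho>)"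
  proof
    fix y assume "y \<in> ball c \<rho>"
    then show "y \<in> ball x (2 * \<rho>)"
      using x dist_triangle[of x y c] by (simp add: dist_commute)
  qed
  have "(\<integral>\<^sup>+ y\<in>ball c \<rho>. W y \<partial>lebesgue) \<le> (\<integral>\<^sup>+ y\<in>ball x (2 * \<rho>). W y \<partial>lebesgue)"
    using sub by (intro nn_integral_mono mult_left_mono) (auto split: split_indicator)
  also have "\<dots> = (\<integral>\<^sup>+ y\<in>ball x (2 * \<rho>). W y \<partial>lebesgue) / ?m * ?m"
    using m by (simp add: ennreal_divide_times del: emeasure_completion)
  also have "\<dots> \<le> B * W x * (ennreal 2 ^ DIM('a) * emeasure lebesgue (ball c \<rho>))"
    using \<rho> by (intro mult_mono order_trans[OF cmax_upper B(2)] emeasure_lebesgue_ball_scale) auto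
  finally show "(\<integral>\<^sup>+ y\<in>ball c \<rho>. W y \<partial>lebesgue) \<le> B * ennreal 2 ^ DIM('a) * emeasure lebesgue (ball c \<rho>) * W x"
    by (simp only: mult_ac)
qed

section \<open>Modulars and the norm of the variable space\<close>

lemma modular_conv_wmod:
  assumes "\<And>x. 0 \<le> h x" "0 < t"
  shows "modular r h t = wmod lebesgue r (\<lambda>_. 1) (\<lambda>x. ennreal (1 / t) * e2ennreal (h x))"
proof -
  have "e2ennreal \<bar>h x\<bar> / ennreal t = ennreal (1 / t) * e2ennreal (h x)" for x
    using assms by (simp add: divide_ennreal_def inverse_ennreal inverse_eq_divide mult.commute)
  then show ?thesis
    by (simp add: modular_def wmod_def)
qed

lemma modular_antimono:
  assumes "\<And>x. 0 \<le> h x" "0 < t" "t \<le> t'" "AE x in lebesgue. 0 < r x"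
  shows "modular r h t' \<le> modular r h t"
proof -
  have "modular r h t' = wmod lebesgue r (\<lambda>_. 1) (\<lambda>x. ennreal (1 / t') * e2ennreal (h x))"
    using assms by (intro modular_conv_wmod) auto
  also have "\<dots> \<le> wmod lebesgue r (\<lambda>_. 1) (\<lambda>x. ennreal (1 / t) * e2ennreal (h x))"
    using assms(2,3) by (intro wmod_mono[OF AE_I2 assms(4)] mult_right_mono ennreal_leI divide_left_mono) auto
  also have "\<dots> = modular r h t"
    using assms by (intro modular_conv_wmod[symmetric]) auto
  finally show ?thesis .
qed

lemma modular_le_one_of_var_norm_less:
  assumes "\<And>x. 0 \<le> h x" "var_norm r h < ennreal t" "AE x in lebesgue. 0 < r x"
  shows "modular r h t \<le> 1"
proof -
  have "h \<in> var_Lebesgue r"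
    using assms(2) by (auto simp: var_norm_def split: if_splits)
  then have "(INF t\<in>{t. 0 < t \<and> modular r h t \<le> 1}. ennreal t) < ennreal t"
    using assms(2) by (simp add: var_norm_def)
  then obtain t' where t': "0 < t'" "modular r h t' \<le> 1" "ennreal t' < ennreal t"
    by (auto simp: INF_less_iff)
  then have "modular r h t \<le> modular r h t'"
    using assms by (intro modular_antimono) (auto simp: ennreal_less_iff)
  then show ?thesis
    using t' by simp
qed

lemma var_norm_le:
  assumes "h \<in> borel_measurable lebesgue" "0 < t" "modular r h t \<le> 1"
  shows "h \<in> var_Lebesgue r" "var_norm r h \<le> ennreal t"
proof -
  show *: "h \<in> var_Lebesgue r"
    using assms by (auto simp: var_Lebesgue_def intro!: exI[of _ t] intro: le_less_trans)
  show "var_norm r h \<le> ennreal t"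
    using * assms by (auto simp: var_norm_def intro!: INF_lower2[of t])
qed

lemma wmod_scale_le:
  assumes [measurable]: "r \<in> borel_measurable M" "u \<in> borel_measurable M" "v \<in> borel_measurable M"
    and r: "AE x in M. 1 \<le> r x" and c: "c \<le> 1"
  shows "wmod M r v (\<lambda>x. c * u x) \<le> c * wmod M r v u"
proof -
  have "wmod M r v (\<lambda>x. c * u x) \<le> (\<integral>\<^sup>+ x. c * (enn_powr (u x) (r x) * v x) \<partial>M)"
    unfolding wmod_def using r
  proof (intro nn_integral_mono_AE, eventually_elim)
    fix x assume "1 \<le> r x"
    then have "enn_powr (c * u x) (r x) * v x \<le> c * enn_powr (u x) (r x) * v x"
      using enn_powr_le_self[OF c, of "r x"] by (auto simp: enn_powr_mult intro!: mult_right_mono)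
    then show "enn_powr (c * u x) (r x) * v x \<le> c * (enn_powr (u x) (r x) * v x)"
      by (simp add: mult.assoc)
  qed
  also have "\<dots> = c * wmod M r v u"
    unfolding wmod_def by (rule nn_integral_cmult) measurable
  finally show ?thesis .
qed

text \<open>The finite upper bound of the exponent enters here: it keeps the modular of a function
  normalised by its norm away from 0.\<close>

lemma wmod_scale_ge:
  assumes [measurable]: "r \<in> borel_measurable M" "u \<in> borel_measurable M" "v \<in> borel_measurable M"
    and r: "AE x in M. 0 < r x \<and> r x \<le> b" and c: "0 < c" "c \<le> 1"
  shows "ennreal (c powr b) * wmod M r v u \<le> wmod M r v (\<lambda>x. ennreal c * u x)"
proof -
  have "ennreal (c powr b) * wmod M r v u = (\<integral>\<^sup>+ x. ennreal (c powr b) * (enn_powr (u x) (r x) * v x) \<partial>M)"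
    unfolding wmod_def by (rule nn_integral_cmult[symmetric]) measurable
  also have "\<dots> \<le> wmod M r v (\<lambda>x. ennreal c * u x)"
    unfolding wmod_def using r
  proof (intro nn_integral_mono_AE, eventually_elim)
    fix x assume "0 < r x \<and> r x \<le> b"
    then have "ennreal (c powr b) \<le> enn_powr (ennreal c) (r x)"
      using c powr_mono'[of "r x" b c] by (simp add: enn_powr_ennreal ennreal_leI)
    then have "ennreal (c powr b) * (enn_powr (u x) (r x) * v x)
        \<le> enn_powr (ennreal c) (r x) * (enn_powr (u x) (r x) * v x)"
      by (rule mult_right_mono) simp
    then show "ennreal (c powr b) * (enn_powr (u x) (r x) * v x) \<le> enn_powr (ennreal c * u x) (r x) * v x"
      using \<open>0 < r x \<and> r x \<le> b\<close> by (simp add: enn_powr_mult mult.assoc)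
  qed
  finally show ?thesis .
qed

text \<open>As the exponent is at least 1, enlarging \<open>t\<close> by the factor
  \<open>M + 1\<close> divides the modular \<open>M\<close> by at least that factor and brings it
  below 1.\<close>

lemma var_norm_finite:
  assumes [measurable]: "r \<in> borel_measurable lebesgue"
    and h: "h \<in> var_Lebesgue r" "\<And>x. 0 \<le> h x" and r: "AE x in lebesgue. 1 \<le> r x"
  shows "var_norm r h < \<infinity>"
proof -
  obtain t where t: "0 < t" "modular r h t < \<infinity>" and [measurable]: "h \<in> borel_measurable lebesgue"
    using h by (auto simp: var_Lebesgue_def)
  obtain M where M: "modular r h t = ennreal M" "0 \<le> M"
    using t by (cases "modular r h t") auto
  have M1: "0 < M + 1"
    using M by simp
  have "modular r h (t * (M + 1)) = wmod lebesgue r (\<lambda>_. 1) (\<lambda>x. ennreal (1 / (M + 1)) * (ennreal (1 / t) * e2ennreal (h x)))"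
  proof -
    have "ennreal (1 / (t * (M + 1))) = ennreal (1 / (M + 1)) * ennreal (1 / t)"
      using t M by (simp flip: ennreal_mult)
    then show ?thesis
      using t M1 h by (subst modular_conv_wmod) (auto simp: mult.assoc)
  qed
  also have "\<dots> \<le> ennreal (1 / (M + 1)) * wmod lebesgue r (\<lambda>_. 1) (\<lambda>x. ennreal (1 / t) * e2ennreal (h x))"
    using M r by (intro wmod_scale_le) (auto simp: ennreal_le_1)
  also have "wmod lebesgue r (\<lambda>_. 1) (\<lambda>x. ennreal (1 / t) * e2ennreal (h x)) = ennreal M"
    using M t h by (subst modular_conv_wmod[symmetric]) auto
  also have "ennreal (1 / (M + 1)) * ennreal M \<le> 1"
    using M by (simp add: ennreal_le_1 flip: ennreal_mult)
  finally have "var_norm r h \<le> ennreal (t * (M + 1))"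
    using t M1 by (intro var_norm_le) auto
  then show ?thesis
    by (rule le_less_trans) simp
qed

lemma maximal_exponents_bound:
  fixes r :: "real ^ 'n \<Rightarrow> real"
  assumes "r \<in> maximal_exponents"
  obtains B where "0 < B" "\<And>u. u \<in> borel_measurable lebesgue \<Longrightarrow> wmod lebesgue r (\<lambda>_. 1) u \<le> 1 \<Longrightarrow>
    cmax u \<in> borel_measurable lebesgue \<and> wmod lebesgue r (\<lambda>_. 1) (\<lambda>x. cmax u x / ennreal B) \<le> 1"
proof -
  have r: "AE x in lebesgue. 1 \<le> r x"
    using assms by (simp add: maximal_exponents_def)
  have r_pos: "AE x in lebesgue. 0 < r x"
    using r by eventually_elim simp
  obtain C :: real where C: "\<forall>f\<in>var_Lebesgue r.
      maximal f \<in> var_Lebesgue r \<and> var_norm r (maximal f) \<le> ennreal C * var_norm r f"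
    using assms by (auto simp: maximal_exponents_def)
  \<comment> \<open>Strictly above the norm of \<open>maximal ?f\<close>: for parameters beyond the
    infimum the modular is at most 1 by monotonicity.\<close>
  define B where "B = max C 0 + 1"
  show thesis
  proof
    show B: "0 < B"
      by (simp add: B_def)
    fix u :: "real ^ 'n \<Rightarrow> ennreal"
    assume [measurable]: "u \<in> borel_measurable lebesgue" and u: "wmod lebesgue r (\<lambda>_. 1) u \<le> 1"
    let ?f = "\<lambda>x. enn2ereal (u x)"
    have "modular r ?f 1 \<le> 1"
      using u by (simp add: modular_conv_wmod)
    then have f: "?f \<in> var_Lebesgue r" "var_norm r ?f \<le> ennreal 1"
      by (intro var_norm_le; simp)+
    have max_eq: "maximal ?f = (\<lambda>x. enn2ereal (cmax u x))"
      by (rule ext) (rule maximal_enn2ereal)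
    have Mf: "maximal ?f \<in> var_Lebesgue r" "var_norm r (maximal ?f) \<le> ennreal C * var_norm r ?f"
      using C f(1) by auto
    have "(\<lambda>x. enn2ereal (cmax u x)) \<in> borel_measurable lebesgue"
      using Mf(1) unfolding max_eq by (auto simp: var_Lebesgue_def)
    from measurable_compose[OF this measurable_e2ennreal]
    have "cmax u \<in> borel_measurable lebesgue"
      by simp
    moreover have "var_norm r (maximal ?f) < ennreal B"
    proof -
      have "var_norm r (maximal ?f) \<le> ennreal (max C 0) * ennreal 1"
        by (intro order_trans[OF Mf(2)] mult_mono ennreal_leI f) auto
      also have "\<dots> < ennreal B"
        by (simp add: B_def ennreal_less_iff)
      finally show ?thesis .
    qed
    then have "modular r (maximal ?f) B \<le> 1"
      unfolding max_eq by (intro modular_le_one_of_var_norm_less r_pos) auto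
    then have "wmod lebesgue r (\<lambda>_. 1) (\<lambda>x. cmax u x / ennreal B) \<le> 1"
      using B unfolding max_eq
      by (simp add: modular_conv_wmod divide_ennreal_def inverse_ennreal inverse_eq_divide mult.commute)
    ultimately show "cmax u \<in> borel_measurable lebesgue \<and>
        wmod lebesgue r (\<lambda>_. 1) (\<lambda>x. cmax u x / ennreal B) \<le> 1"
      by simp
  qed
qed

text \<open>The algorithm is run with the centred operator. Measurability of \<open>cmax u\<close>
  for \<open>u\<close> in the modular unit ball is supplied by membership of its image in
  \<open>var_Lebesgue\<close>.\<close>

lemma maximal_exponents_A1_majorant:
  fixes r :: "real ^ 'n \<Rightarrow> real" and u :: "nat \<Rightarrow> real ^ 'n \<Rightarrow> ennreal"
  assumes r: "r \<in> maximal_exponents" and [measurable]: "\<And>j. u j \<in> borel_measurable lebesgue"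
    and u: "\<And>j. wmod lebesgue r (\<lambda>_. 1) (u j) \<le> 1" "wmod lebesgue r (\<lambda>_. 1) (u 0) \<noteq> 0"
  obtains W where "A1 W" "wmod lebesgue r (\<lambda>_. 1) W \<le> 1" "\<And>j x. u j x \<le> ennreal (4 ^ (j + 2)) * W x"
proof -
  have r_meas [measurable]: "r \<in> borel_measurable lebesgue" and r1: "AE x in lebesgue. 1 \<le> r x"
    using r by (auto simp: maximal_exponents_def)
  have r_pos: "AE x in lebesgue. 0 < r x"
    using r1 by eventually_elim simp
  obtain B where B: "0 < B" "\<And>u. u \<in> borel_measurable lebesgue \<Longrightarrow> wmod lebesgue r (\<lambda>_. 1) u \<le> 1 \<Longrightarrow>
    cmax u \<in> borel_measurable lebesgue \<and> wmod lebesgue r (\<lambda>_. 1) (\<lambda>x. cmax u x / ennreal B) \<le> 1"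
    using maximal_exponents_bound[OF r] by blast
  obtain W where W: "W \<in> borel_measurable lebesgue" "wmod lebesgue r (\<lambda>_. 1) W \<le> 1"
      "\<And>j x. u j x \<le> ennreal (4 ^ (j + 2)) * W x" "\<And>x. cmax W x \<le> 4 * ennreal B * W x"
      "\<not> (AE x in lebesgue. W x = 0)"
  proof (rule rubio_de_francia_sequence[where N = cmax and B = "ennreal B" and r = r and v = "\<lambda>_. 1" and u = u and M = lebesgue])
    show "cmax (\<lambda>x. \<Sum>j. (1/4) ^ Suc j * u j x) x \<le> (\<Sum>j. (1/4) ^ Suc j * cmax (u j) x)"
      if "\<And>j. u j \<in> borel_measurable lebesgue" for u :: "nat \<Rightarrow> real ^ 'n \<Rightarrow> ennreal" and x
      using that by (rule cmax_sublinear)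
    show "cmax u \<in> borel_measurable lebesgue" "wmod lebesgue r (\<lambda>_. 1) (\<lambda>x. cmax u x / ennreal B) \<le> 1"
      if "u \<in> borel_measurable lebesgue" "wmod lebesgue r (\<lambda>_. 1) u \<le> 1" for u
      using B(2)[OF that] by auto
  qed (use B(1) u r1 in auto)
  have "A1 W"
  proof (rule A1_of_cmax_bound[OF W(1) _ W(4) _ W(5)])
    show "4 * ennreal B < \<infinity>"
      by (simp add: ennreal_mult_less_top)
    show "AE x in lebesgue. W x < \<infinity>"
      by (rule wmod_finite_AE[of r _ "\<lambda>_. 1"]) (use W r_pos in \<open>auto intro: le_less_trans\<close>)
  qed
  then show thesis
    using that W(2,3) by blast
qed

text \<open>With a varying exponent the norm is not a power of the modular, so the modulars are only
  confined between two positive constants. Division by twice the norm of \<open>f\<close> brings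
  them below 1; at half the norm the modular is at least 1, and the scaling by 1/4 between the two
  costs at most \<open>(1/4) powr b\<close>.\<close>

lemma var_norm_violating_sequence:
  fixes F :: "((real ^ 'n \<Rightarrow> ereal) \<times> (real ^ 'n \<Rightarrow> ereal)) set"
  assumes F: "\<And>f g. (f, g) \<in> F \<Longrightarrow>
      f \<in> borel_measurable lebesgue \<and> g \<in> borel_measurable lebesgue \<and> (\<forall>x. 0 \<le> f x) \<and> (\<forall>x. 0 \<le> g x)"
    and [measurable]: "p \<in> borel_measurable lebesgue"
    and p: "AE x in lebesgue. 1 \<le> p x \<and> p x \<le> b"
    and violated: "\<not> (\<exists>C::real. \<forall>(f, g) \<in> F. f \<in> var_Lebesgue p \<longrightarrow> var_norm p f \<le> ennreal C * var_norm p g)"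
  shows "\<exists>f g a. \<forall>j::nat. (f j, g j) \<in> F \<and> 0 < a j \<and>
    wmod lebesgue p (\<lambda>_. 1) (\<lambda>x. ennreal (a j) * e2ennreal (f j x)) \<le> 1 \<and>
    ennreal ((1/4) powr b) \<le> wmod lebesgue p (\<lambda>_. 1) (\<lambda>x. ennreal (a j) * e2ennreal (f j x)) \<and>
    wmod lebesgue p (\<lambda>_. 1) (\<lambda>x. ennreal (16 ^ j * a j) * e2ennreal (g j x)) \<le> 1"
proof -
  let ?M = "wmod lebesgue p (\<lambda>_. 1)"
  have p1: "AE x in lebesgue. 1 \<le> p x" and p_pos: "AE x in lebesgue. 0 < p x"
    and p_b: "AE x in lebesgue. 0 < p x \<and> p x \<le> b"
    using p by (auto elim!: eventually_mono)
  have "\<exists>f g a. (f, g) \<in> F \<and> 0 < a \<and> ?M (\<lambda>x. ennreal a * e2ennreal (f x)) \<le> 1 \<and>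
    ennreal ((1/4) powr b) \<le> ?M (\<lambda>x. ennreal a * e2ennreal (f x)) \<and>
    ?M (\<lambda>x. ennreal (16 ^ j * a) * e2ennreal (g x)) \<le> 1" for j :: nat
  proof -
    have "\<not> (\<forall>(f, g) \<in> F. f \<in> var_Lebesgue p \<longrightarrow> var_norm p f \<le> ennreal (16 ^ j) * var_norm p g)"
      using violated by blast
    then obtain f g where fg: "(f, g) \<in> F" and f_in: "f \<in> var_Lebesgue p"
      and less: "ennreal (16 ^ j) * var_norm p g < var_norm p f"
      by (metis (no_types, lifting) case_prodI2 not_le)
    note [measurable] = F[OF fg, THEN conjunct1] F[OF fg, THEN conjunct2, THEN conjunct1]
    have nonneg: "0 \<le> f x" "0 \<le> g x" for x
      using F[OF fg] by auto
    have "var_norm p f < \<infinity>"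
      using nonneg(1) by (intro var_norm_finite p1 f_in) auto
    then obtain \<nu> where \<nu>: "var_norm p f = ennreal \<nu>" "0 \<le> \<nu>"
      by (cases "var_norm p f") auto
    have "0 < \<nu>"
    proof (rule ccontr)
      assume "\<not> 0 < \<nu>"
      with \<nu> less show False
        by simp
    qed
    define a where "a = 1 / (2 * \<nu>)"
    have a: "0 < a"
      using \<open>0 < \<nu>\<close> by (simp add: a_def)
    have "modular p f (2 * \<nu>) \<le> 1"
      using \<nu> \<open>0 < \<nu>\<close> nonneg by (intro modular_le_one_of_var_norm_less p_pos) (auto simp: ennreal_less_iff)
    then have upper: "?M (\<lambda>x. ennreal a * e2ennreal (f x)) \<le> 1"
      using \<open>0 < \<nu>\<close> nonneg by (simp add: modular_conv_wmod a_def)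
    have "1 \<le> modular p f (\<nu> / 2)"
    proof (rule ccontr)
      assume "\<not> 1 \<le> modular p f (\<nu> / 2)"
      then have "var_norm p f \<le> ennreal (\<nu> / 2)"
        using \<open>0 < \<nu>\<close> by (intro var_norm_le) auto
      then show False
        using \<nu> \<open>0 < \<nu>\<close> by (simp add: ennreal_le_iff)
    qed
    then have one_le: "1 \<le> ?M (\<lambda>x. ennreal (1 / (\<nu> / 2)) * e2ennreal (f x))"
      using \<open>0 < \<nu>\<close> nonneg by (subst (asm) modular_conv_wmod) auto
    have "ennreal ((1/4) powr b) \<le> ennreal ((1/4) powr b) * ?M (\<lambda>x. ennreal (1 / (\<nu> / 2)) * e2ennreal (f x))"
      using mult_left_mono[OF one_le, of "ennreal ((1/4) powr b)"] by (simp only: mult_1_right zero_le)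
    also have "\<dots> \<le> ?M (\<lambda>x. ennreal (1 / 4) * (ennreal (1 / (\<nu> / 2)) * e2ennreal (f x)))"
      by (rule wmod_scale_ge[OF _ _ _ p_b]) auto
    also have "(\<lambda>x. ennreal (1 / 4) * (ennreal (1 / (\<nu> / 2)) * e2ennreal (f x))) = (\<lambda>x. ennreal a * e2ennreal (f x))"
    proof -
      have "ennreal (1 / 4) * ennreal (1 / (\<nu> / 2)) = ennreal a"
        using \<open>0 < \<nu>\<close> ennreal_mult[of "1 / 4" "1 / (\<nu> / 2)"] by (simp only: a_def) simp
      then show ?thesis
        by (simp only: mult.assoc[symmetric])
    qed
    finally have lower: "ennreal ((1/4) powr b) \<le> ?M (\<lambda>x. ennreal a * e2ennreal (f x))" .
    have "var_norm p g < ennreal (2 * \<nu> / 16 ^ j)"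
    proof (cases "var_norm p g")
      case (real n)
      then have "ennreal (16 ^ j * n) < ennreal \<nu>"
        using less \<nu> by (simp add: ennreal_mult)
      then have "16 ^ j * n < \<nu>"
        using real by (subst (asm) ennreal_less_iff) auto
      also have "\<dots> \<le> 2 * \<nu>"
        using \<open>0 < \<nu>\<close> by simp
      finally show ?thesis
        using real by (simp add: ennreal_less_iff less_divide_eq mult.commute)
    next
      case top
      then show ?thesis
        using less by (simp add: ennreal_mult_top)
    qed
    then have "modular p g (2 * \<nu> / 16 ^ j) \<le> 1"
      using nonneg by (intro modular_le_one_of_var_norm_less p_pos)
    then have "?M (\<lambda>x. ennreal (16 ^ j * a) * e2ennreal (g x)) \<le> 1"
      using \<open>0 < \<nu>\<close> nonneg by (simp add: modular_conv_wmod a_def)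
    then show ?thesis
      using fg a upper lower by blast
  qed
  then show ?thesis
    by metis
qed

lemma weighted_integral_conv_wmod:
  "weighted_integral p \<delta> (\<lambda>x. enn2real (u x) * enn2real (v x) powr (1 - p)) f
    = wmod lebesgue (\<lambda>_. p) (factored_weight p \<delta> u v) (\<lambda>x. e2ennreal (f x))"
  by (simp add: weighted_integral_def wmod_def factored_weight_def)

theorem corollary1p6:
  fixes F :: "((real ^ 'n \<Rightarrow> ereal) \<times> (real ^ 'n \<Rightarrow> ereal)) set"
    and \<delta> p0 pstar \<delta>star :: real
    and p :: "real ^ 'n \<Rightarrow> real"
  assumes F_meas: "\<And>f g. (f, g) \<in> F \<Longrightarrow>
      f \<in> borel_measurable lebesgue \<and> g \<in> borel_measurable lebesgue \<and>
      (\<forall>x. 0 \<le> f x) \<and> (\<forall>x. 0 \<le> g x)"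
    and \<delta>: "0 < \<delta>" "\<delta> < 1"
    and p0: "1 < p0"
    and weighted: "\<exists>C0 :: real \<Rightarrow> real. \<forall>w \<in> Aq p0. \<forall>(f, g) \<in> F.
      weighted_integral p0 \<delta> w f < \<infinity> \<longrightarrow>
      weighted_integral p0 \<delta> w f \<le> ennreal (C0 (Aq_const p0 w)) * weighted_integral p0 \<delta> w g"
    and p_meas: "p \<in> borel_measurable lebesgue"
    and p_pos: "\<And>x. 0 < p x"
    and pstar_lower: "p0 / (1 + \<delta> * (p0 - 1)) < pstar"
    and p_minus: "ereal pstar < essinf lebesgue (\<lambda>x. ereal (p x))"
    and p_minus_plus: "essinf lebesgue (\<lambda>x. ereal (p x)) \<le> esssup lebesgue (\<lambda>x. ereal (p x))"
    and p_plus: "esssup lebesgue (\<lambda>x. ereal (p x)) < ereal (p0 / (1 - \<delta>))"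
    and \<delta>star: "\<delta>star = (p0 - pstar * (1 - \<delta>)) / p0"
    and maximal: "(\<lambda>x. \<delta>star * conj_exponent (p x / pstar)) \<in> maximal_exponents"
  shows "\<exists>C :: real. \<forall>(f, g) \<in> F. f \<in> var_Lebesgue p \<longrightarrow>
      var_norm p f \<le> ennreal C * var_norm p g"
proof (rule ccontr)
  note [measurable] = p_meas
  define G where "G = (\<lambda>(f, g). (\<lambda>x. e2ennreal (f x), \<lambda>x. e2ennreal (g x))) ` F"
  define b where "b = p0 / (1 - \<delta>)"
  define r where "r x = \<delta>star * conj_exponent (p x / pstar)" for x
  let ?M = "wmod lebesgue p (\<lambda>_. 1)"
  have G_meas: "f \<in> borel_measurable lebesgue \<and> g \<in> borel_measurable lebesgue" if fg: "(f, g) \<in> G" for f g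
  proof -
    obtain f' g' where "(f', g') \<in> F" and eq: "f = (\<lambda>x. e2ennreal (f' x))" "g = (\<lambda>x. e2ennreal (g' x))"
      using fg by (auto simp: G_def)
    then have [measurable]: "f' \<in> borel_measurable lebesgue" "g' \<in> borel_measurable lebesgue"
      using F_meas by auto
    show ?thesis
      unfolding eq by simp
  qed
  have den: "0 < 1 + \<delta> * (p0 - 1)"
    using \<delta> p0 by (simp add: add_pos_nonneg)
  have s_lower: "p0 < pstar * (1 + \<delta> * (p0 - 1))"
    using pstar_lower den by (simp add: divide_less_eq)
  have s1: "1 < pstar"
  proof -
    have "1 + \<delta> * (p0 - 1) \<le> 1 + 1 * (p0 - 1)"
      using \<delta> p0 by (intro add_left_mono mult_right_mono) auto
    then have "1 \<le> p0 / (1 + \<delta> * (p0 - 1))"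
      using den by (simp add: le_divide_eq)
    then show ?thesis
      using pstar_lower by linarith
  qed
  have p_lower: "AE x in lebesgue. pstar < p x"
  proof -
    obtain z where z: "AE x in lebesgue. z \<le> ereal (p x)" "ereal pstar < z"
      using p_minus unfolding essinf_def by (auto simp: less_Sup_iff)
    from z(1) show ?thesis
    proof eventually_elim
      fix x assume "z \<le> ereal (p x)"
      with z(2) have "ereal pstar < ereal (p x)"
        by (rule less_le_trans)
      then show "pstar < p x"
        by simp
    qed
  qed
  have p_upper: "AE x in lebesgue. p x < b"
    using esssup_AE[where M = lebesgue and f = "\<lambda>x. ereal (p x)"]
  proof eventually_elim
    fix x assume "ereal (p x) \<le> esssup lebesgue (\<lambda>x. ereal (p x))"
    then have "ereal (p x) < ereal b"
      using p_plus unfolding b_def by (rule le_less_trans)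
    then show "p x < b"
      by simp
  qed
  \<comment> \<open>The inequality \<open>pstar < b\<close> between constants is read off at one
    point where both bounds hold.\<close>
  have "AE x in lebesgue. pstar < p x \<and> p x < b"
    using p_lower p_upper by eventually_elim simp
  then obtain x where "x \<in> ball 0 1" "pstar < p x \<and> p x < b"
    using AE_lebesgue_ball_ex[of "\<lambda>x. pstar < p x \<and> p x < b" 1 0] by auto
  then have "pstar < b"
    by linarith
  then have s_upper: "pstar * (1 - \<delta>) < p0"
    using \<delta> by (simp add: b_def less_divide_eq)
  \<comment> \<open>\<open>\<delta>star \<le> 1\<close> will allow the loss
    \<open>(4 ^ (j + 2)) powr \<delta>star\<close> to be replaced by
    \<open>4 ^ (j + 2)\<close>.\<close>
  have ds: "0 < \<delta>star" "\<delta>star \<le> 1"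
    using s_upper p0 s1 \<delta> by (auto simp: \<delta>star)
  have r_eq: "r x = \<delta>star * (p x / (p x - pstar))" if "pstar < p x" for x
    using that s1 by (simp add: r_def conj_exponent_def divide_simps)
  have hyp: "\<exists>C::real. \<forall>(f, g)\<in>G. wmod lebesgue (\<lambda>_. p0) (factored_weight p0 \<delta> u v) f < \<infinity> \<longrightarrow>
      wmod lebesgue (\<lambda>_. p0) (factored_weight p0 \<delta> u v) f
        \<le> ennreal C * wmod lebesgue (\<lambda>_. p0) (factored_weight p0 \<delta> u v) g"
    if "A1 u" "A1 v" for u v :: "real ^ 'n \<Rightarrow> ennreal"
  proof -
    let ?w = "\<lambda>x. enn2real (u x) * enn2real (v x) powr (1 - p0)"
    obtain C0 :: "real \<Rightarrow> real" where C0: "\<forall>w \<in> Aq p0. \<forall>(f, g) \<in> F.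
        weighted_integral p0 \<delta> w f < \<infinity> \<longrightarrow>
        weighted_integral p0 \<delta> w f \<le> ennreal (C0 (Aq_const p0 w)) * weighted_integral p0 \<delta> w g"
      using weighted by (rule exE)
    have "\<forall>(f, g) \<in> F. weighted_integral p0 \<delta> ?w f < \<infinity> \<longrightarrow>
        weighted_integral p0 \<delta> ?w f \<le> ennreal (C0 (Aq_const p0 ?w)) * weighted_integral p0 \<delta> ?w g"
      using C0 A1_factor_in_Aq[OF that p0] by (rule bspec)
    then show ?thesis
      unfolding weighted_integral_conv_wmod G_def by (intro exI[of _ "C0 (Aq_const p0 ?w)"]) auto
  qed
  assume violated: "\<not> ?thesis"
  have p_bounds: "AE x in lebesgue. 1 \<le> p x \<and> p x \<le> b"
    using p_lower p_upper by eventually_elim (use s1 in simp)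
  have "\<exists>f g a. \<forall>j::nat. (f j, g j) \<in> F \<and> 0 < a j \<and>
    ?M (\<lambda>x. ennreal (a j) * e2ennreal (f j x)) \<le> 1 \<and>
    ennreal ((1/4) powr b) \<le> ?M (\<lambda>x. ennreal (a j) * e2ennreal (f j x)) \<and>
    ?M (\<lambda>x. ennreal (16 ^ j * a j) * e2ennreal (g j x)) \<le> 1"
    by (rule var_norm_violating_sequence[OF F_meas p_meas p_bounds violated])
  then obtain f g a where seq_all: "\<forall>j::nat. (f j, g j) \<in> F \<and> 0 < a j \<and>
    ?M (\<lambda>x. ennreal (a j) * e2ennreal (f j x)) \<le> 1 \<and>
    ennreal ((1/4) powr b) \<le> ?M (\<lambda>x. ennreal (a j) * e2ennreal (f j x)) \<and>
    ?M (\<lambda>x. ennreal (16 ^ j * a j) * e2ennreal (g j x)) \<le> 1"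
    by (elim exE)
  have seq: "(f j, g j) \<in> F" "0 < a j" for j
    using seq_all by auto
  have [measurable]: "f j \<in> borel_measurable lebesgue" "g j \<in> borel_measurable lebesgue" for j
    using F_meas[OF seq(1)] by auto
  define \<phi> where "\<phi> j x = ennreal (a j) * e2ennreal (f j x)" for j x
  define \<gamma> where "\<gamma> j x = ennreal (16 ^ j * a j) * e2ennreal (g j x)" for j x
  have [measurable]: "\<phi> j \<in> borel_measurable lebesgue" "\<gamma> j \<in> borel_measurable lebesgue" for j
    unfolding \<phi>_def \<gamma>_def by measurable
  define \<kappa> where "\<kappa> = (1/4) powr b"
  have \<kappa>: "0 < \<kappa>"
    by (simp add: \<kappa>_def)
  have M: "?M (\<phi> j) \<le> 1" "ennreal \<kappa> \<le> ?M (\<phi> j)" "?M (\<gamma> j) \<le> 1" for j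
    using seq_all by (simp_all add: \<phi>_def[abs_def] \<gamma>_def[abs_def] \<kappa>_def)
  \<comment> \<open>The extremal choice in Hoelder's inequality for \<open>p x / pstar\<close>: to
    the power \<open>r x\<close> it returns \<open>\<phi> j x\<close> to the power
    \<open>p x\<close>, and to the power \<open>\<delta>star\<close> it supplies the missing power
    \<open>p x - pstar\<close>.\<close>
  define k where "k j x = enn_powr (\<phi> j x) ((p x - pstar) / \<delta>star)" for j x
  have [measurable]: "k j \<in> borel_measurable lebesgue" for j
    unfolding k_def by measurable
  have k_mod: "wmod lebesgue r (\<lambda>_. 1) (k j) = ?M (\<phi> j)" for j
    unfolding wmod_def using p_lower
  proof (intro nn_integral_cong_AE, eventually_elim)
    fix x assume px: "pstar < p x"
    then have "(p x - pstar) / \<delta>star * r x = p x"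
      using ds by (simp add: r_eq)
    moreover have "0 < r x"
      using px ds s1 by (simp add: r_eq)
    ultimately show "enn_powr (k j x) (r x) * 1 = enn_powr (\<phi> j x) (p x) * 1"
      using px ds by (simp add: k_def enn_powr_powr)
  qed
  obtain W where W: "A1 W" "wmod lebesgue r (\<lambda>_. 1) W \<le> 1" "\<And>j x. k j x \<le> ennreal (4 ^ (j + 2)) * W x"
  proof (rule maximal_exponents_A1_majorant[of r k])
    show "r \<in> maximal_exponents"
      using maximal by (simp add: r_def[abs_def])
    show "wmod lebesgue r (\<lambda>_. 1) (k j) \<le> 1" for j
      unfolding k_mod by (rule M)
    show "wmod lebesgue r (\<lambda>_. 1) (k 0) \<noteq> 0"
      using M(2)[of 0] \<kappa> unfolding k_mod by auto
  qed simp_all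
  note [measurable] = A1_D(1)[OF W(1)]
  let ?J = "wmod lebesgue (\<lambda>_. pstar) (\<lambda>x. enn_powr (W x) \<delta>star)"
  have "\<exists>C::real. \<forall>(f, g)\<in>G. ?J f < \<infinity> \<longrightarrow> ?J f \<le> ennreal C * ?J g"
    by (rule A1_extrapolation[OF G_meas \<delta> p0 s_lower s_upper \<delta>star hyp W(1)])
  then obtain C where C: "\<forall>(f, g)\<in>G. ?J f < \<infinity> \<longrightarrow> ?J f \<le> ennreal C * ?J g"
    by (rule exE)
  have r_meas [measurable]: "r \<in> borel_measurable lebesgue"
    using maximal by (simp add: maximal_exponents_def r_def[abs_def])
  \<comment> \<open>Pointwise Young for \<open>p x / pstar\<close> and its conjugate. Since
    \<open>r x\<close> is \<open>\<delta>star\<close> times the conjugate, the second term is the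
    modular of \<open>W\<close>.\<close>
  have J_le: "?J h \<le> 2" if [measurable]: "h \<in> borel_measurable lebesgue" and h: "?M h \<le> 1" for h
  proof -
    have "?J h \<le> (\<integral>\<^sup>+ x. enn_powr (h x) (p x) * 1 + enn_powr (W x) (r x) * 1 \<partial>lebesgue)"
      unfolding wmod_def using p_lower
    proof (intro nn_integral_mono_AE, eventually_elim)
      fix x assume px: "pstar < p x"
      have "enn_powr (enn_powr (W x) \<delta>star) (p x / (p x - pstar)) = enn_powr (W x) (r x)"
        using px ds s1 by (simp add: enn_powr_powr r_eq)
      then show "enn_powr (h x) pstar * enn_powr (W x) \<delta>star
          \<le> enn_powr (h x) (p x) * 1 + enn_powr (W x) (r x) * 1"
        using enn_powr_Young[of pstar "p x" "h x" "enn_powr (W x) \<delta>star"] px s1 by simp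
    qed
    also have "\<dots> = ?M h + wmod lebesgue r (\<lambda>_. 1) W"
      unfolding wmod_def by (rule nn_integral_add) measurable
    also have "\<dots> \<le> 1 + 1"
      by (intro add_mono h W)
    finally show ?thesis
      by simp
  qed
  have lower: "ennreal \<kappa> \<le> ennreal ((4 ^ (j + 2)) powr \<delta>star) * ?J (\<phi> j)" for j
  proof -
    have "?M (\<phi> j) \<le> (\<integral>\<^sup>+ x. ennreal ((4 ^ (j + 2)) powr \<delta>star) *
        (enn_powr (\<phi> j x) pstar * enn_powr (W x) \<delta>star) \<partial>lebesgue)"
      unfolding wmod_def using p_lower
    proof (intro nn_integral_mono_AE, eventually_elim)
      fix x assume px: "pstar < p x"
      have "enn_powr (\<phi> j x) (p x - pstar) = enn_powr (k j x) \<delta>star"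
        using px ds by (simp add: k_def enn_powr_powr)
      also have "\<dots> \<le> enn_powr (ennreal (4 ^ (j + 2)) * W x) \<delta>star"
        using ds W(3) by (intro enn_powr_mono) auto
      also have "\<dots> = ennreal ((4 ^ (j + 2)) powr \<delta>star) * enn_powr (W x) \<delta>star"
        using ds by (simp add: enn_powr_mult enn_powr_ennreal)
      finally have "enn_powr (\<phi> j x) pstar * enn_powr (\<phi> j x) (p x - pstar)
          \<le> enn_powr (\<phi> j x) pstar * (ennreal ((4 ^ (j + 2)) powr \<delta>star) * enn_powr (W x) \<delta>star)"
        by (rule mult_left_mono) simp
      moreover have "enn_powr (\<phi> j x) (p x) = enn_powr (\<phi> j x) pstar * enn_powr (\<phi> j x) (p x - pstar)"
        using px s1 enn_powr_add[of pstar "p x - pstar" "\<phi> j x"] by simp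
      ultimately show "enn_powr (\<phi> j x) (p x) * 1
          \<le> ennreal ((4 ^ (j + 2)) powr \<delta>star) * (enn_powr (\<phi> j x) pstar * enn_powr (W x) \<delta>star)"
        by (simp only: mult_1_right mult.left_commute)
    qed
    also have "\<dots> = ennreal ((4 ^ (j + 2)) powr \<delta>star) * ?J (\<phi> j)"
      unfolding wmod_def by (rule nn_integral_cmult) measurable
    finally show ?thesis
      using M(2)[of j] by (rule order_trans[rotated])
  qed
  \<comment> \<open>The constant-exponent argument again, with \<open>\<kappa>\<close> in place of
    the normalisation 1 and the bound 2 from \<open>J_le\<close>.\<close>
  have "\<kappa> * 4 ^ j \<le> 16 * (max C 0 * 2)" for j
  proof -
    have fin: "?J (\<phi> j) \<le> 2" "?J (\<gamma> j) \<le> 2"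
      by (intro J_le M; measurable)+
    then obtain t where t: "?J (\<phi> j) = ennreal t" "0 \<le> t"
      by (cases "?J (\<phi> j)") (auto simp: top_unique)
    have "((\<lambda>x. e2ennreal (f j x)), (\<lambda>x. e2ennreal (g j x))) \<in> G"
      unfolding G_def using seq(1)[of j] by (rule rev_image_eqI) simp
    with C have CG: "?J (\<lambda>x. e2ennreal (f j x)) < \<infinity> \<Longrightarrow>
        ?J (\<lambda>x. e2ennreal (f j x)) \<le> ennreal C * ?J (\<lambda>x. e2ennreal (g j x))"
      by blast
    have "ennreal ((16 ^ j) powr pstar) * ?J (\<phi> j) \<le> ennreal C * ?J (\<gamma> j)"
      unfolding \<phi>_def \<gamma>_def
    proof (rule wmod_scaled_transfer)
      show "?J (\<lambda>x. ennreal (a j) * e2ennreal (f j x)) < \<infinity>"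
        using t by (simp add: \<phi>_def[abs_def])
    qed (use seq s1 CG in auto)
    also have "\<dots> \<le> ennreal (max C 0) * ennreal 2"
      using fin by (intro mult_mono ennreal_leI) auto
    also have "\<dots> = ennreal (max C 0 * 2)"
      by (rule ennreal_mult[symmetric]) auto
    finally have "(16 ^ j) powr pstar * t \<le> max C 0 * 2"
      using t by (simp flip: ennreal_mult)
    moreover have "\<kappa> \<le> (4 ^ (j + 2)) powr \<delta>star * t"
      using lower[of j] t \<kappa> by (simp flip: ennreal_mult)
    moreover have "(4 ^ (j + 2)) powr \<delta>star \<le> (4::real) ^ (j + 2)"
      using powr_mono[OF ds(2) one_le_power[of "4::real" "j + 2"]] by simp
    moreover have "(16::real) ^ j \<le> (16 ^ j) powr pstar"
      using powr_mono[OF less_imp_le[OF s1] one_le_power[of "16::real" j]] by simp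
    ultimately have "16 ^ j * t \<le> max C 0 * 2" "\<kappa> \<le> 4 ^ (j + 2) * t"
      using t(2) by (meson mult_right_mono order_trans)+
    then show ?thesis
      by (rule geometric_gap)
  qed
  then show False
    using no_geometric_growth[of \<kappa> "16 * (max C 0 * 2)"] \<kappa> by simp
qed

end
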